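(* Let $r\ge 2$ and let $f:\Omega_{r,r}\to\Omega_{r+1,r+1}$ be a proper holomorphic map. Suppose that $f$ preserves the maximal invariantly geodesic subspaces and that an induced proper map $g:D_{r,r}\to D_{r+1,r+1}$ (i.e. a proper map with $f(X^\#)\subset g(X)^\#$ for generic $X\in D_{r,r}$) is a proper monomial rational map such that either $\mathrm{degree}(g)\le 2$, or $Q_P$ has degree $1$, or the coefficients of $Q_P$ are nonnegative. Then $f$ is equivalent to one of the following: (1) $f(Z)=\begin{pmatrix} Z&0\\ 0&h(Z)\end{pmatrix}$ for $Z\in\Omega_{r,r}$, for some holomorphic map $h:\Omega_{r,r}\to\Delta=\{z\in\mathbb{C}:|z|<1\}$; (2) ($r=2$) $f\left(\begin{pmatrix} z_1&z_2\\ z_3&z_4\end{pmatrix}\right)=\begin{pmatrix} z_1^2&z_1z_2&z_2\\ z_1z_3&z_2z_3&z_4\\ z_3&z_4&0\end{pmatrix}$ for $\begin{pmatrix} z_1&z_2\\ z_3&z_4\end{pmatrix}\in\Omega_{2,2}$; (3) ($r=2$) $f\left(\begin{pmatrix} z_1&z_2\\ z_3&z_4\end{pmatrix}\right)=\begin{pmatrix} z_1^2&\sqrt2 z_1z_2&z_2^2\\ \sqrt2 z_1z_3&z_1z_4+z_2z_3&\sqrt2 z_2z_4\\ z_3^2&\sqrt2 z_3z_4&z_4^2\end{pmatrix}$ for $\begin{pmatrix} z_1&z_2\\ z_3&z_4\end{pmatrix}\in\Omega_{2,2}$.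
   Context: $M(r,s,\mathbb{C})$ is the set of complex $r\times s$ matrices, and $\Omega_{r,s}=\{Z\in M(r,s,\mathbb{C}): I_{r,r}-ZZ^*>0\}$ (positive definite; $I_{r,r}$ is the $r\times r$ identity matrix), the bounded symmetric domain of type I. The generalized ball is $D_{r,s}=\{[z_1,\dots,z_{r+s}]\in\mathbb{P}^{r+s-1}: |z_1|^2+\dots+|z_r|^2>|z_{r+1}|^2+\dots+|z_{r+s}|^2\}$. Holomorphic maps $f,g:\Omega_1\to\Omega_2$ between domains are equivalent if $f=A\circ g\circ B$ for some $B\in\mathrm{Aut}(\Omega_1)$, $A\in\mathrm{Aut}(\Omega_2)$, where $\mathrm{Aut}$ denotes the group of holomorphic automorphisms. For $X=[A,B]\in D_{r,s}$ with $A\in M(1,r,\mathbb{C})$, $B\in M(1,s,\mathbb{C})$, put $X^\#=\{Z\in\Omega_{r,s}: AZ=B\}$. These subspaces $X^\#$ are the maximal invariantly geodesic subspaces of $\Omega_{r,s}$. The map $f$ preserves the maximal invariantly geodesic subspaces if it maps each such subspace of the source into such a subspace of the target. For such a proper $f:\Omega_{r,r}\to\Omega_{r+1,r+1}$, an induced map is a map $g:D_{r,r}\to D_{r+1,r+1}$ with $f(X^\#)\subset g(X)^\#$ for generic $X\in D_{r,r}$ (i.e. for $X$ outside a proper complex analytic subset). A rational map $g:D_{r,s}\to D_{r',s'}$ (a rational map $\mathbb{P}^{r+s-1}\to\mathbb{P}^{r'+s'-1}$ sending points of $D_{r,s}$ outside the indeterminacy into $D_{r',s'}$) is proper if for any $x\in\partial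 D_{r,s}$ and any open neighborhood $U$ of $x$ which does not intersect the indeterminacy of $g$, $g$ is proper on $U\cap D_{r,s}$ (i.e. boundary points of $D_{r,s}$ in $U$ are approached only with images approaching $\partial D_{r',s'}$). Writing $g=[g_1,\dots,g_{r'+s'}]$ in homogeneous coordinates, $g$ is monomial if each $g_i$ is a (constant multiple of a) monomial in $z_1,\dots,z_{r+s}$, all of the same degree, which is $\mathrm{degree}(g)$; it is assumed throughout that the components $g_i$ have no common factor. For a proper monomial rational map $g$, let $P:\mathbb{R}^{r+s}\to\mathbb{R}$ be the homogeneous polynomial with $P(|z_1|^2,\dots,|z_{r+s}|^2)=\sum_{k=1}^{r'}|g_k|^2-\sum_{k=r'+1}^{r'+s'}|g_k|^2$. Then $P(x)=\left(\sum_{j=1}^r x_j-\sum_{j=r+1}^{r+s}x_j\right)^m Q_P(x)$ for a positive integer $m$ and a homogeneous polynomial $Q_P$ not identically zero on the hyperplane $\sum_{j=1}^r x_j=\sum_{j=r+1}^{r+s}x_j$; this defines $Q_P$. *)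

theory Defs
  imports "HOL-Analysis.Analysis" "HOL-Library.Poly_Mapping"
begin

section \<open>Holomorphic maps of several variables\<close>

text \<open>Complex (Frechet) differentiability at every point of an open set: the real derivative exists
  and is linear for the complex scalar multiplications \<open>sa\<close>, \<open>sb\<close> of source and target.\<close>

definition cdiff_on ::
  "(complex \<Rightarrow> 'a::real_normed_vector \<Rightarrow> 'a) \<Rightarrow> (complex \<Rightarrow> 'b::real_normed_vector \<Rightarrow> 'b)
    \<Rightarrow> ('a \<Rightarrow> 'b) \<Rightarrow> 'a set \<Rightarrow> bool" where
  "cdiff_on sa sb f S \<longleftrightarrow> open S \<and>
     (\<forall>x\<in>S. \<exists>D. (f has_derivative D) (at x) \<and> Vector_Spaces.linear sa sb D)"

text \<open>Complex \<open>r \<times> s\<close> matrices have type \<open>complex^'s^'r\<close>, the entry in row \<open>i\<close> and column \<open>j\<close>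
  being \<open>Z $ i $ j\<close>.\<close>

definition cscale_mat :: "complex \<Rightarrow> complex^'s::finite^'r::finite \<Rightarrow> complex^'s^'r" where
  "cscale_mat c Z = (\<chi> i j. c * Z $ i $ j)"

abbreviation mat_holomorphic_on ::
  "(complex^'s::finite^'r::finite \<Rightarrow> complex^'q::finite^'p::finite) \<Rightarrow> (complex^'s^'r) set \<Rightarrow> bool" where
  "mat_holomorphic_on \<equiv> cdiff_on cscale_mat cscale_mat"

abbreviation fun_holomorphic_on ::
  "(complex^'s::finite^'r::finite \<Rightarrow> complex) \<Rightarrow> (complex^'s^'r) set \<Rightarrow> bool" where
  "fun_holomorphic_on \<equiv> cdiff_on cscale_mat (*)"


section \<open>Bounded symmetric domains of type I\<close>

definition adjoint_mat :: "complex^'s::finite^'r::finite \<Rightarrow> complex^'r^'s" where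
  "adjoint_mat Z = (\<chi> i j. cnj (Z $ j $ i))"

definition pos_def :: "complex^'r::finite^'r \<Rightarrow> bool" where
  "pos_def M \<longleftrightarrow> adjoint_mat M = M \<and>
     (\<forall>v. v \<noteq> 0 \<longrightarrow> Re (\<Sum>i\<in>UNIV. \<Sum>j\<in>UNIV. cnj (v $ i) * M $ i $ j * v $ j) > 0)"

definition type1_domain :: "(complex^'s::finite^'r::finite) set" where
  "type1_domain = {Z. pos_def (mat 1 - Z ** adjoint_mat Z)}"

definition automorphisms ::
  "(complex^'s::finite^'r::finite) set \<Rightarrow> (complex^'s^'r \<Rightarrow> complex^'s^'r) set" where
  "automorphisms \<Omega> = {\<phi>. bij_betw \<phi> \<Omega> \<Omega> \<and> mat_holomorphic_on \<phi> \<Omega> \<and>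
     mat_holomorphic_on (inv_into \<Omega> \<phi>) \<Omega>}"

text \<open>HOL functions being total, maps between domains are compared on the source domain only.\<close>

definition equivalent_maps ::
  "(complex^'s::finite^'r::finite) set \<Rightarrow> (complex^'q::finite^'p::finite) set
    \<Rightarrow> (complex^'s^'r \<Rightarrow> complex^'q^'p) \<Rightarrow> (complex^'s^'r \<Rightarrow> complex^'q^'p) \<Rightarrow> bool" where
  "equivalent_maps \<Omega>1 \<Omega>2 f g \<longleftrightarrow>
     f ` \<Omega>1 \<subseteq> \<Omega>2 \<and> mat_holomorphic_on f \<Omega>1 \<and> g ` \<Omega>1 \<subseteq> \<Omega>2 \<and> mat_holomorphic_on g \<Omega>1 \<and>
     (\<exists>A\<in>automorphisms \<Omega>2. \<exists>B\<in>automorphisms \<Omega>1. \<forall>Z\<in>\<Omega>1. f Z = A (g (B Z)))"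


section \<open>Complex projective space\<close>

text \<open>Homogeneous coordinates are indexed by \<open>'n\<close>, so \<open>'n proj\<close> has dimension \<open>CARD('n) - 1\<close>.
  The point \<open>[v]\<close> is \<open>abs_proj v\<close>, meaningful for \<open>v \<noteq> 0\<close>; \<open>rep_proj X\<close> is some choice of
  homogeneous coordinates of \<open>X\<close>.\<close>

definition proj_rel :: "complex^'n::finite \<Rightarrow> complex^'n \<Rightarrow> bool" where
  "proj_rel v w \<longleftrightarrow> v \<noteq> 0 \<and> w \<noteq> 0 \<and> (\<exists>c. c \<noteq> 0 \<and> w = c *s v)"

lemma part_equivp_proj_rel: "part_equivp proj_rel"
proof (rule part_equivpI)
  show "\<exists>x::complex^'n. proj_rel x x"
    by (intro exI[of _ "1::complex^'n"]) (auto simp: proj_rel_def vec_eq_iff intro: exI[of _ 1])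
  show "symp (proj_rel :: complex^'n \<Rightarrow> _)"
  proof (rule sympI)
    fix v w :: "complex^'n"
    assume "proj_rel v w"
    then obtain c where c: "v \<noteq> 0" "w \<noteq> 0" "c \<noteq> 0" "w = c *s v" by (auto simp: proj_rel_def)
    then have "v = inverse c *s w" by (simp add: vec_eq_iff)
    with c show "proj_rel w v" unfolding proj_rel_def by (metis inverse_nonzero_iff_nonzero)
  qed
  show "transp (proj_rel :: complex^'n \<Rightarrow> _)"
  proof (rule transpI)
    fix u v w :: "complex^'n"
    assume "proj_rel u v" "proj_rel v w"
    then obtain c d where "u \<noteq> 0" "w \<noteq> 0" "c \<noteq> 0" "d \<noteq> 0" "v = c *s u" "w = d *s v"
      by (auto simp: proj_rel_def)
    then show "proj_rel u w"
      unfolding proj_rel_def by (metis mult_eq_0_iff vector_smult_assoc)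
  qed
qed

quotient_type (overloaded) 'n proj = "complex^'n::finite" / partial: proj_rel
  by (rule part_equivp_proj_rel)

instantiation proj :: (finite) topological_space
begin

text \<open>The quotient topology.\<close>

definition open_proj :: "'a proj set \<Rightarrow> bool" where
  "open_proj U \<longleftrightarrow> open {v. v \<noteq> 0 \<and> abs_proj v \<in> U}"

instance
proof
  have "{v::complex^'a. v \<noteq> 0 \<and> abs_proj v \<in> UNIV} = - {0}" by auto
  then show "open (UNIV :: 'a proj set)" by (simp add: open_proj_def open_Compl)
next
  fix S T :: "'a proj set"
  assume "open S" "open T"
  moreover have "{v. v \<noteq> 0 \<and> abs_proj v \<in> S \<inter> T}
      = {v. v \<noteq> 0 \<and> abs_proj v \<in> S} \<inter> {v. v \<noteq> 0 \<and> abs_proj v \<in> T}" by auto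
  ultimately show "open (S \<inter> T)" by (simp add: open_proj_def open_Int)
next
  fix K :: "'a proj set set"
  assume "\<forall>S\<in>K. open S"
  moreover have "{v. v \<noteq> 0 \<and> abs_proj v \<in> \<Union>K} = (\<Union>S\<in>K. {v. v \<noteq> 0 \<and> abs_proj v \<in> S})" by auto
  ultimately show "open (\<Union>K)" by (simp add: open_proj_def open_UN)
qed

end

text \<open>A function on an open subset of projective space is holomorphic iff its pullback to the cone
  over that subset is.\<close>

definition proj_holomorphic_on :: "('n::finite proj \<Rightarrow> complex) \<Rightarrow> 'n proj set \<Rightarrow> bool" where
  "proj_holomorphic_on \<phi> U \<longleftrightarrow>
     cdiff_on (*s) (*) (\<lambda>v. \<phi> (abs_proj v)) {v. v \<noteq> 0 \<and> abs_proj v \<in> U}"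

definition analytic_subset :: "'n::finite proj set \<Rightarrow> 'n proj set \<Rightarrow> bool" where
  "analytic_subset D S \<longleftrightarrow> S \<subseteq> D \<and>
     (\<forall>X\<in>D. \<exists>U F. open U \<and> X \<in> U \<and> U \<subseteq> D \<and> finite F \<and> (\<forall>\<phi>\<in>F. proj_holomorphic_on \<phi> U) \<and>
        S \<inter> U = {Y\<in>U. \<forall>\<phi>\<in>F. \<phi> Y = 0})"


section \<open>Generalized balls and maximal invariantly geodesic subspaces\<close>

text \<open>The coordinates \<open>z\<^sub>1, \<dots>, z\<^sub>r\<close> are indexed by \<open>Inl\<close>, and \<open>z\<^sub>r\<^sub>+\<^sub>1, \<dots>, z\<^sub>r\<^sub>+\<^sub>s\<close> by \<open>Inr\<close>.\<close>

definition gen_ball :: "('r::finite + 's::finite) proj set" where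
  "gen_ball = {abs_proj z |z.
     (\<Sum>i\<in>UNIV. (cmod (z $ Inl i))\<^sup>2) > (\<Sum>j\<in>UNIV. (cmod (z $ Inr j))\<^sup>2)}"

definition sharp :: "('r::finite + 's::finite) proj \<Rightarrow> (complex^'s^'r) set" where
  "sharp X = {Z \<in> type1_domain.
     (\<chi> i. rep_proj X $ Inl i) v* Z = (\<chi> j. rep_proj X $ Inr j)}"

definition max_inv_geodesic_subspaces :: "(complex^'s::finite^'r::finite) set set" where
  "max_inv_geodesic_subspaces = sharp ` gen_ball"

definition preserves_max_inv_geodesic ::
  "(complex^'s::finite^'r::finite \<Rightarrow> complex^'q::finite^'p::finite) \<Rightarrow> bool" where
  "preserves_max_inv_geodesic f \<longleftrightarrow>
     (\<forall>S\<in>max_inv_geodesic_subspaces. \<exists>T\<in>max_inv_geodesic_subspaces. f ` S \<subseteq> T)"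


section \<open>Polynomials and rational maps\<close>

text \<open>Multivariate polynomials in variables indexed by \<open>'n\<close>: finitely supported functions from
  exponent vectors to coefficients.\<close>

type_synonym ('n, 'a) mpolynomial = "('n \<Rightarrow>\<^sub>0 nat) \<Rightarrow>\<^sub>0 'a"

definition peval :: "('n::finite, 'a::comm_semiring_1) mpolynomial \<Rightarrow> 'a^'n \<Rightarrow> 'a" where
  "peval p x = (\<Sum>m\<in>Poly_Mapping.keys p.
     Poly_Mapping.lookup p m * (\<Prod>i\<in>UNIV. (x $ i) ^ Poly_Mapping.lookup m i))"

definition exp_sum :: "('n::finite \<Rightarrow>\<^sub>0 nat) \<Rightarrow> nat" where
  "exp_sum m = (\<Sum>i\<in>UNIV. Poly_Mapping.lookup m i)"

definition homogeneous :: "nat \<Rightarrow> ('n::finite, 'a::zero) mpolynomial \<Rightarrow> bool" where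
  "homogeneous d p \<longleftrightarrow> (\<forall>m\<in>Poly_Mapping.keys p. exp_sum m = d)"

definition total_degree :: "('n::finite, 'a::zero) mpolynomial \<Rightarrow> nat" where
  "total_degree p = Max (insert 0 (exp_sum ` Poly_Mapping.keys p))"

text \<open>A rational map of projective spaces, given by homogeneous components of the same degree
  without common factor. Some components may be zero, but not all of them.\<close>

definition rational_map :: "('k::finite \<Rightarrow> ('n::finite, complex) mpolynomial) \<Rightarrow> bool" where
  "rational_map g \<longleftrightarrow> (\<exists>d. \<forall>k. homogeneous d (g k)) \<and> (\<exists>k. g k \<noteq> 0) \<and>
     (\<forall>q. (\<forall>k. q dvd g k) \<longrightarrow> q dvd 1)"

definition map_degree :: "('k::finite \<Rightarrow> ('n::finite, complex) mpolynomial) \<Rightarrow> nat" where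
  "map_degree g = Max (range (\<lambda>k. total_degree (g k)))"

definition monomial_map :: "('k::finite \<Rightarrow> ('n::finite, complex) mpolynomial) \<Rightarrow> bool" where
  "monomial_map g \<longleftrightarrow> (\<forall>k. \<exists>\<alpha> c. g k = Poly_Mapping.single \<alpha> c)"

definition indeterminacy :: "('k::finite \<Rightarrow> ('n::finite, complex) mpolynomial) \<Rightarrow> 'n proj set" where
  "indeterminacy g = {X. \<forall>k. peval (g k) (rep_proj X) = 0}"

text \<open>Meaningful for \<open>X \<notin> indeterminacy g\<close>.\<close>

definition rat_app ::
  "('k::finite \<Rightarrow> ('n::finite, complex) mpolynomial) \<Rightarrow> 'n proj \<Rightarrow> 'k proj" where
  "rat_app g X = abs_proj (\<chi> k. peval (g k) (rep_proj X))"

text \<open>A rational map between generalized balls, and its properness: near boundary points that have a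
  neighbourhood avoiding the indeterminacy, points of the ball tending to the boundary have images
  tending to the boundary, that is, eventually inside every neighbourhood of the boundary.\<close>

definition ball_rational_map ::
  "('p::finite + 'q::finite \<Rightarrow> ('r::finite + 's::finite, complex) mpolynomial) \<Rightarrow> bool" where
  "ball_rational_map g \<longleftrightarrow> rational_map g \<and>
     (\<forall>X \<in> gen_ball - indeterminacy g. rat_app g X \<in> gen_ball)"

definition proper_ball_rational_map ::
  "('p::finite + 'q::finite \<Rightarrow> ('r::finite + 's::finite, complex) mpolynomial) \<Rightarrow> bool" where
  "proper_ball_rational_map g \<longleftrightarrow> ball_rational_map g \<and>
     (\<forall>X \<in> frontier gen_ball. \<forall>U. open U \<and> X \<in> U \<and> U \<inter> indeterminacy g = {} \<longrightarrow>
        (\<forall>Y \<in> frontier gen_ball \<inter> U. \<forall>V. open V \<and> frontier gen_ball \<subseteq> V \<longrightarrow>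
           (\<forall>\<^sub>F W in at Y within (U \<inter> gen_ball). rat_app g W \<in> V)))"

definition induced_map ::
  "(complex^'s::finite^'r::finite \<Rightarrow> complex^'q::finite^'p::finite)
    \<Rightarrow> ('p + 'q \<Rightarrow> ('r + 's, complex) mpolynomial) \<Rightarrow> bool" where
  "induced_map f g \<longleftrightarrow> ball_rational_map g \<and>
     (\<exists>S. analytic_subset gen_ball S \<and> S \<noteq> gen_ball \<and>
        (\<forall>X \<in> gen_ball - S. X \<notin> indeterminacy g \<and> f ` sharp X \<subseteq> sharp (rat_app g X)))"

definition norm_polynomial ::
  "('p::finite + 'q::finite \<Rightarrow> ('n::finite, complex) mpolynomial) \<Rightarrow> ('n, real) mpolynomial \<Rightarrow> bool" where
  "norm_polynomial g P \<longleftrightarrow> (\<exists>d. homogeneous d P) \<and>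
     (\<forall>z. peval P (\<chi> i. (cmod (z $ i))\<^sup>2) =
        (\<Sum>k\<in>UNIV. (cmod (peval (g (Inl k)) z))\<^sup>2) - (\<Sum>k\<in>UNIV. (cmod (peval (g (Inr k)) z))\<^sup>2))"

definition sign_form :: "real^('r::finite + 's::finite) \<Rightarrow> real" where
  "sign_form x = (\<Sum>j\<in>UNIV. x $ Inl j) - (\<Sum>j\<in>UNIV. x $ Inr j)"

text \<open>\<open>Q\<close> is the (unique) polynomial \<open>Q\<^sub>P\<close>.\<close>

definition is_quotient_polynomial ::
  "('p::finite + 'q::finite \<Rightarrow> ('r::finite + 's::finite, complex) mpolynomial)
    \<Rightarrow> ('r + 's, real) mpolynomial \<Rightarrow> bool" where
  "is_quotient_polynomial g Q \<longleftrightarrow>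
     (\<exists>P m. norm_polynomial g P \<and> m > 0 \<and> (\<exists>d. homogeneous d Q) \<and>
        (\<forall>x. peval P x = sign_form x ^ m * peval Q x) \<and>
        (\<exists>x. sign_form x = 0 \<and> peval Q x \<noteq> 0))"


section \<open>The model maps\<close>

text \<open>Indices of the target matrices range over \<open>'r option\<close>, the last index being \<open>None\<close>.\<close>

definition block_map ::
  "(complex^'r::finite^'r \<Rightarrow> complex) \<Rightarrow> complex^'r^'r \<Rightarrow> complex^('r option)^('r option)" where
  "block_map h Z = (\<chi> a b. case (a, b) of
      (Some i, Some j) \<Rightarrow> Z $ i $ j
    | (None, None) \<Rightarrow> h Z
    | _ \<Rightarrow> 0)"

definition triple :: "'r \<Rightarrow> 'r \<Rightarrow> 'b \<Rightarrow> 'b \<Rightarrow> 'b \<Rightarrow> 'r option \<Rightarrow> 'b" where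
  "triple p q x y z a = (if a = Some p then x else if a = Some q then y else z)"

text \<open>In the following two maps \<open>p\<close> and \<open>q\<close> are the first and the second element of a two-element
  index type.\<close>

definition quadratic_map_A ::
  "'r::finite \<Rightarrow> 'r \<Rightarrow> complex^'r^'r \<Rightarrow> complex^('r option)^('r option)" where
  "quadratic_map_A p q Z =
     (let z1 = Z $ p $ p; z2 = Z $ p $ q; z3 = Z $ q $ p; z4 = Z $ q $ q in
      \<chi> a b. triple p q
        (triple p q (z1\<^sup>2)    (z1 * z2) z2)
        (triple p q (z1 * z3) (z2 * z3) z4)
        (triple p q z3        z4        0) a b)"

definition quadratic_map_B ::
  "'r::finite \<Rightarrow> 'r \<Rightarrow> complex^'r^'r \<Rightarrow> complex^('r option)^('r option)" where
  "quadratic_map_B p q Z =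
     (let z1 = Z $ p $ p; z2 = Z $ p $ q; z3 = Z $ q $ p; z4 = Z $ q $ q;
          w = complex_of_real (sqrt 2) in
      \<chi> a b. triple p q
        (triple p q (z1\<^sup>2)        (w * z1 * z2)      (z2\<^sup>2))
        (triple p q (w * z1 * z3) (z1 * z4 + z2 * z3) (w * z2 * z4))
        (triple p q (z3\<^sup>2)        (w * z3 * z4)      (z4\<^sup>2)) a b)"

end

theory Submission
  imports Defs "HOL-Complex_Analysis.Conformal_Mappings"
begin

text \<open>Write \<open>P = s\<^sup>m Q\<close>, where \<open>s\<close> is the sum of the \<open>x\<^sub>i\<close> minus the sum of the \<open>y\<^sub>j\<close>. The map \<open>g\<close> has only
  \<open>r + 1\<close> components of each sign, so \<open>P\<close> has at most \<open>r + 1\<close> positive and \<open>r + 1\<close> negative coefficients.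
  Positivity of \<open>P\<close> on the ball reduces all hypotheses to the case where \<open>Q\<close> has nonnegative coefficients.
  The parts of \<open>P\<close> of highest and lowest degree in \<open>x\<close> then already use up almost all the available
  coefficients, which forces \<open>m = 1\<close> and \<open>Q\<close> to be constant or, for \<open>r = 2\<close>, a multiple of
  \<open>x\<^sub>i + y\<^sub>j\<close> or of the sum of all variables.

  The induced map gives \<open>g\<^sub>+(A, A Z) f(Z) = g\<^sub>-(A, A Z)\<close> for generic, hence for all, \<open>A\<close>. If \<open>Q\<close> is not
  constant, \<open>g\<close> is known up to permutations and phases, and these equations determine \<open>f\<close>. If \<open>Q\<close> is
  constant, \<open>g\<close> is a linear isometry up to a factor. After extending it to a pseudo-unitary
  transformation, \<open>f\<close> is a matrix with diagonal blocks \<open>Z\<close>, \<open>h\<close> and zero upper right block; the remaining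
  block vanishes since it tends to zero at unitary matrices.\<close>


text \<open>The counting is tight for this reason. For m = 1, multiplying an exponent
  \<open>\<alpha>\<close> of Q of highest x-degree by the x-variables gives r positive coefficients
  of P, since anything cancelling them would need a higher x-degree; dually, the lowest x-degree
  gives r negative ones. So at most one further coefficient of each sign remains, and every other
  product must be balanced by products of opposite sign. Each balance x_i \<nu> = y_j \<gamma>
  exhibits another exponent of Q, and following these exchanges determines its shape up to a
  monomial factor. That factor is excluded because the components of \<open>g\<close> have no common
  factor.

  The obstacle on the analytic side is that the hypotheses speak of generic points of projective
  space and of neighbourhoods of a boundary. Both are moved to the cone of homogeneous coordinates,
  where limits and the one-variable identity theorem turn them into identities: P vanishes at
  nonzero nonnegative points with s = 0, and the relation between \<open>f\<close> and
  \<open>g\<close> holds for every nonzero A.\<close>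

section \<open>Complex differentiability\<close>

text \<open>Pointwise form of \<open>cdiff_on\<close>. Additivity of \<open>D\<close> comes with the
  Frechet derivative, so only complex homogeneity is required. The scalings \<open>sa\<close>,
  \<open>sb\<close> stay arbitrary in order that numbers, vectors and matrices share one set of
  rules.\<close>

definition cdiff_at ::
  "(complex \<Rightarrow> 'a::real_normed_vector \<Rightarrow> 'a) \<Rightarrow> (complex \<Rightarrow> 'b::real_normed_vector \<Rightarrow> 'b)
    \<Rightarrow> ('a \<Rightarrow> 'b) \<Rightarrow> 'a \<Rightarrow> bool" where
  "cdiff_at sa sb f x \<longleftrightarrow>
     (\<exists>D. (f has_derivative D) (at x) \<and> (\<forall>c h. D (sa c h) = sb c (D h)))"

lemma vector_space_cscale_mat: "vector_space (cscale_mat :: complex \<Rightarrow> complex^'s::finite^'r::finite \<Rightarrow> _)"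
  by unfold_locales (auto simp: cscale_mat_def vec_eq_iff algebra_simps)

lemma vector_space_complex_mult: "vector_space ((*) :: complex \<Rightarrow> complex \<Rightarrow> complex)"
  by unfold_locales (auto simp: algebra_simps)

lemma cdiff_on_iff:
  assumes "vector_space sa" "vector_space sb"
  shows "cdiff_on sa sb f S \<longleftrightarrow> open S \<and> (\<forall>x\<in>S. cdiff_at sa sb f x)"
proof -
  have "Vector_Spaces.linear sa sb D \<longleftrightarrow> (\<forall>c h. D (sa c h) = sb c (D h))"
    if "(f has_derivative D) (at x)" for D x
    using assms linear_add[OF has_derivative_linear[OF that]]
    by (auto simp: Vector_Spaces.linear_iff)
  then show ?thesis unfolding cdiff_on_def cdiff_at_def by blast
qed

lemma mat_holomorphic_on_iff:
  "mat_holomorphic_on f S \<longleftrightarrow> open S \<and> (\<forall>x\<in>S. cdiff_at cscale_mat cscale_mat f x)"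
  by (rule cdiff_on_iff[OF vector_space_cscale_mat vector_space_cscale_mat])

lemma fun_holomorphic_on_iff:
  "fun_holomorphic_on f S \<longleftrightarrow> open S \<and> (\<forall>x\<in>S. cdiff_at cscale_mat (*) f x)"
  by (rule cdiff_on_iff[OF vector_space_cscale_mat vector_space_complex_mult])

lemma proj_holomorphic_on_iff:
  "proj_holomorphic_on \<phi> U \<longleftrightarrow> open {v. v \<noteq> 0 \<and> abs_proj v \<in> U} \<and>
     (\<forall>v. v \<noteq> 0 \<and> abs_proj v \<in> U \<longrightarrow> cdiff_at (*s) (*) (\<lambda>v. \<phi> (abs_proj v)) v)"
  unfolding proj_holomorphic_on_def
  by (subst cdiff_on_iff[OF vec.vector_space_axioms vector_space_complex_mult]) auto

lemma cdiff_at_imp_isCont: "cdiff_at sa sb f x \<Longrightarrow> isCont f x"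
  unfolding cdiff_at_def using has_derivative_continuous by blast

lemma cdiff_at_compose:
  assumes "cdiff_at sa sb g x" "cdiff_at sb sc f (g x)"
  shows "cdiff_at sa sc (\<lambda>x. f (g x)) x"
proof -
  obtain D where D: "(g has_derivative D) (at x)" "\<And>c h. D (sa c h) = sb c (D h)"
    using assms(1) by (auto simp: cdiff_at_def)
  obtain E where E: "(f has_derivative E) (at (g x))" "\<And>c h. E (sb c h) = sc c (E h)"
    using assms(2) by (auto simp: cdiff_at_def)
  have "((\<lambda>x. f (g x)) has_derivative (\<lambda>h. E (D h))) (at x)"
    by (rule has_derivative_compose[OF D(1) E(1)])
  then show ?thesis
    unfolding cdiff_at_def using D(2) E(2) by (intro exI[of _ "\<lambda>h. E (D h)"]) auto
qed

lemma cdiff_at_cong_eventually: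
  assumes "cdiff_at sa sb f x" "open U" "x \<in> U" "\<And>y. y \<in> U \<Longrightarrow> f y = g y"
  shows "cdiff_at sa sb g x"
proof -
  obtain D where D: "(f has_derivative D) (at x)" "\<And>c h. D (sa c h) = sb c (D h)"
    using assms(1) by (auto simp: cdiff_at_def)
  have "(g has_derivative D) (at x)"
    by (rule has_derivative_transform_within_open[OF D(1) assms(2,3,4)])
  with D(2) show ?thesis unfolding cdiff_at_def by blast
qed

lemma cdiff_at_const: "cdiff_at sa (*) (\<lambda>x. c :: complex) x"
  unfolding cdiff_at_def by (intro exI[of _ "\<lambda>_. 0"]) auto

lemma cdiff_at_add:
  fixes f g :: "'a::real_normed_vector \<Rightarrow> complex"
  assumes "cdiff_at sa (*) f x" "cdiff_at sa (*) g x"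
  shows "cdiff_at sa (*) (\<lambda>x. f x + g x) x"
proof -
  obtain D where D: "(f has_derivative D) (at x)" "\<And>c h. D (sa c h) = c * (D h)"
    using assms(1) by (auto simp: cdiff_at_def)
  obtain E where E: "(g has_derivative E) (at x)" "\<And>c h. E (sa c h) = c * (E h)"
    using assms(2) by (auto simp: cdiff_at_def)
  show ?thesis unfolding cdiff_at_def
    using has_derivative_add[OF D(1) E(1)] D(2) E(2)
    by (intro exI[of _ "\<lambda>h. D h + E h"]) (auto simp: algebra_simps)
qed

lemma cdiff_at_mult:
  fixes f g :: "'a::real_normed_vector \<Rightarrow> complex"
  assumes "cdiff_at sa (*) f x" "cdiff_at sa (*) g x"
  shows "cdiff_at sa (*) (\<lambda>x. f x * g x) x"
proof -
  obtain D where D: "(f has_derivative D) (at x)" "\<And>c h. D (sa c h) = c * (D h)"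
    using assms(1) by (auto simp: cdiff_at_def)
  obtain E where E: "(g has_derivative E) (at x)" "\<And>c h. E (sa c h) = c * (E h)"
    using assms(2) by (auto simp: cdiff_at_def)
  show ?thesis unfolding cdiff_at_def
    using has_derivative_mult[OF D(1) E(1)] D(2) E(2)
    by (intro exI[of _ "\<lambda>h. f x * E h + D h * g x"]) (auto simp: algebra_simps)
qed

lemma cdiff_at_minus:
  fixes f g :: "'a::real_normed_vector \<Rightarrow> complex"
  assumes "cdiff_at sa (*) f x" "cdiff_at sa (*) g x"
  shows "cdiff_at sa (*) (\<lambda>x. f x - g x) x"
  using cdiff_at_add[OF assms(1) cdiff_at_mult[OF cdiff_at_const[of sa "-1"] assms(2)]] by simp

lemma cdiff_at_inverse:
  fixes f :: "'a::real_normed_vector \<Rightarrow> complex"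
  assumes "cdiff_at sa (*) f x" "f x \<noteq> 0"
  shows "cdiff_at sa (*) (\<lambda>x. inverse (f x)) x"
proof -
  have "cdiff_at (*) (*) inverse (f x)"
    unfolding cdiff_at_def using has_derivative_inverse'[OF assms(2)]
    by (intro exI) (auto simp: algebra_simps)
  from cdiff_at_compose[OF assms(1) this] show ?thesis .
qed

lemma cdiff_at_divide:
  fixes f g :: "'a::real_normed_vector \<Rightarrow> complex"
  assumes "cdiff_at sa (*) f x" "cdiff_at sa (*) g x" "g x \<noteq> 0"
  shows "cdiff_at sa (*) (\<lambda>x. f x / g x) x"
  using cdiff_at_mult[OF assms(1) cdiff_at_inverse[OF assms(2,3)]] by (simp add: divide_inverse)

lemma cdiff_at_sum:
  fixes f :: "'i \<Rightarrow> 'a::real_normed_vector \<Rightarrow> complex"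
  assumes "\<And>i. i \<in> I \<Longrightarrow> cdiff_at sa (*) (f i) x"
  shows "cdiff_at sa (*) (\<lambda>x. \<Sum>i\<in>I. f i x) x"
  using assms by (induction I rule: infinite_finite_induct) (auto intro: cdiff_at_const cdiff_at_add)

lemma cdiff_at_prod:
  fixes f :: "'i \<Rightarrow> 'a::real_normed_vector \<Rightarrow> complex"
  assumes "\<And>i. i \<in> I \<Longrightarrow> cdiff_at sa (*) (f i) x"
  shows "cdiff_at sa (*) (\<lambda>x. \<Prod>i\<in>I. f i x) x"
  using assms by (induction I rule: infinite_finite_induct) (auto intro: cdiff_at_const cdiff_at_mult)

lemma cdiff_at_power:
  fixes f :: "'a::real_normed_vector \<Rightarrow> complex"
  assumes "cdiff_at sa (*) f x"
  shows "cdiff_at sa (*) (\<lambda>x. f x ^ n) x"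
  using assms by (induction n) (auto intro: cdiff_at_const cdiff_at_mult)

lemma cdiff_at_entry: "cdiff_at cscale_mat (*) (\<lambda>Z. Z $ i $ j) Z"
  unfolding cdiff_at_def
  by (rule exI[of _ "\<lambda>Z. Z $ i $ j"])
     (auto simp: cscale_mat_def intro!: bounded_linear.has_derivative[OF bounded_linear_vec_nth] has_derivative_ident)

lemmas cdiff_at_intros = cdiff_at_const cdiff_at_add cdiff_at_minus cdiff_at_mult cdiff_at_divide
  cdiff_at_inverse cdiff_at_sum cdiff_at_prod cdiff_at_power cdiff_at_entry

lemma has_derivative_vecI:
  fixes f :: "'a::real_normed_vector \<Rightarrow> 'b::euclidean_space ^ 'n::finite"
  assumes "\<And>i. ((\<lambda>x. f x $ i) has_derivative (\<lambda>h. D h $ i)) (at x)"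
  shows "(f has_derivative D) (at x)"
proof (subst has_derivative_componentwise_within, intro ballI)
  fix b :: "'b ^ 'n" assume "b \<in> Basis"
  then obtain i u where b: "b = axis i u" unfolding Basis_vec_def by blast
  have "((\<lambda>x. f x $ i \<bullet> u) has_derivative (\<lambda>h. D h $ i \<bullet> u)) (at x)"
    by (rule bounded_linear.has_derivative[OF bounded_linear_inner_left assms])
  then show "((\<lambda>x. f x \<bullet> b) has_derivative (\<lambda>h. D h \<bullet> b)) (at x)"
    by (simp add: b inner_axis)
qed

lemma cdiff_at_vecI:
  assumes "\<And>i. cdiff_at sa (*) (\<lambda>x. F x $ i) x"
  shows "cdiff_at sa (*s) F x"
proof -
  obtain D where D: "\<And>i. ((\<lambda>x. F x $ i) has_derivative D i) (at x)"
      "\<And>i c h. D i (sa c h) = c * D i h"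
    using assms unfolding cdiff_at_def by metis
  have "(F has_derivative (\<lambda>h. \<chi> i. D i h)) (at x)"
    by (intro has_derivative_vecI) (simp add: D(1))
  then show ?thesis unfolding cdiff_at_def
    by (intro exI[of _ "\<lambda>h. \<chi> i. D i h"]) (auto simp: D(2) vec_eq_iff)
qed

lemma cdiff_at_matI:
  assumes "\<And>i j. cdiff_at sa (*) (\<lambda>x. F x $ i $ j) x"
  shows "cdiff_at sa cscale_mat F x"
proof -
  obtain D where D: "\<And>i j. ((\<lambda>x. F x $ i $ j) has_derivative D i j) (at x)"
      "\<And>i j c h. D i j (sa c h) = c * D i j h"
    using assms unfolding cdiff_at_def by metis
  have "(F has_derivative (\<lambda>h. \<chi> i j. D i j h)) (at x)"
    by (intro has_derivative_vecI) (simp add: D(1))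
  then show ?thesis unfolding cdiff_at_def
    by (intro exI[of _ "\<lambda>h. \<chi> i j. D i j h"]) (auto simp: D(2) vec_eq_iff cscale_mat_def)
qed

lemma cdiff_at_mat_entry:
  assumes "cdiff_at sa cscale_mat F x"
  shows "cdiff_at sa (*) (\<lambda>x. F x $ i $ j) x"
  by (rule cdiff_at_compose[OF assms cdiff_at_entry])

lemma cdiff_at_ident: "cdiff_at (*) (*) (\<lambda>x::complex. x) x"
  unfolding cdiff_at_def by (rule exI[of _ "\<lambda>x. x"]) auto

lemma cdiff_at_imp_holomorphic:
  assumes "\<And>z. z \<in> S \<Longrightarrow> cdiff_at (*) (*) f z"
  shows "f holomorphic_on S"
proof (rule holomorphic_onI)
  fix z assume "z \<in> S"
  then obtain D where D: "(f has_derivative D) (at z)" "\<And>c h. D (c * h) = c * D h"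
    using assms[OF \<open>z \<in> S\<close>] by (auto simp: cdiff_at_def)
  have "D h = D 1 * h" for h using D(2)[of h 1] by (metis mult.commute mult.right_neutral)
  then have "D = (*) (D 1)" by blast
  with D(1) have "(f has_field_derivative D 1) (at z)" by (simp add: has_field_derivative_def)
  then show "f field_differentiable at z within S"
    using field_differentiable_def field_differentiable_at_within by blast
qed

lemma cdiff_at_mat_line: "cdiff_at (*) cscale_mat (\<lambda>\<zeta>. X + cscale_mat \<zeta> Y) z"
  by (intro cdiff_at_matI) (simp add: cscale_mat_def, intro cdiff_at_intros cdiff_at_ident)

lemma cdiff_at_vec_line: "cdiff_at (*) (*s) (\<lambda>\<zeta>. X + \<zeta> *s Y) z"
  by (intro cdiff_at_vecI) (simp, intro cdiff_at_intros cdiff_at_ident)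

lemma cdiff_at_det:
  fixes F :: "'a::real_normed_vector \<Rightarrow> complex^'n::finite^'n"
  assumes "\<And>i j. cdiff_at sa (*) (\<lambda>x. F x $ i $ j) x"
  shows "cdiff_at sa (*) (\<lambda>x. det (F x)) x"
  unfolding det_def by (intro cdiff_at_intros assms)

text \<open>Cramer's rule writes each component of the solution as a quotient of determinants.
  Fractional linear maps thus become holomorphic without differentiating a matrix inverse.\<close>

lemma cdiff_at_solve:
  fixes M :: "'a::real_normed_vector \<Rightarrow> complex^'n::finite^'n" and y w :: "'a \<Rightarrow> complex^'n"
  assumes "open U" "x \<in> U"
    and M: "\<And>i j. cdiff_at sa (*) (\<lambda>x. M x $ i $ j) x" and w: "\<And>i. cdiff_at sa (*) (\<lambda>x. w x $ i) x"
    and det: "\<And>u. u \<in> U \<Longrightarrow> det (M u) \<noteq> 0" and eq: "\<And>u. u \<in> U \<Longrightarrow> M u *v y u = w u"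
  shows "cdiff_at sa (*) (\<lambda>x. y x $ k) x"
proof (rule cdiff_at_cong_eventually[OF _ assms(1,2)])
  let ?y = "\<lambda>u. det (\<chi> i j. if j = k then w u $ i else M u $ i $ j) / det (M u)"
  show "cdiff_at sa (*) ?y x"
  proof (intro cdiff_at_divide cdiff_at_det M det assms(2))
    show "cdiff_at sa (*) (\<lambda>xa. (\<chi> i j. if j = k then w xa $ i else M xa $ i $ j) $ i $ j) x" for i j
      using w M by (cases "j = k") auto
  qed
  show "?y u = y u $ k" if "u \<in> U" for u
    using cramer[OF det[OF that], of "y u" "w u"] eq[OF that] by (simp add: vec_eq_iff)
qed


section \<open>Contractions and their automorphisms\<close>

lemma norm_vec_sq: "(norm (v :: complex^'n::finite))\<^sup>2 = (\<Sum>i\<in>UNIV. (cmod (v $ i))\<^sup>2)"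
  by (simp add: norm_vec_def L2_set_def sum_nonneg)

text \<open>At the conjugate of v, the form of \<open>mat 1 - Z ** adjoint_mat Z\<close> becomes
  |v|^2 - |v Z|^2. Rows rather than columns are the natural side here, because \<open>sharp\<close>
  is the condition A Z = B on rows.\<close>

lemma type1_domain_iff:
  "(Z :: complex^'s::finite^'r::finite) \<in> type1_domain \<longleftrightarrow> (\<forall>v. v \<noteq> 0 \<longrightarrow> norm (v v* Z) < norm v)"
proof -
  define M where "M = mat 1 - Z ** adjoint_mat Z"
  have M: "M $ i $ j = (if i = j then 1 else 0) - (\<Sum>k\<in>UNIV. Z $ i $ k * cnj (Z $ j $ k))" for i j
    by (simp add: M_def mat_def matrix_matrix_mult_def adjoint_mat_def)
  have herm: "adjoint_mat M = M"
    by (auto simp: vec_eq_iff adjoint_mat_def M mult.commute)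
  have quad: "Re (\<Sum>i\<in>UNIV. \<Sum>j\<in>UNIV. cnj (v $ i) * M $ i $ j * v $ j)
      = (norm (\<chi> i. cnj (v $ i)))\<^sup>2 - (norm ((\<chi> i. cnj (v $ i)) v* Z))\<^sup>2" for v
  proof -
    define w where "w = (\<chi> i. cnj (v $ i)) v* Z"
    have w: "w $ k = (\<Sum>i\<in>UNIV. cnj (v $ i) * Z $ i $ k)" for k
      by (simp add: w_def vector_matrix_mult_def)
    have "(\<Sum>i\<in>UNIV. \<Sum>j\<in>UNIV. cnj (v $ i) * M $ i $ j * v $ j)
        = (\<Sum>i\<in>UNIV. \<Sum>j\<in>UNIV. (if i = j then cnj (v $ i) * v $ j else 0))
          - (\<Sum>i\<in>UNIV. \<Sum>j\<in>UNIV. \<Sum>k\<in>UNIV. (cnj (v $ i) * Z $ i $ k) * cnj (cnj (v $ j) * Z $ j $ k))"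
      unfolding sum_subtractf[symmetric]
      by (intro sum.cong refl)
         (auto simp: M algebra_simps sum_distrib_left sum_distrib_right)
    also have "(\<Sum>i\<in>UNIV. \<Sum>j\<in>UNIV. (if i = j then cnj (v $ i) * v $ j else 0))
        = of_real ((norm v)\<^sup>2)"
      by (simp add: norm_vec_sq complex_norm_square[symmetric] mult.commute)
    also have "(\<Sum>i\<in>UNIV. \<Sum>j\<in>UNIV. \<Sum>k\<in>UNIV. (cnj (v $ i) * Z $ i $ k) * cnj (cnj (v $ j) * Z $ j $ k))
        = (\<Sum>k\<in>UNIV. \<Sum>i\<in>UNIV. \<Sum>j\<in>UNIV. (cnj (v $ i) * Z $ i $ k) * cnj (cnj (v $ j) * Z $ j $ k))"
      by (subst sum.swap, rule sum.cong[OF refl], subst sum.swap) simp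
    also have "\<dots> = (\<Sum>k\<in>UNIV. w $ k * cnj (w $ k))"
      by (simp only: w cnj_sum sum_product)
    also have "\<dots> = of_real ((norm w)\<^sup>2)"
      by (simp add: norm_vec_sq complex_norm_square[symmetric])
    finally show ?thesis
      unfolding w_def[symmetric] by (simp add: norm_vec_sq)
  qed
  have "(\<forall>v. v \<noteq> 0 \<longrightarrow> norm ((\<chi> i. cnj (v $ i)) v* Z) < norm (\<chi> i. cnj (v $ i)))
     \<longleftrightarrow> (\<forall>v. v \<noteq> 0 \<longrightarrow> norm (v v* Z) < norm v)" (is "?L \<longleftrightarrow> ?R")
  proof
    assume L: ?L
    show ?R
    proof (intro allI impI)
      fix v :: "complex^'r" assume "v \<noteq> 0"
      then have "(\<chi> i. cnj (v $ i)) \<noteq> 0" by (simp add: vec_eq_iff)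
      moreover have "(\<chi> i. cnj ((\<chi> i. cnj (v $ i)) $ i)) = v" by (simp add: vec_eq_iff)
      ultimately show "norm (v v* Z) < norm v" using L by metis
    qed
  next
    assume R: ?R
    show ?L
    proof (intro allI impI)
      fix v :: "complex^'r" assume "v \<noteq> 0"
      then have "(\<chi> i. cnj (v $ i)) \<noteq> 0" by (simp add: vec_eq_iff)
      then show "norm ((\<chi> i. cnj (v $ i)) v* Z) < norm (\<chi> i. cnj (v $ i))" using R by blast
    qed
  qed
  moreover have "(0 < (norm a)\<^sup>2 - (norm b)\<^sup>2) = (norm b < norm a)"
    for a :: "complex^'r" and b :: "complex^'s"
    using power_less_imp_less_base[of "norm b" 2 "norm a"] power_strict_mono[of "norm b" "norm a" 2] by auto
  ultimately show ?thesis
    unfolding type1_domain_def pos_def_def mem_Collect_eq M_def[symmetric] quad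
    using herm by simp
qed

lemma type1_domainI: "(\<And>v. v \<noteq> 0 \<Longrightarrow> norm (v v* Z) < norm v) \<Longrightarrow> Z \<in> type1_domain"
  by (simp add: type1_domain_iff)

lemma type1_domainD: "Z \<in> type1_domain \<Longrightarrow> v \<noteq> 0 \<Longrightarrow> norm (v v* Z) < norm v"
  by (simp add: type1_domain_iff)

lemma type1_domain_le: "Z \<in> type1_domain \<Longrightarrow> norm (v v* Z) \<le> norm v"
  by (cases "v = 0") (auto dest: type1_domainD intro: less_imp_le)

lemma norm_vector_matrix_mult_le: "norm (v v* (X :: complex^'s::finite^'r::finite)) \<le> norm v * norm X"
proof (rule power2_le_imp_le)
  have "(norm (v v* X))\<^sup>2 = (\<Sum>j\<in>UNIV. (cmod (\<Sum>i\<in>UNIV. v $ i * X $ i $ j))\<^sup>2)"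
    by (simp add: norm_vec_sq vector_matrix_mult_def)
  also have "\<dots> \<le> (\<Sum>j\<in>UNIV. (\<Sum>i\<in>UNIV. cmod (v $ i) * cmod (X $ i $ j))\<^sup>2)"
    by (intro sum_mono power_mono) (auto intro: sum_norm_le simp: norm_mult)
  also have "\<dots> \<le> (\<Sum>j\<in>UNIV. (\<Sum>i\<in>UNIV. (cmod (v $ i))\<^sup>2) * (\<Sum>i\<in>UNIV. (cmod (X $ i $ j))\<^sup>2))"
    by (intro sum_mono Cauchy_Schwarz_ineq_sum)
  also have "\<dots> = (norm v)\<^sup>2 * (\<Sum>j\<in>UNIV. \<Sum>i\<in>UNIV. (cmod (X $ i $ j))\<^sup>2)"
    by (simp add: norm_vec_sq sum_distrib_left)
  also have "(\<Sum>j\<in>UNIV. \<Sum>i\<in>UNIV. (cmod (X $ i $ j))\<^sup>2) = (norm X)\<^sup>2"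
    by (subst sum.swap) (simp add: norm_vec_def[of X] L2_set_def sum_nonneg norm_vec_sq)
  finally show "(norm (v v* X))\<^sup>2 \<le> (norm v * norm X)\<^sup>2" by (simp add: power_mult_distrib)
qed simp

text \<open>Compactness of the unit sphere gives a uniform bound M < 1 for |v Z|, and a perturbation
  of norm below 1 - M cannot reach 1.\<close>

lemma open_type1_domain: "open (type1_domain :: (complex^'s::finite^'r::finite) set)"
  unfolding open_contains_ball
proof
  fix Z :: "complex^'s^'r" assume Z: "Z \<in> type1_domain"
  define S where "S = sphere (0 :: complex^'r) 1"
  have "continuous_on S (\<lambda>v. norm (v v* Z))"
    unfolding vector_matrix_mult_def by (intro continuous_intros)
  moreover have "compact S" by (simp add: S_def)
  moreover have "axis undefined 1 \<in> S" by (simp add: S_def)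
  ultimately obtain v0 where v0: "v0 \<in> S" "\<And>v. v \<in> S \<Longrightarrow> norm (v v* Z) \<le> norm (v0 v* Z)"
    using continuous_attains_sup[of S "\<lambda>v. norm (v v* Z)"] by blast
  define M where "M = norm (v0 v* Z)"
  have "v0 \<noteq> 0" using v0(1) by (auto simp: S_def)
  then have M: "M < 1" using type1_domainD[OF Z, of v0] v0(1) by (simp add: M_def S_def)
  have "W \<in> type1_domain" if "dist W Z < 1 - M" for W
  proof (rule type1_domainI)
    fix v :: "complex^'r" assume v: "v \<noteq> 0"
    define u where "u = inverse (norm v) *\<^sub>R v"
    have "u \<in> S" using v by (simp add: S_def u_def)
    then have u: "norm (u v* Z) \<le> M" using v0(2) by (simp add: M_def)
    have vu: "v = norm v *\<^sub>R u" using v by (simp add: u_def)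
    have "v v* Z = norm v *\<^sub>R (u v* Z)"
      by (subst vu) (simp add: vec_eq_iff vector_matrix_mult_def scaleR_sum_right)
    then have "norm (v v* Z) = norm v * norm (u v* Z)" by simp
    then have 1: "norm (v v* Z) \<le> norm v * M" using u by (simp add: mult_left_mono)
    have "v v* W = v v* Z + v v* (W - Z)" by (simp add: vector_matrix_mult_diff_rdistrib)
    then have "norm (v v* W) \<le> norm (v v* Z) + norm v * norm (W - Z)"
      using norm_triangle_ineq[of "v v* Z" "v v* (W - Z)"] norm_vector_matrix_mult_le[of v "W - Z"] by simp
    also have "\<dots> < norm v * M + norm v * (1 - M)"
      using 1 that v by (intro add_le_less_mono) (auto simp: dist_norm)
    finally show "norm (v v* W) < norm v" by (simp add: algebra_simps)
  qed
  then show "\<exists>e>0. ball Z e \<subseteq> type1_domain"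
    using M by (intro exI[of _ "1 - M"]) (auto simp: dist_commute)
qed

lemma convex_type1_domain: "convex (type1_domain :: (complex^'s::finite^'r::finite) set)"
proof (rule convexI)
  fix X Y :: "complex^'s^'r" and a b :: real
  assume XY: "X \<in> type1_domain" "Y \<in> type1_domain" and ab: "0 \<le> a" "0 \<le> b" "a + b = 1"
  show "a *\<^sub>R X + b *\<^sub>R Y \<in> type1_domain"
  proof (rule type1_domainI)
    fix v :: "complex^'r" assume v: "v \<noteq> 0"
    have "v v* (a *\<^sub>R X + b *\<^sub>R Y) = a *\<^sub>R (v v* X) + b *\<^sub>R (v v* Y)"
      by (simp add: vec_eq_iff vector_matrix_mult_def sum.distrib algebra_simps scaleR_sum_right)
    then have "norm (v v* (a *\<^sub>R X + b *\<^sub>R Y)) \<le> a * norm (v v* X) + b * norm (v v* Y)"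
      using norm_triangle_ineq[of "a *\<^sub>R (v v* X)" "b *\<^sub>R (v v* Y)"] ab by simp
    also have "\<dots> < a * norm v + b * norm v"
    proof (cases "a = 0")
      case True
      then show ?thesis using ab type1_domainD[OF XY(2) v] by simp
    next
      case False
      then have "a * norm (v v* X) < a * norm v" using ab type1_domainD[OF XY(1) v] by simp
      moreover have "b * norm (v v* Y) \<le> b * norm v"
        using ab type1_domain_le[OF XY(2)] by (simp add: mult_left_mono)
      ultimately show ?thesis by linarith
    qed
    also have "\<dots> = norm v" using ab by (metis distrib_right mult_1)
    finally show "norm (v v* (a *\<^sub>R X + b *\<^sub>R Y)) < norm v" .
  qed
qed

text \<open>Testing with the row v conjugate to Z w gives |Z w|^2 = v Z w \<le> |v Z| |w| \<le> |Z
  w| |w|, which transfers the row bound to columns.\<close>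

lemma type1_domain_column_le:
  fixes Z :: "complex^'s::finite^'r::finite"
  assumes "Z \<in> type1_domain"
  shows "norm (Z *v w) \<le> norm w"
proof (cases "Z *v w = 0")
  case False
  define v where "v = (\<chi> i. cnj ((Z *v w) $ i))"
  have nv: "norm v = norm (Z *v w)"
    by (rule power2_eq_imp_eq) (auto simp: norm_vec_sq v_def)
  have "of_real ((norm (Z *v w))\<^sup>2) = (\<Sum>i\<in>UNIV. v $ i * (Z *v w) $ i)"
    unfolding norm_vec_sq of_real_sum complex_norm_square v_def by (simp add: mult.commute)
  also have "\<dots> = (\<Sum>j\<in>UNIV. (v v* Z) $ j * w $ j)"
    unfolding matrix_vector_mult_def vector_matrix_mult_def
    by (simp add: sum_distrib_left sum_distrib_right, subst sum.swap) (simp add: mult.assoc)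
  finally have "cmod (of_real ((norm (Z *v w))\<^sup>2)) = cmod (\<Sum>j\<in>UNIV. (v v* Z) $ j * w $ j)"
    by (rule arg_cong)
  then have "(norm (Z *v w))\<^sup>2 = cmod (\<Sum>j\<in>UNIV. (v v* Z) $ j * w $ j)"
    by (simp only: norm_of_real abs_power2)
  also have "\<dots> \<le> (\<Sum>j\<in>UNIV. cmod ((v v* Z) $ j) * cmod (w $ j))"
    by (rule sum_norm_le) (simp add: norm_mult)
  also have "\<dots> \<le> norm (v v* Z) * norm w"
  proof (rule power2_le_imp_le)
    show "(\<Sum>j\<in>UNIV. cmod ((v v* Z) $ j) * cmod (w $ j))\<^sup>2 \<le> (norm (v v* Z) * norm w)\<^sup>2"
      unfolding power_mult_distrib norm_vec_sq by (rule Cauchy_Schwarz_ineq_sum)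
  qed simp
  also have "\<dots> \<le> norm (Z *v w) * norm w"
    using type1_domain_le[OF assms, of v] nv by (simp add: mult_right_mono)
  finally show ?thesis using False by (simp add: power2_eq_square)
qed simp

lemma automorphismI:
  fixes \<phi> \<psi> :: "complex^'s::finite^'r::finite \<Rightarrow> complex^'s^'r"
  assumes \<phi>: "\<And>Z. Z \<in> \<Omega> \<Longrightarrow> \<phi> Z \<in> \<Omega>" "mat_holomorphic_on \<phi> \<Omega>"
    and \<psi>: "\<And>Z. Z \<in> \<Omega> \<Longrightarrow> \<psi> Z \<in> \<Omega>" "mat_holomorphic_on \<psi> \<Omega>"
    and inv: "\<And>Z. Z \<in> \<Omega> \<Longrightarrow> \<psi> (\<phi> Z) = Z" "\<And>Z. Z \<in> \<Omega> \<Longrightarrow> \<phi> (\<psi> Z) = Z"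
  shows "\<phi> \<in> automorphisms \<Omega>"
proof -
  have bij: "bij_betw \<phi> \<Omega> \<Omega>"
    using assms by (intro bij_betw_byWitness[where f' = \<psi>]) auto
  then have "inv_into \<Omega> \<phi> Z = \<psi> Z" if "Z \<in> \<Omega>" for Z
    by (metis \<psi>(1) bij_betw_inv_into_left inv(2) that)
  moreover have "open \<Omega>" "\<forall>x\<in>\<Omega>. cdiff_at cscale_mat cscale_mat \<psi> x"
    using \<psi>(2) by (auto simp: mat_holomorphic_on_iff)
  ultimately have "mat_holomorphic_on (inv_into \<Omega> \<phi>) \<Omega>"
    unfolding mat_holomorphic_on_iff
  proof (intro conjI ballI)
    fix Z assume *: "Z \<in> \<Omega>" "\<And>Z. Z \<in> \<Omega> \<Longrightarrow> inv_into \<Omega> \<phi> Z = \<psi> Z" "open \<Omega>"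
      "\<forall>x\<in>\<Omega>. cdiff_at cscale_mat cscale_mat \<psi> x"
    show "cdiff_at cscale_mat cscale_mat (inv_into \<Omega> \<phi>) Z"
      by (rule cdiff_at_cong_eventually[OF _ *(3) *(1)]) (use * in auto)
  qed
  with bij \<phi>(2) show ?thesis by (simp add: automorphisms_def)
qed

section \<open>Fractional linear automorphisms\<close>

lemma matrix_inv_inverse:
  fixes A :: "complex^'n::finite^'n"
  assumes "invertible A"
  shows "matrix_inv A ** A = mat 1" "A ** matrix_inv A = mat 1"
  using someI_ex[OF assms[unfolded invertible_def]] unfolding matrix_inv_def by auto

text \<open>The block row [1, Z] is multiplied on the right by the block matrix with rows (a, b) and
  (c, d); normalising the result [a + Z c, b + Z d] back to the form [1, W] gives this W.\<close>

definition moebius ::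
  "complex^'n::finite^'n \<Rightarrow> complex^'n^'n \<Rightarrow> complex^'n^'n \<Rightarrow> complex^'n^'n \<Rightarrow> complex^'n^'n \<Rightarrow> complex^'n^'n" where
  "moebius a b c d Z = matrix_inv (a + Z ** c) ** (b + Z ** d)"

definition pseudo_unitary ::
  "complex^'n::finite^'n \<Rightarrow> complex^'n^'n \<Rightarrow> complex^'n^'n \<Rightarrow> complex^'n^'n \<Rightarrow> bool" where
  "pseudo_unitary a b c d \<longleftrightarrow>
     (\<forall>u v. (norm (u v* a + v v* c))\<^sup>2 - (norm (u v* b + v v* d))\<^sup>2 = (norm u)\<^sup>2 - (norm v)\<^sup>2)"

text \<open>The row (v, v Z) has positive form because Z is a strict contraction, and the isometry
  carries it to (v (a + Z c), v (b + Z d)). This yields both the invertibility of the denominator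
  and the contractivity of the image.\<close>

lemma pseudo_unitary_strict:
  assumes "pseudo_unitary a b c d" "Z \<in> type1_domain" "v \<noteq> 0"
  shows "norm (v v* (b + Z ** d)) < norm (v v* (a + Z ** c))"
proof -
  have "(norm (v v* (a + Z ** c)))\<^sup>2 - (norm (v v* (b + Z ** d)))\<^sup>2 = (norm v)\<^sup>2 - (norm (v v* Z))\<^sup>2"
    using assms(1) by (simp add: pseudo_unitary_def vector_matrix_mult_add_rdistrib flip: vector_matrix_mul_assoc)
  moreover have "(norm (v v* Z))\<^sup>2 < (norm v)\<^sup>2"
    using type1_domainD[OF assms(2,3)] by (intro power_strict_mono) auto
  ultimately have "(norm (v v* (b + Z ** d)))\<^sup>2 < (norm (v v* (a + Z ** c)))\<^sup>2" by linarith
  then show ?thesis by (rule power_less_imp_less_base) simp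
qed

lemma invertible_if_row_kernel_trivial:
  fixes N :: "complex^'n::finite^'n"
  assumes "\<And>v. v v* N = 0 \<Longrightarrow> v = 0"
  shows "invertible N"
proof -
  have "\<exists>B. B ** transpose N = mat 1"
    using assms by (subst matrix_left_invertible_ker) simp
  then have "invertible (transpose N)" by (simp add: invertible_left_inverse)
  then show ?thesis by (simp add: invertible_det_nz)
qed

lemma pseudo_unitary_invertible:
  assumes "pseudo_unitary a b c d" "Z \<in> type1_domain"
  shows "invertible (a + Z ** c)"
proof (rule invertible_if_row_kernel_trivial)
  fix v assume "v v* (a + Z ** c) = 0"
  then show "v = 0" using pseudo_unitary_strict[OF assms, of v] by (metis norm_ge_zero norm_zero not_less)
qed

lemma moebius_eqI:
  assumes "pseudo_unitary a b c d" "Z \<in> type1_domain" "(a + Z ** c) ** W = b + Z ** d"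
  shows "moebius a b c d Z = W"
proof -
  have "matrix_inv (a + Z ** c) ** (a + Z ** c) = mat 1"
    using pseudo_unitary_invertible[OF assms(1,2)] matrix_inv_inverse(1) by blast
  then show ?thesis
    unfolding moebius_def assms(3)[symmetric] by (simp add: matrix_mul_assoc)
qed

lemma moebius_eq:
  assumes "pseudo_unitary a b c d" "Z \<in> type1_domain"
  shows "(a + Z ** c) ** moebius a b c d Z = b + Z ** d"
proof -
  have "(a + Z ** c) ** matrix_inv (a + Z ** c) = mat 1"
    using pseudo_unitary_invertible[OF assms] matrix_inv_inverse(2) by blast
  then show ?thesis
    unfolding moebius_def by (simp add: matrix_mul_assoc)
qed

lemma moebius_in_domain:
  assumes "pseudo_unitary a b c d" "Z \<in> type1_domain"
  shows "moebius a b c d Z \<in> type1_domain"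
proof (rule type1_domainI)
  fix v :: "complex^'a" assume v: "v \<noteq> 0"
  define N where "N = a + Z ** c"
  have inv: "invertible N" unfolding N_def by (rule pseudo_unitary_invertible[OF assms])
  define w where "w = v v* matrix_inv N"
  have wN: "w v* N = v"
    using matrix_inv_inverse(1)[OF inv] by (simp add: w_def vector_matrix_mul_assoc)
  then have "w \<noteq> 0" using v by auto
  have "v v* moebius a b c d Z = w v* (b + Z ** d)"
    by (simp add: moebius_def w_def N_def vector_matrix_mul_assoc)
  then show "norm (v v* moebius a b c d Z) < norm v"
    using pseudo_unitary_strict[OF assms \<open>w \<noteq> 0\<close>] wN by (simp add: N_def)
qed

lemma moebius_holomorphic:
  assumes "pseudo_unitary a b c d"
  shows "mat_holomorphic_on (moebius a b c d) type1_domain"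
  unfolding mat_holomorphic_on_iff
proof (intro conjI ballI cdiff_at_matI open_type1_domain)
  fix Z and i j :: 'a assume Z: "Z \<in> (type1_domain :: (complex^'a^'a) set)"
  have "cdiff_at cscale_mat (*) (\<lambda>Z. (\<chi> i. moebius a b c d Z $ i $ j) $ i) Z"
  proof (rule cdiff_at_solve[OF open_type1_domain Z])
    show "cdiff_at cscale_mat (*) (\<lambda>x. (a + x ** c) $ i $ k) Z" for i k
      by (simp add: matrix_matrix_mult_def, intro cdiff_at_intros)
    show "cdiff_at cscale_mat (*) (\<lambda>x. (\<chi> i. (b + x ** d) $ i $ j) $ i) Z" for i
      by (simp add: matrix_matrix_mult_def, intro cdiff_at_intros)
    fix u :: "complex^'a^'a" assume u: "u \<in> type1_domain"
    show "det (a + u ** c) \<noteq> 0"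
      using pseudo_unitary_invertible[OF assms u] by (simp add: invertible_det_nz)
    show "(a + u ** c) *v (\<chi> i. moebius a b c d u $ i $ j) = (\<chi> i. (b + u ** d) $ i $ j)"
      using moebius_eq[OF assms u]
      by (simp add: vec_eq_iff matrix_matrix_mult_def matrix_vector_mult_def)
  qed
  then show "cdiff_at cscale_mat (*) (\<lambda>Z. moebius a b c d Z $ i $ j) Z" by simp
qed

lemma matrix_add_rdistrib: "((A :: 'a::semiring_1^'n^'m) + B) ** C = A ** C + B ** C"
  by (simp add: vec_eq_iff matrix_matrix_mult_def sum.distrib distrib_right)

text \<open>With N = a + Z c and W the image of Z, the block row N [1, W] is [1, Z] times the first
  matrix, and the second matrix takes it back to [1, Z]. Hence N inverts the denominator of the
  second map.\<close>

lemma moebius_inverse: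
  assumes u: "pseudo_unitary a b c d" "pseudo_unitary a' b' c' d'" and Z: "Z \<in> type1_domain"
    and inv: "a ** a' + b ** c' = mat 1" "a ** b' + b ** d' = 0"
             "c ** a' + d ** c' = 0" "c ** b' + d ** d' = mat 1"
  shows "moebius a' b' c' d' (moebius a b c d Z) = Z"
proof (rule moebius_eqI[OF u(2) moebius_in_domain[OF u(1) Z]])
  define N where "N = a + Z ** c"
  define R where "R = b + Z ** d"
  define W where "W = moebius a b c d Z"
  have NW: "N ** W = R" using moebius_eq[OF u(1) Z] by (simp add: N_def R_def W_def)
  have inj: "invertible N" unfolding N_def by (rule pseudo_unitary_invertible[OF u(1) Z])
  have 1: "N ** (a' + W ** c') = mat 1"
  proof -
    have "N ** (a' + W ** c') = N ** a' + R ** c'"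
      by (simp add: matrix_add_ldistrib matrix_mul_assoc NW)
    also have "\<dots> = (a ** a' + b ** c') + Z ** (c ** a' + d ** c')"
      by (simp only: N_def R_def matrix_add_ldistrib matrix_add_rdistrib matrix_mul_assoc add_ac)
    finally show ?thesis by (simp add: inv)
  qed
  have 2: "N ** (b' + W ** d') = Z"
  proof -
    have "N ** (b' + W ** d') = N ** b' + R ** d'"
      by (simp add: matrix_add_ldistrib matrix_mul_assoc NW)
    also have "\<dots> = (a ** b' + b ** d') + Z ** (c ** b' + d ** d')"
      by (simp only: N_def R_def matrix_add_ldistrib matrix_add_rdistrib matrix_mul_assoc add_ac)
    finally show ?thesis by (simp add: inv)
  qed
  have "(a' + W ** c') ** N = mat 1" using 1 by (simp add: matrix_left_right_inverse)
  then show "(a' + moebius a b c d Z ** c') ** Z = b' + moebius a b c d Z ** d'"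
    using 2 by (metis W_def matrix_mul_assoc matrix_mul_lid)
qed

lemma moebius_automorphism:
  assumes u: "pseudo_unitary a b c d" "pseudo_unitary a' b' c' d'"
    and inv: "a ** a' + b ** c' = mat 1" "a ** b' + b ** d' = 0"
             "c ** a' + d ** c' = 0" "c ** b' + d ** d' = mat 1"
    and inv': "a' ** a + b' ** c = mat 1" "a' ** b + b' ** d = 0"
             "c' ** a + d' ** c = 0" "c' ** b + d' ** d = mat 1"
  shows "moebius a b c d \<in> automorphisms type1_domain"
  using assms
  by (intro automorphismI[where \<psi> = "moebius a' b' c' d'"] moebius_in_domain moebius_holomorphic moebius_inverse)

section \<open>Automorphisms by permutations and phases\<close>

lemma sum_bij_UNIV: "bij \<pi> \<Longrightarrow> (\<Sum>i\<in>UNIV. f (\<pi> i)) = (\<Sum>i\<in>UNIV. f i)"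
  by (rule sum.reindex_bij_betw) simp

text \<open>For bijective \<open>\<pi>\<close>, \<open>\<rho>\<close> and unimodular
  \<open>\<eta>\<close>, \<open>\<theta>\<close> this is multiplication by unitary monomial matrices
  on both sides. It absorbs the order and the phases of the components of a monomial map.\<close>

definition monomial_trans ::
  "('r \<Rightarrow> 'r) \<Rightarrow> ('s \<Rightarrow> 's) \<Rightarrow> ('r \<Rightarrow> complex) \<Rightarrow> ('s \<Rightarrow> complex) \<Rightarrow> complex^'s::finite^'r::finite \<Rightarrow> complex^'s^'r" where
  "monomial_trans \<pi> \<rho> \<eta> \<theta> Z = (\<chi> k l. \<eta> k * Z $ \<pi> k $ \<rho> l * \<theta> l)"

lemma monomial_trans_in_domain:
  fixes Z :: "complex^'s::finite^'r::finite"
  assumes "bij \<pi>" "bij \<rho>" "\<And>k. cmod (\<eta> k) = 1" "\<And>l. cmod (\<theta> l) = 1" and Z: "Z \<in> type1_domain"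
  shows "monomial_trans \<pi> \<rho> \<eta> \<theta> Z \<in> type1_domain"
proof (rule type1_domainI)
  fix v :: "complex^'r" assume v: "v \<noteq> 0"
  define w where "w = (\<chi> k. v $ (inv \<pi> k) * \<eta> (inv \<pi> k))"
  have w: "w $ \<pi> k = v $ k * \<eta> k" for k
    using assms(1) by (simp add: w_def bij_is_inj)
  have nw: "norm w = norm v"
  proof (rule power2_eq_imp_eq)
    show "(norm w)\<^sup>2 = (norm v)\<^sup>2"
      unfolding norm_vec_sq using sum_bij_UNIV[OF assms(1), of "\<lambda>i. (cmod (w $ i))\<^sup>2"] assms(3)
      by (simp add: w norm_mult)
  qed auto
  then have "w \<noteq> 0" using v by auto
  have comp: "(v v* monomial_trans \<pi> \<rho> \<eta> \<theta> Z) $ l = (w v* Z) $ \<rho> l * \<theta> l" for l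
  proof -
    have "(v v* monomial_trans \<pi> \<rho> \<eta> \<theta> Z) $ l = (\<Sum>i\<in>UNIV. w $ \<pi> i * Z $ \<pi> i $ \<rho> l) * \<theta> l"
      by (simp add: vector_matrix_mult_def monomial_trans_def w sum_distrib_right mult.assoc)
    also have "(\<Sum>i\<in>UNIV. w $ \<pi> i * Z $ \<pi> i $ \<rho> l) = (w v* Z) $ \<rho> l"
      using sum_bij_UNIV[OF assms(1), of "\<lambda>i. w $ i * Z $ i $ \<rho> l"] by (simp add: vector_matrix_mult_def)
    finally show ?thesis .
  qed
  have "norm (v v* monomial_trans \<pi> \<rho> \<eta> \<theta> Z) = norm (w v* Z)"
  proof (rule power2_eq_imp_eq)
    show "(norm (v v* monomial_trans \<pi> \<rho> \<eta> \<theta> Z))\<^sup>2 = (norm (w v* Z))\<^sup>2"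
      unfolding norm_vec_sq using sum_bij_UNIV[OF assms(2), of "\<lambda>l. (cmod ((w v* Z) $ l))\<^sup>2"] assms(4)
      by (simp add: comp norm_mult)
  qed auto
  then show "norm (v v* monomial_trans \<pi> \<rho> \<eta> \<theta> Z) < norm v"
    using type1_domainD[OF Z \<open>w \<noteq> 0\<close>] nw by simp
qed

lemma monomial_trans_inverse:
  assumes "bij \<pi>" "bij \<rho>" "\<And>k. cmod (\<eta> k) = 1" "\<And>l. cmod (\<theta> l) = 1"
  shows "monomial_trans (inv \<pi>) (inv \<rho>) (\<lambda>k. cnj (\<eta> (inv \<pi> k))) (\<lambda>l. cnj (\<theta> (inv \<rho> l)))
           (monomial_trans \<pi> \<rho> \<eta> \<theta> Z) = Z"
    and "monomial_trans \<pi> \<rho> \<eta> \<theta>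
           (monomial_trans (inv \<pi>) (inv \<rho>) (\<lambda>k. cnj (\<eta> (inv \<pi> k))) (\<lambda>l. cnj (\<theta> (inv \<rho> l))) Z) = Z"
proof -
  have 1: "cnj (\<eta> k) * \<eta> k = 1" "cnj (\<theta> l) * \<theta> l = 1" for k l
    using assms(3)[of k] assms(4)[of l] complex_norm_square[of "\<eta> k"] complex_norm_square[of "\<theta> l"]
    by (simp_all add: mult.commute)
  have 2: "cnj (\<eta> k) * (\<eta> k * z * \<theta> l) * cnj (\<theta> l) = z" "\<eta> k * (cnj (\<eta> k) * z * cnj (\<theta> l)) * \<theta> l = z" for k l z
  proof -
    have "cnj (\<eta> k) * (\<eta> k * z * \<theta> l) * cnj (\<theta> l) = (cnj (\<eta> k) * \<eta> k) * (cnj (\<theta> l) * \<theta> l) * z"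
      by (simp add: algebra_simps)
    then show "cnj (\<eta> k) * (\<eta> k * z * \<theta> l) * cnj (\<theta> l) = z" by (simp add: 1)
    have "\<eta> k * (cnj (\<eta> k) * z * cnj (\<theta> l)) * \<theta> l = (cnj (\<eta> k) * \<eta> k) * (cnj (\<theta> l) * \<theta> l) * z"
      by (simp add: algebra_simps)
    then show "\<eta> k * (cnj (\<eta> k) * z * cnj (\<theta> l)) * \<theta> l = z" by (simp add: 1)
  qed
  have 3: "\<pi> (inv \<pi> k) = k" "inv \<pi> (\<pi> k) = k" "\<rho> (inv \<rho> l) = l" "inv \<rho> (\<rho> l) = l" for k l
    using assms(1,2) by (simp_all add: bij_is_surj surj_f_inv_f bij_is_inj)
  show "monomial_trans (inv \<pi>) (inv \<rho>) (\<lambda>k. cnj (\<eta> (inv \<pi> k))) (\<lambda>l. cnj (\<theta> (inv \<rho> l)))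
           (monomial_trans \<pi> \<rho> \<eta> \<theta> Z) = Z"
    unfolding vec_eq_iff using 2(1) by (simp add: monomial_trans_def 3)
  show "monomial_trans \<pi> \<rho> \<eta> \<theta>
           (monomial_trans (inv \<pi>) (inv \<rho>) (\<lambda>k. cnj (\<eta> (inv \<pi> k))) (\<lambda>l. cnj (\<theta> (inv \<rho> l))) Z) = Z"
    unfolding vec_eq_iff using 2(2) by (simp add: monomial_trans_def 3)
qed

lemma monomial_trans_holomorphic: "mat_holomorphic_on (monomial_trans \<pi> \<rho> \<eta> \<theta>) type1_domain"
  unfolding mat_holomorphic_on_iff monomial_trans_def
  by (intro conjI ballI cdiff_at_matI open_type1_domain) (simp, intro cdiff_at_intros)

lemma monomial_trans_automorphism:
  assumes "bij \<pi>" "bij \<rho>" "\<And>k. cmod (\<eta> k) = 1" "\<And>l. cmod (\<theta> l) = 1"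
  shows "monomial_trans \<pi> \<rho> \<eta> \<theta> \<in> automorphisms type1_domain"
  using assms
  by (intro automorphismI[where \<psi> = "monomial_trans (inv \<pi>) (inv \<rho>) (\<lambda>k. cnj (\<eta> (inv \<pi> k))) (\<lambda>l. cnj (\<theta> (inv \<rho> l)))"]
        monomial_trans_in_domain monomial_trans_holomorphic monomial_trans_inverse bij_imp_bij_inv) auto


section \<open>Generalized balls and induced maps\<close>

lemma abs_proj_eq_iff:
  "v \<noteq> 0 \<Longrightarrow> w \<noteq> 0 \<Longrightarrow> abs_proj v = abs_proj w \<longleftrightarrow> (\<exists>c. c \<noteq> 0 \<and> w = c *s v)"
  using Quotient3_rel[OF Quotient3_proj, of v w] Quotient3_rel[OF Quotient3_proj, of v v]
    Quotient3_rel[OF Quotient3_proj, of w w]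
  by (auto simp: proj_rel_def intro: exI[of _ 1])

lemma rep_proj_nonzero: "rep_proj X \<noteq> 0"
  using Quotient3_rep_reflp[OF Quotient3_proj, of X] by (simp add: proj_rel_def)

lemma abs_rep_proj: "abs_proj (rep_proj X) = X"
  by (rule Quotient3_abs_rep[OF Quotient3_proj])

lemma rep_abs_proj:
  assumes "v \<noteq> 0"
  obtains c where "c \<noteq> 0" "rep_proj (abs_proj v) = c *s v"
  using abs_proj_eq_iff[OF assms rep_proj_nonzero, of "abs_proj v"] abs_rep_proj by metis

lemma open_proj_iff: "open U \<longleftrightarrow> open {v. v \<noteq> 0 \<and> abs_proj v \<in> U}"
  by (simp add: open_proj_def)

section \<open>The cone over the generalized ball\<close>

definition vleft :: "complex^('r::finite + 's::finite) \<Rightarrow> complex^'r" where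
  "vleft z = (\<chi> i. z $ Inl i)"

definition vright :: "complex^('r::finite + 's::finite) \<Rightarrow> complex^'s" where
  "vright z = (\<chi> j. z $ Inr j)"

definition vjoin :: "complex^'r::finite \<Rightarrow> complex^'s::finite \<Rightarrow> complex^('r + 's)" where
  "vjoin a b = (\<chi> k. case k of Inl i \<Rightarrow> a $ i | Inr j \<Rightarrow> b $ j)"

lemma vleft_nth [simp]: "vleft z $ i = z $ Inl i" by (simp add: vleft_def)
lemma vright_nth [simp]: "vright z $ j = z $ Inr j" by (simp add: vright_def)
lemma vjoin_nth [simp]: "vjoin a b $ Inl i = a $ i" "vjoin a b $ Inr j = b $ j"
  by (simp_all add: vjoin_def)

lemma vleft_vjoin [simp]: "vleft (vjoin a b) = a" by (simp add: vec_eq_iff)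
lemma vright_vjoin [simp]: "vright (vjoin a b) = b" by (simp add: vec_eq_iff)
lemma vjoin_eqI: "vleft z = a \<Longrightarrow> vright z = b \<Longrightarrow> vjoin a b = z"
  by (auto simp: vec_eq_iff vjoin_def split: sum.splits)
lemma vjoin_vleft_vright [simp]: "vjoin (vleft z) (vright z) = z" by (rule vjoin_eqI) auto

lemma vleft_cmult [simp]: "vleft (c *s z) = c *s vleft z" by (simp add: vec_eq_iff)
lemma vright_cmult [simp]: "vright (c *s z) = c *s vright z" by (simp add: vec_eq_iff)

lemma norm_cmult_vec: "norm (c *s (z :: complex^'n::finite)) = cmod c * norm z"
  by (rule power2_eq_imp_eq) (auto simp: norm_vec_sq power_mult_distrib norm_mult sum_distrib_left)

lemma continuous_on_vjoin [continuous_intros]: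
  fixes a :: "'x::topological_space \<Rightarrow> complex^'r::finite" and b :: "'x \<Rightarrow> complex^'s::finite"
  assumes "continuous_on S a" "continuous_on S b"
  shows "continuous_on S (\<lambda>x. vjoin (a x) (b x))"
  unfolding vjoin_def
proof (rule continuous_on_vec_lambda)
  fix k :: "'r + 's"
  show "continuous_on S (\<lambda>x. case k of Inl i \<Rightarrow> a x $ i | Inr j \<Rightarrow> b x $ j)"
    using assms by (cases k) (auto intro!: continuous_intros)
qed

lemma continuous_on_vleft [continuous_intros]:
  "continuous_on S z \<Longrightarrow> continuous_on S (\<lambda>x. vleft (z x))"
  unfolding vleft_def by (intro continuous_intros)

lemma continuous_on_vright [continuous_intros]:
  "continuous_on S z \<Longrightarrow> continuous_on S (\<lambda>x. vright (z x))"
  unfolding vright_def by (intro continuous_intros)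

definition nform :: "complex^('r::finite + 's::finite) \<Rightarrow> real" where
  "nform z = (norm (vleft z))\<^sup>2 - (norm (vright z))\<^sup>2"

text \<open>All homogeneous coordinates of points of \<open>gen_ball\<close>. Strictness keeps the
  origin out, and connectedness, limits and derivatives can be handled here in a normed
  space.\<close>

definition pcone :: "(complex^('r::finite + 's::finite)) set" where
  "pcone = {z. nform z > 0}"

lemma nform_cmult: "nform (c *s z) = (cmod c)\<^sup>2 * nform z"
  by (simp add: nform_def norm_cmult_vec power_mult_distrib algebra_simps)

lemma continuous_on_nform [continuous_intros]:
  "continuous_on S z \<Longrightarrow> continuous_on S (\<lambda>x. nform (z x))"
  unfolding nform_def by (intro continuous_intros)

lemma nform_zero [simp]: "nform 0 = 0" by (simp add: nform_def vleft_def vright_def norm_vec_sq)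

lemma pcone_nonzero: "z \<in> pcone \<Longrightarrow> z \<noteq> 0" by (auto simp: pcone_def)

lemma pcone_iff: "z \<in> pcone \<longleftrightarrow> norm (vright z) < norm (vleft z)"
  using power_less_imp_less_base[of "norm (vright z)" 2 "norm (vleft z)"]
    power_strict_mono[of "norm (vright z)" "norm (vleft z)" 2] by (auto simp: pcone_def nform_def)

lemma nform_sums: "nform z = (\<Sum>i\<in>UNIV. (cmod (z $ Inl i))\<^sup>2) - (\<Sum>j\<in>UNIV. (cmod (z $ Inr j))\<^sup>2)"
  by (simp add: nform_def norm_vec_sq)

lemma gen_ball_eq: "gen_ball = abs_proj ` pcone"
  unfolding gen_ball_def pcone_def nform_sums by auto

lemma abs_proj_in_gen_ball:
  assumes "z \<noteq> 0"
  shows "abs_proj z \<in> gen_ball \<longleftrightarrow> z \<in> pcone"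
proof
  assume "abs_proj z \<in> gen_ball"
  then obtain w where w: "w \<in> pcone" "abs_proj z = abs_proj w" by (auto simp: gen_ball_eq)
  then obtain c where "c \<noteq> 0" "w = c *s z" using abs_proj_eq_iff[OF assms pcone_nonzero] by blast
  then show "z \<in> pcone" using w(1) by (simp add: pcone_def nform_cmult zero_less_mult_iff)
qed (auto simp: gen_ball_eq)

lemma open_pcone: "open pcone"
  unfolding pcone_def by (intro open_Collect_less continuous_intros)

text \<open>The cone is the image of (nonzero v) x (unit ball) under (v, w) \<mapsto> (v, |v| w),
  and a complex space without the origin is connected since its real dimension is at least
  2.\<close>

lemma connected_pcone: "connected (pcone :: (complex^('r::finite + 's::finite)) set)"
proof -
  let ?D = "(- {0 :: complex^'r}) \<times> ball (0 :: complex^'s) 1"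
  let ?h = "\<lambda>(v, w). vjoin v (norm v *\<^sub>R w) :: complex^('r + 's)"
  have "pcone = ?h ` ?D"
  proof (intro equalityI subsetI)
    fix z :: "complex^('r + 's)" assume "z \<in> pcone"
    then have z: "norm (vright z) < norm (vleft z)" by (simp add: pcone_iff)
    then have "vleft z \<noteq> 0" by auto
    then have "z = ?h (vleft z, inverse (norm (vleft z)) *\<^sub>R vright z)" by simp
    moreover have "(vleft z, inverse (norm (vleft z)) *\<^sub>R vright z) \<in> ?D"
      using z \<open>vleft z \<noteq> 0\<close> by (simp add: field_simps)
    ultimately show "z \<in> ?h ` ?D" by blast
  next
    fix z assume "z \<in> ?h ` ?D"
    then obtain v w where "v \<noteq> 0" "norm w < 1" "z = vjoin v (norm v *\<^sub>R w)" by force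
    then show "z \<in> pcone" using mult_strict_left_mono[of "norm w" 1 "norm v"] by (simp add: pcone_iff)
  qed
  moreover have "connected ?D"
    by (intro connected_Times connected_punctured_universe) (auto simp: Suc_leI)
  moreover have "continuous_on ?D ?h"
    unfolding case_prod_beta by (intro continuous_intros)
  ultimately show ?thesis using connected_continuous_image[of ?D ?h] by metis
qed

section \<open>Identity theorem and density off an analytic subset\<close>

text \<open>What is needed to restrict a function to complex lines; it allows one identity theorem
  for vectors and for matrices.\<close>

definition complex_scaling :: "(complex \<Rightarrow> 'a::real_normed_vector \<Rightarrow> 'a) \<Rightarrow> bool" where
  "complex_scaling sa \<longleftrightarrow> vector_space sa \<and> (\<forall>a v. sa (complex_of_real a) v = a *\<^sub>R v) \<and>
     (\<forall>x d z. cdiff_at (*) sa (\<lambda>\<zeta>. x + sa \<zeta> d) z)"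

lemma complex_scaling_vec: "complex_scaling ((*s) :: complex \<Rightarrow> complex^'n::finite \<Rightarrow> _)"
  unfolding complex_scaling_def
  by (auto intro: vec.vector_space_axioms cdiff_at_vec_line simp: vec_eq_iff) (simp_all add: scaleR_conv_of_real)

lemma complex_scaling_mat: "complex_scaling (cscale_mat :: complex \<Rightarrow> complex^'s::finite^'r::finite \<Rightarrow> _)"
  unfolding complex_scaling_def
  using vector_space_cscale_mat cdiff_at_mat_line
proof (intro conjI allI)
  show "cscale_mat (complex_of_real a) v = a *\<^sub>R v" for a and v :: "complex^'s^'r"
    by (simp add: vec_eq_iff cscale_mat_def) (simp add: scaleR_conv_of_real)
qed

lemma holomorphic_on_line:
  fixes x d :: "'a::real_normed_vector"
  assumes sa: "complex_scaling sa" and U: "open U" "convex U"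
    and \<phi>: "\<And>x. x \<in> U \<Longrightarrow> cdiff_at sa (*) \<phi> x"
  defines "S \<equiv> {\<zeta>. x + sa \<zeta> d \<in> U}"
  shows "open S" "connected S" "(\<lambda>\<zeta>. \<phi> (x + sa \<zeta> d)) holomorphic_on S"
proof -
  have line: "cdiff_at (*) sa (\<lambda>\<zeta>. x + sa \<zeta> d) z" for z
    using sa by (auto simp: complex_scaling_def)
  interpret vector_space sa using sa by (auto simp: complex_scaling_def)
  have "continuous_on UNIV (\<lambda>\<zeta>. x + sa \<zeta> d)"
    using cdiff_at_imp_isCont[OF line] by (simp add: continuous_at_imp_continuous_on)
  then have "open ((\<lambda>\<zeta>. x + sa \<zeta> d) -` U)" using U(1) by (simp add: open_vimage)
  then show "open S" by (simp add: S_def vimage_def)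
  have "convex S"
  proof (rule convexI)
    fix \<zeta> \<eta> :: complex and a b :: real
    assume *: "\<zeta> \<in> S" "\<eta> \<in> S" "0 \<le> a" "0 \<le> b" "a + b = 1"
    have sc: "sa (complex_of_real t) v = t *\<^sub>R v" for t v using sa by (auto simp: complex_scaling_def)
    have "x + sa (a *\<^sub>R \<zeta> + b *\<^sub>R \<eta>) d = (a + b) *\<^sub>R x + (a *\<^sub>R sa \<zeta> d + b *\<^sub>R sa \<eta> d)"
      using *(5) by (simp add: scaleR_conv_of_real scale_left_distrib scale_scale[symmetric] sc del: scale_scale)
    also have "\<dots> = a *\<^sub>R (x + sa \<zeta> d) + b *\<^sub>R (x + sa \<eta> d)" by (simp add: algebra_simps)
    also have "\<dots> \<in> U" using * U(2) by (intro convexD) (auto simp: S_def)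
    finally show "a *\<^sub>R \<zeta> + b *\<^sub>R \<eta> \<in> S" by (simp add: S_def)
  qed
  then show "connected S" by (rule convex_connected)
  show "(\<lambda>\<zeta>. \<phi> (x + sa \<zeta> d)) holomorphic_on S"
    by (rule cdiff_at_imp_holomorphic, rule cdiff_at_compose[OF line \<phi>]) (simp add: S_def)
qed

text \<open>The complex line through a point of V and y meets the convex set U in a connected slice,
  on which the one-variable identity theorem applies.\<close>

lemma cdiff_identity:
  assumes sa: "complex_scaling sa" and U: "open U" "convex U"
    and \<phi>: "\<And>x. x \<in> U \<Longrightarrow> cdiff_at sa (*) \<phi> x"
    and V: "open V" "V \<noteq> {}" "V \<subseteq> U" "\<And>x. x \<in> V \<Longrightarrow> \<phi> x = 0" and y: "y \<in> U"
  shows "\<phi> y = 0"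
proof -
  interpret vector_space sa using sa by (auto simp: complex_scaling_def)
  obtain x where x: "x \<in> V" using V by blast
  note line = holomorphic_on_line[OF sa U \<phi>, where x = x and d = "y - x"]
  note lineV = cdiff_at_imp_isCont[of "(*)" sa "\<lambda>\<zeta>. x + sa \<zeta> (y - x)"]
  have "continuous_on UNIV (\<lambda>\<zeta>. x + sa \<zeta> (y - x))"
    using sa lineV by (auto simp: complex_scaling_def continuous_at_imp_continuous_on)
  then have T: "open {\<zeta>. x + sa \<zeta> (y - x) \<in> V}"
    using open_vimage[OF V(1)] by (simp add: vimage_def)
  have "\<phi> (x + sa 1 (y - x)) = 0"
  proof (rule analytic_continuation[OF line(3) line(1) line(2), where U = "{\<zeta>. x + sa \<zeta> (y - x) \<in> V}" and \<xi> = 0])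
    show "0 islimpt {\<zeta>. x + sa \<zeta> (y - x) \<in> V}"
      using x T by (intro interior_limit_point) (simp add: interior_open)
  qed (use x V y in auto)
  then show ?thesis by simp
qed

text \<open>Otherwise the cone over S has interior points. Near a limit of such points S is the zero
  set of functions that vanish on an open part of a ball, hence on the whole ball; so the interior
  is also closed in \<open>pcone\<close>, and connectedness forces S to be all of
  \<open>gen_ball\<close>.\<close>

lemma analytic_subset_complement_dense:
  fixes S :: "('r::finite + 's::finite) proj set"
  assumes S: "analytic_subset gen_ball S" "S \<noteq> gen_ball" and z: "z \<in> pcone" and V: "open V" "z \<in> V"
  obtains w where "w \<in> V" "w \<in> pcone" "abs_proj w \<notin> S"
proof (rule ccontr)
  assume "\<not> thesis"
  then have zV: "w \<in> V \<inter> pcone \<Longrightarrow> abs_proj w \<in> S" for w using that by blast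
  define E where "E = {w \<in> pcone. abs_proj w \<in> S}"
  define I where "I = interior E"
  have "I \<noteq> {}"
  proof -
    have "V \<inter> pcone \<subseteq> I"
      unfolding I_def by (rule interior_maximal) (use zV V open_pcone in \<open>auto simp: E_def\<close>)
    then show ?thesis using V z by blast
  qed
  have closed: "z \<in> I" if z: "z \<in> pcone" "z \<in> closure I" for z
  proof -
    have "abs_proj z \<in> gen_ball" using z by (simp add: gen_ball_eq)
    then obtain U F where U: "open U" "abs_proj z \<in> U" "U \<subseteq> gen_ball"
      and F: "\<And>\<phi>. \<phi> \<in> F \<Longrightarrow> proj_holomorphic_on \<phi> U" "S \<inter> U = {Y\<in>U. \<forall>\<phi>\<in>F. \<phi> Y = 0}"
      using S(1) unfolding analytic_subset_def by meson
    define C where "C = {v. v \<noteq> 0 \<and> abs_proj v \<in> U}"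
    have "open C" using U(1) by (simp add: open_proj_iff C_def)
    moreover have "z \<in> C" using pcone_nonzero z U by (auto simp: C_def)
    ultimately obtain e where e: "e > 0" "ball z e \<subseteq> C" using open_contains_ball by blast
    have "\<phi> (abs_proj w) = 0" if \<phi>: "\<phi> \<in> F" and w: "w \<in> ball z e" for \<phi> w
    proof (rule cdiff_identity[OF complex_scaling_vec open_ball convex_ball, where \<phi> = "\<lambda>v. \<phi> (abs_proj v)"])
      show "cdiff_at (*s) (*) (\<lambda>v. \<phi> (abs_proj v)) x" if "x \<in> ball z e" for x
        using F(1)[OF \<phi>] that e unfolding proj_holomorphic_on_iff C_def by blast
      show "open (ball z e \<inter> I)" unfolding I_def by (intro open_Int open_ball open_interior)
      show "ball z e \<inter> I \<noteq> {}"
        using z(2) e(1) open_Int_closure_eq_empty[OF open_ball, of z e I] by force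
      show "\<phi> (abs_proj x) = 0" if "x \<in> ball z e \<inter> I" for x
      proof -
        have "x \<in> E" using that interior_subset by (auto simp: I_def)
        then have "abs_proj x \<in> S \<inter> U" using that e by (auto simp: C_def E_def)
        then show ?thesis using F(2) \<phi> by blast
      qed
    qed (use w in auto)
    then have "ball z e \<subseteq> E"
    proof (intro subsetI)
      fix w assume *: "\<And>\<phi> w. \<phi> \<in> F \<Longrightarrow> w \<in> ball z e \<Longrightarrow> \<phi> (abs_proj w) = 0" and w: "w \<in> ball z e"
      then have "w \<in> C" using e by blast
      then have wC: "w \<noteq> 0" "abs_proj w \<in> U" by (auto simp: C_def)
      then have "abs_proj w \<in> S" using F(2) * w by blast
      moreover have "w \<in> pcone" using wC U abs_proj_in_gen_ball by blast
      ultimately show "w \<in> E" by (simp add: E_def)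
    qed
    then show ?thesis unfolding I_def using e(1) by (meson centre_in_ball interior_maximal open_ball subsetD)
  qed
  have "I \<subseteq> pcone" using interior_subset by (auto simp: I_def E_def)
  have "pcone - I = pcone \<inter> - closure I" using closed closure_subset by blast
  then have "open (pcone - I)" by (simp add: open_Int open_pcone open_Compl)
  then have "pcone - I = {}"
    using connectedD[OF connected_pcone, of I "pcone - I"] \<open>I \<noteq> {}\<close> \<open>I \<subseteq> pcone\<close> by (auto simp: I_def)
  then have "pcone \<subseteq> E" using interior_subset by (auto simp: I_def)
  then have "gen_ball \<subseteq> S" by (auto simp: gen_ball_eq E_def)
  then show False using S by (auto simp: analytic_subset_def)
qed

section \<open>Rational maps in homogeneous coordinates\<close>

definition pmap :: "('k::finite \<Rightarrow> ('n::finite, complex) mpolynomial) \<Rightarrow> complex^'n \<Rightarrow> complex^'k" where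
  "pmap g z = (\<chi> k. peval (g k) z)"

lemma pmap_nth [simp]: "pmap g z $ k = peval (g k) z" by (simp add: pmap_def)

lemma peval_homogeneous:
  assumes "homogeneous d p"
  shows "peval p (c *s x) = c ^ d * peval p (x :: 'a::comm_ring_1^'n::finite)"
proof -
  have "(\<Prod>i\<in>UNIV. ((c *s x) $ i) ^ Poly_Mapping.lookup m i) =
      c ^ d * (\<Prod>i\<in>UNIV. (x $ i) ^ Poly_Mapping.lookup m i)" if "m \<in> Poly_Mapping.keys p" for m
    using assms that by (auto simp: homogeneous_def exp_sum_def power_mult_distrib prod.distrib power_sum)
  then show ?thesis
    unfolding peval_def sum_distrib_left by (intro sum.cong) (auto simp: algebra_simps)
qed

lemma continuous_on_pmap [continuous_intros]:
  "continuous_on S z \<Longrightarrow> continuous_on S (\<lambda>x. pmap g (z x))"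
  unfolding pmap_def peval_def by (intro continuous_intros)

lemma pmap_homogeneous:
  assumes "\<And>k. homogeneous d (g k)"
  shows "pmap g (c *s z) = c ^ d *s pmap g z"
  by (simp add: vec_eq_iff peval_homogeneous[OF assms])

lemma rational_map_homogeneous:
  assumes "rational_map g" obtains d where "\<And>k. homogeneous d (g k)"
  using assms by (auto simp: rational_map_def)

lemma indeterminacy_iff:
  assumes "rational_map g" "z \<noteq> 0"
  shows "abs_proj z \<in> indeterminacy g \<longleftrightarrow> pmap g z = 0"
proof -
  obtain d where d: "\<And>k. homogeneous d (g k)" using rational_map_homogeneous[OF assms(1)] by blast
  obtain c where c: "c \<noteq> 0" "rep_proj (abs_proj z) = c *s z" using rep_abs_proj[OF assms(2)] by blast
  have "peval (g k) (rep_proj (abs_proj z)) = c ^ d * peval (g k) z" for k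
    unfolding c(2) by (rule peval_homogeneous[OF d])
  then show ?thesis using c(1) by (simp add: indeterminacy_def vec_eq_iff)
qed

lemma rat_app_abs_proj:
  assumes "rational_map g" "z \<noteq> 0" "pmap g z \<noteq> 0"
  shows "rat_app g (abs_proj z) = abs_proj (pmap g z)"
proof -
  obtain d where d: "\<And>k. homogeneous d (g k)" using rational_map_homogeneous[OF assms(1)] by blast
  obtain c where c: "c \<noteq> 0" "rep_proj (abs_proj z) = c *s z" using rep_abs_proj[OF assms(2)] by blast
  have "rat_app g (abs_proj z) = abs_proj (pmap g (c *s z))"
    by (simp add: rat_app_def c pmap_def)
  also have "\<dots> = abs_proj (pmap g z)"
    using c assms(3) by (subst abs_proj_eq_iff)
      (auto simp: pmap_homogeneous[OF d] intro!: exI[of _ "inverse (c ^ d)"] simp: vector_smult_assoc)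
  finally show ?thesis .
qed

lemma ball_map_nform_pos:
  assumes "ball_rational_map g" "z \<in> pcone" "pmap g z \<noteq> 0"
  shows "nform (pmap g z) > 0"
proof -
  have r: "rational_map g" using assms(1) by (simp add: ball_rational_map_def)
  have "abs_proj z \<in> gen_ball - indeterminacy g"
    using assms pcone_nonzero indeterminacy_iff[OF r] abs_proj_in_gen_ball by blast
  then have "rat_app g (abs_proj z) \<in> gen_ball" using assms(1) by (auto simp: ball_rational_map_def)
  then have "pmap g z \<in> pcone"
    using rat_app_abs_proj[OF r pcone_nonzero[OF assms(2)] assms(3)] abs_proj_in_gen_ball[OF assms(3)] by simp
  then show ?thesis by (simp add: pcone_def)
qed

section \<open>Boundary behaviour of proper maps\<close>

lemma boundary_sequence:
  fixes z :: "complex^('r::finite + 's::finite)"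
  assumes "nform z = 0" "z \<noteq> 0"
  obtains w where "w \<longlonglongrightarrow> z" "\<And>n. w n \<in> pcone"
proof
  define w where "w n = vjoin (vleft z) ((1 - 1 / real (n + 2)) *\<^sub>R vright z)" for n
  have eq: "norm (vleft z) = norm (vright z)"
    by (rule power2_eq_imp_eq) (use assms(1) in \<open>auto simp: nform_def\<close>)
  have "vright z \<noteq> 0"
  proof
    assume "vright z = 0"
    then have "vleft z = 0" using eq by simp
    with \<open>vright z = 0\<close> have "vjoin (vleft z) (vright z) = vjoin 0 0" by simp
    also have "vjoin 0 0 = (0 :: complex^('r + 's))" by (rule vjoin_eqI) (auto simp: vec_eq_iff)
    finally show False using assms(2) by simp
  qed
  then show "w n \<in> pcone" for n
    by (simp add: w_def pcone_iff eq)
  have "(\<lambda>n. 1 - 1 / real (n + 2)) \<longlonglongrightarrow> 1 - 0"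
    by (intro tendsto_diff tendsto_const) (rule LIMSEQ_ignore_initial_segment[OF lim_1_over_n])
  moreover have "isCont (\<lambda>t. vjoin (vleft z) (t *\<^sub>R vright z)) 1"
    by (rule continuous_on_interior[of UNIV]) (auto intro!: continuous_intros)
  ultimately have "(\<lambda>n. vjoin (vleft z) ((1 - 1 / real (n + 2)) *\<^sub>R vright z)) \<longlonglongrightarrow> vjoin (vleft z) (1 *\<^sub>R vright z)"
    using isCont_tendsto_compose[of 1 "\<lambda>t. vjoin (vleft z) (t *\<^sub>R vright z)" "\<lambda>n. 1 - 1 / real (n + 2)"] by simp
  then show "w \<longlonglongrightarrow> z" by (simp add: w_def[abs_def])
qed

lemma abs_proj_in_frontier:
  assumes "nform z = 0" "z \<noteq> 0"
  shows "abs_proj z \<in> frontier gen_ball"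
proof -
  have nb: "abs_proj z \<notin> gen_ball" using assms by (simp add: abs_proj_in_gen_ball pcone_def)
  then have "abs_proj z \<notin> interior gen_ball" using interior_subset by blast
  moreover have "abs_proj z islimpt gen_ball"
    unfolding islimpt_def
  proof (intro allI impI)
    fix T assume T: "abs_proj z \<in> T" "open T"
    obtain w where w: "w \<longlonglongrightarrow> z" "\<And>n. w n \<in> pcone" using boundary_sequence[OF assms] by blast
    have "open {v. v \<noteq> 0 \<and> abs_proj v \<in> T}" using T by (simp add: open_proj_iff)
    then have "eventually (\<lambda>n. w n \<in> {v. v \<noteq> 0 \<and> abs_proj v \<in> T}) sequentially"
      by (rule topological_tendstoD[OF w(1)]) (use T assms(2) in auto)
    then obtain n where "abs_proj (w n) \<in> T" by (auto simp: eventually_sequentially)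
    moreover have "abs_proj (w n) \<in> gen_ball" using w(2) by (simp add: gen_ball_eq)
    moreover have "abs_proj (w n) \<noteq> abs_proj z" using nb calculation(2) by metis
    ultimately show "\<exists>y\<in>gen_ball. y \<in> T \<and> y \<noteq> abs_proj z" by (intro bexI conjI)
  qed
  ultimately show ?thesis by (simp add: frontier_def closure_def)
qed

text \<open>Vectors of negative form give an open set disjoint from the ball, and those of positive
  form give the ball itself, which is open; neither meets the frontier.\<close>

lemma frontier_gen_ball_nform:
  assumes "X \<in> frontier gen_ball"
  shows "nform (rep_proj X) = 0"
proof (rule ccontr)
  assume n: "nform (rep_proj X) \<noteq> 0"
  have og: "open (gen_ball :: ('a + 'b) proj set)"
  proof -
    have "{v. v \<noteq> 0 \<and> abs_proj v \<in> (gen_ball :: ('a + 'b) proj set)} = pcone"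
      using abs_proj_in_gen_ball pcone_nonzero by blast
    then show ?thesis by (simp add: open_proj_iff open_pcone)
  qed
  then have "X \<notin> gen_ball" using assms by (simp add: frontier_def interior_open)
  then have "rep_proj X \<notin> pcone" using abs_proj_in_gen_ball[OF rep_proj_nonzero, of X] by (simp add: abs_rep_proj)
  with n have neg: "nform (rep_proj X) < 0" by (simp add: pcone_def)
  define T where "T = abs_proj ` {z :: complex^('a + 'b). nform z < 0}"
  have T: "v \<noteq> 0 \<and> abs_proj v \<in> T \<longleftrightarrow> nform v < 0" for v
  proof
    assume v: "v \<noteq> 0 \<and> abs_proj v \<in> T"
    then obtain w where w: "nform w < 0" "abs_proj v = abs_proj w" by (auto simp: T_def)
    then have "w \<noteq> 0" by auto
    then obtain c where "c \<noteq> 0" "w = c *s v" using abs_proj_eq_iff w v by blast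
    then show "nform v < 0" using w by (simp add: nform_cmult mult_less_0_iff not_less)
  qed (auto simp: T_def)
  have "open T" unfolding open_proj_iff T by (intro open_Collect_less continuous_intros)
  moreover have "X \<in> T" using neg T abs_rep_proj by metis
  moreover have "X \<in> closure gen_ball" using assms by (simp add: frontier_def)
  ultimately obtain Y where "Y \<in> gen_ball" "Y \<in> T"
    using \<open>X \<notin> gen_ball\<close> islimptE[of X gen_ball T] unfolding closure_def by blast
  then show False
    using T[of "rep_proj Y"] abs_proj_in_gen_ball[OF rep_proj_nonzero, of Y] rep_proj_nonzero[of Y]
    by (simp add: abs_rep_proj pcone_def)
qed

text \<open>Properness puts the images of a sequence tending to the boundary into every
  neighbourhood of the target boundary. The neighbourhoods |nform v| < e |v|^2 bound the form of the
  limit by e times its squared norm for each e > 0. Where the lift \<open>pmap g z\<close> is zero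
  there is nothing to show.\<close>

lemma proper_map_boundary:
  assumes g: "proper_ball_rational_map g" and z: "nform z = 0" "z \<noteq> 0"
  shows "nform (pmap g z) = 0"
proof (cases "pmap g z = 0")
  case False
  have bm: "ball_rational_map g" and r: "rational_map g"
    using g by (auto simp: proper_ball_rational_map_def ball_rational_map_def)
  define U where "U = - indeterminacy g"
  have Uset: "{v. v \<noteq> 0 \<and> abs_proj v \<in> U} = {v. v \<noteq> 0} \<inter> {v. pmap g v \<noteq> 0}"
    using indeterminacy_iff[OF r] by (auto simp: U_def)
  have oU: "open U"
    unfolding open_proj_iff Uset by (intro open_Int open_Collect_neq continuous_intros)
  have zU: "abs_proj z \<in> U" using indeterminacy_iff[OF r z(2)] False by (simp add: U_def)
  have fr: "abs_proj z \<in> frontier gen_ball" by (rule abs_proj_in_frontier[OF z])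
  obtain w where w: "w \<longlonglongrightarrow> z" "\<And>n. w n \<in> pcone" using boundary_sequence[OF z] by blast
  have contG: "(\<lambda>n. pmap g (w n)) \<longlonglongrightarrow> pmap g z"
    by (rule continuous_on_tendsto_compose[OF _ w(1), of UNIV]) (auto intro!: continuous_intros)
  have contN: "(\<lambda>n. nform (pmap g (w n))) \<longlonglongrightarrow> nform (pmap g z)"
    by (rule continuous_on_tendsto_compose[OF _ contG, of UNIV]) (auto intro!: continuous_intros)
  have bound: "\<bar>nform (pmap g z)\<bar> \<le> e * (norm (pmap g z))\<^sup>2" if "e > 0" for e
  proof -
    \<comment> \<open>Both sides scale alike, so the condition descends to projective space; it
      holds at every boundary point since the form vanishes there.\<close>
    define C where "C = {v :: complex^('a + 'b). v \<noteq> 0 \<and> \<bar>nform v\<bar> < e * (norm v)\<^sup>2}"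
    define V where "V = abs_proj ` C"
    have V: "{v. v \<noteq> 0 \<and> abs_proj v \<in> V} = C"
    proof (intro equalityI subsetI)
      fix v assume "v \<in> {v. v \<noteq> 0 \<and> abs_proj v \<in> V}"
      then obtain u where u: "v \<noteq> 0" "u \<in> C" "abs_proj v = abs_proj u" by (auto simp: V_def)
      then obtain c where "c \<noteq> 0" "u = c *s v" using abs_proj_eq_iff[of v u] by (auto simp: C_def)
      then show "v \<in> C" using u by (simp add: C_def nform_cmult norm_cmult_vec power_mult_distrib abs_mult)
    qed (auto simp: C_def V_def)
    have "C = {v. v \<noteq> 0} \<inter> {v. \<bar>nform v\<bar> < e * (norm v)\<^sup>2}" by (auto simp: C_def)
    then have "open V" unfolding open_proj_iff V
      by (auto intro!: open_Int open_Collect_neq open_Collect_less continuous_intros)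
    moreover have "frontier gen_ball \<subseteq> V"
    proof
      fix X :: "('a + 'b) proj" assume "X \<in> frontier gen_ball"
      then have "rep_proj X \<in> C"
        using frontier_gen_ball_nform[of X] that rep_proj_nonzero[of X] by (auto simp: C_def)
      then show "X \<in> V" using abs_rep_proj[of X] by (metis V_def image_eqI)
    qed
    ultimately have "\<forall>\<^sub>F W in at (abs_proj z) within (U \<inter> gen_ball). rat_app g W \<in> V"
      using g fr oU zU unfolding proper_ball_rational_map_def
      by (metis (no_types, lifting) Compl_disjoint2 IntI U_def)
    then obtain O' where O': "open O'" "abs_proj z \<in> O'"
       "\<And>W. W \<in> O' \<Longrightarrow> W \<noteq> abs_proj z \<Longrightarrow> W \<in> U \<inter> gen_ball \<Longrightarrow> rat_app g W \<in> V"
      unfolding eventually_at_topological by blast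
    have "open {v. v \<noteq> 0 \<and> abs_proj v \<in> O' \<inter> U}" 
      using open_Int[OF O'(1) oU] by (simp only: open_proj_iff)
    then have "eventually (\<lambda>n. w n \<in> {v. v \<noteq> 0 \<and> abs_proj v \<in> O' \<inter> U}) sequentially"
      using w(1) O'(2) zU z(2) by (intro topological_tendstoD) auto
    then have "eventually (\<lambda>n. \<bar>nform (pmap g (w n))\<bar> \<le> e * (norm (pmap g (w n)))\<^sup>2) sequentially"
    proof (rule eventually_mono)
      fix n assume n: "w n \<in> {v. v \<noteq> 0 \<and> abs_proj v \<in> O' \<inter> U}"
      have gb: "abs_proj (w n) \<in> gen_ball" using w(2) by (simp add: gen_ball_eq)
      moreover have "abs_proj z \<notin> gen_ball" using z by (simp add: abs_proj_in_gen_ball pcone_def)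
      ultimately have "abs_proj (w n) \<noteq> abs_proj z" by metis
      with gb have "rat_app g (abs_proj (w n)) \<in> V" using O'(3)[of "abs_proj (w n)"] n by auto
      moreover have nz: "pmap g (w n) \<noteq> 0" using n Uset by auto
      ultimately have "pmap g (w n) \<in> C" using n V rat_app_abs_proj[OF r] by auto
      then show "\<bar>nform (pmap g (w n))\<bar> \<le> e * (norm (pmap g (w n)))\<^sup>2" by (simp add: C_def)
    qed
    then show ?thesis
      by (intro tendsto_le[OF _ _ tendsto_rabs[OF contN], where f = "\<lambda>n. e * (norm (pmap g (w n)))\<^sup>2"]
            tendsto_mult tendsto_power tendsto_norm tendsto_const contG) auto
  qed
  show ?thesis
  proof (rule ccontr)
    assume n: "nform (pmap g z) \<noteq> 0"
    define e where "e = \<bar>nform (pmap g z)\<bar> / (2 * (norm (pmap g z))\<^sup>2)"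
    have "e > 0" using n False by (simp add: e_def)
    from bound[OF this] show False using n False by (simp add: e_def)
  qed
qed simp

text \<open>The relation is given only off an analytic subset. The point (A, A Z) is approached by
  generic \<open>v n\<close>, which need not satisfy \<open>vleft (v n) v* Z = vright (v n)\<close>;
  so Z is moved along with them to \<open>Y n\<close>, and continuity of \<open>f\<close> gives the
  limit.\<close>

lemma induced_map_relation:
  fixes f :: "complex^'s::finite^'r::finite \<Rightarrow> complex^'q::finite^'p::finite"
    and g :: "'p + 'q \<Rightarrow> ('r + 's, complex) mpolynomial"
  assumes ind: "induced_map f g" and cont: "continuous_on type1_domain f"
    and Z: "Z \<in> type1_domain" and A: "A \<noteq> 0"
  defines "w \<equiv> pmap g (vjoin A (A v* Z))"
  shows "vleft w v* f Z = vright w"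
proof -
  have r: "rational_map g" using ind by (auto simp: induced_map_def ball_rational_map_def)
  obtain S where S: "analytic_subset gen_ball S" "S \<noteq> gen_ball"
    and rel: "\<And>X. X \<in> gen_ball - S \<Longrightarrow> X \<notin> indeterminacy g \<and> f ` sharp X \<subseteq> sharp (rat_app g X)"
    using ind by (auto simp: induced_map_def)
  have gen: "vleft (pmap g z) v* f Y = vright (pmap g z)"
    if z: "z \<in> pcone" "abs_proj z \<notin> S" and Y: "Y \<in> type1_domain" "vleft z v* Y = vright z" for z Y
  proof -
    have z0: "z \<noteq> 0" by (rule pcone_nonzero[OF z(1)])
    have X: "abs_proj z \<in> gen_ball - S" using z by (auto simp: gen_ball_eq)
    then have nz: "pmap g z \<noteq> 0" using rel indeterminacy_iff[OF r z0] by blast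
    obtain c where c: "c \<noteq> 0" "rep_proj (abs_proj z) = c *s z" using rep_abs_proj[OF z0] by blast
    have "Y \<in> sharp (abs_proj z)"
    proof -
      have "(c *s vleft z) v* Y = c *s vright z" using Y(2) by (simp add: scalar_vector_matrix_assoc)
      then show ?thesis unfolding sharp_def c(2) vleft_def[symmetric] vright_def[symmetric]
        using Y(1) by simp
    qed
    then have "f Y \<in> sharp (abs_proj (pmap g z))"
      using rel[OF X] rat_app_abs_proj[OF r z0 nz] by auto
    moreover obtain b where b: "b \<noteq> 0" "rep_proj (abs_proj (pmap g z)) = b *s pmap g z"
      using rep_abs_proj[OF nz] by blast
    ultimately have "(b *s vleft (pmap g z)) v* f Y = b *s vright (pmap g z)"
      unfolding sharp_def b(2) vleft_def[symmetric] vright_def[symmetric] by simp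
    then show ?thesis using b(1) by (simp add: scalar_vector_matrix_assoc)
  qed
  define z where "z = vjoin A (A v* Z)"
  have zc: "z \<in> pcone" using type1_domainD[OF Z A] by (simp add: pcone_iff z_def)
  have "\<exists>v. v \<in> ball z (1 / real (Suc n)) \<and> v \<in> pcone \<and> abs_proj v \<notin> S" for n
    by (rule analytic_subset_complement_dense[OF S zc open_ball, of z "1 / real (Suc n)"]) auto
  then obtain v where v: "\<And>n. v n \<in> ball z (1 / real (Suc n))" "\<And>n. v n \<in> pcone" "\<And>n. abs_proj (v n) \<notin> S"
    by metis
  have vz: "v \<longlonglongrightarrow> z"
  proof (rule metric_tendsto_imp_tendsto[OF LIMSEQ_inverse_real_of_nat])
    show "\<forall>\<^sub>F n in sequentially. dist (v n) z \<le> dist (inverse (real (Suc n))) 0"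
      using v(1) by (intro always_eventually allI) (auto simp: dist_commute inverse_eq_divide intro!: less_imp_le)
  qed
  \<comment> \<open>A rank-one correction: with a the left half of \<open>v n\<close> and b the
    defect of the equation at Z, the matrix with entries cnj(a_i) b_j / |a|^2 sends the row a to b.
    The defect tends to 0, hence \<open>Y n\<close> tends to Z.\<close>
  define Y where "Y n = Z + (\<chi> i j. cnj (vleft (v n) $ i) * (vright (v n) - vleft (v n) v* Z) $ j
      / of_real ((norm (vleft (v n)))\<^sup>2))" for n
  have nzA: "vleft (v n) \<noteq> 0" for n using v(2)[of n] by (auto simp: pcone_iff)
  have vY: "vleft (v n) v* Y n = vright (v n)" for n
  proof -
    define a b where "a = vleft (v n)" and "b = vright (v n) - vleft (v n) v* Z"
    have "(\<Sum>i\<in>UNIV. a $ i * (cnj (a $ i) * b $ j / of_real ((norm a)\<^sup>2))) = b $ j" for j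
    proof -
      have "(\<Sum>i\<in>UNIV. a $ i * (cnj (a $ i) * b $ j / of_real ((norm a)\<^sup>2)))
          = (\<Sum>i\<in>UNIV. a $ i * cnj (a $ i)) * b $ j / of_real ((norm a)\<^sup>2)"
        by (simp add: sum_distrib_right sum_divide_distrib mult.assoc)
      also have "(\<Sum>i\<in>UNIV. a $ i * cnj (a $ i)) = of_real ((norm a)\<^sup>2)"
        unfolding norm_vec_sq of_real_sum complex_norm_square by simp
      finally show ?thesis using nzA by (simp add: a_def)
    qed
    then have "a v* (\<chi> i j. cnj (a $ i) * b $ j / of_real ((norm a)\<^sup>2)) = b"
      by (simp add: vec_eq_iff vector_matrix_mult_def)
    then show ?thesis
      by (simp add: Y_def a_def b_def vector_matrix_mult_add_rdistrib)
  qed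
  have Al: "(\<lambda>n. vleft (v n)) \<longlonglongrightarrow> A"
    using continuous_on_tendsto_compose[OF continuous_on_vleft[OF continuous_on_id[of UNIV]] vz] by (simp add: z_def)
  have Bl: "(\<lambda>n. vright (v n)) \<longlonglongrightarrow> A v* Z"
    using continuous_on_tendsto_compose[OF continuous_on_vright[OF continuous_on_id[of UNIV]] vz] by (simp add: z_def)
  have YZ: "Y \<longlonglongrightarrow> Z"
  proof -
    have "Y \<longlonglongrightarrow> Z + (\<chi> i j. cnj (A $ i) * (A v* Z - A v* Z) $ j / of_real ((norm A)\<^sup>2))"
      unfolding Y_def vector_matrix_mult_def[of _ Z]
      using A by (intro tendsto_intros Al Bl[unfolded vector_matrix_mult_def]) auto
    also have "(\<chi> i j. cnj (A $ i) * (A v* Z - A v* Z) $ j / of_real ((norm A)\<^sup>2)) = 0"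
      by (simp add: vec_eq_iff)
    finally show ?thesis by simp
  qed
  have evY: "eventually (\<lambda>n. Y n \<in> type1_domain) sequentially"
    using topological_tendstoD[OF YZ open_type1_domain Z] .
  have fY: "(\<lambda>n. f (Y n)) \<longlonglongrightarrow> f Z"
    by (rule continuous_on_tendsto_compose[OF cont YZ Z evY])
  have G: "(\<lambda>n. pmap g (v n)) \<longlonglongrightarrow> w"
    using continuous_on_tendsto_compose[OF continuous_on_pmap[OF continuous_on_id[of UNIV], of g] vz] by (simp add: w_def z_def)
  have Gl: "(\<lambda>n. vleft (pmap g (v n))) \<longlonglongrightarrow> vleft w" "(\<lambda>n. vright (pmap g (v n))) \<longlonglongrightarrow> vright w"
    by (rule continuous_on_tendsto_compose[OF _ G, of UNIV], auto intro!: continuous_intros)+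
  have "(\<lambda>n. vleft (pmap g (v n)) v* f (Y n)) \<longlonglongrightarrow> vleft w v* f Z"
    unfolding vector_matrix_mult_def by (intro tendsto_intros Gl fY)
  moreover have "eventually (\<lambda>n. vright (pmap g (v n)) = vleft (pmap g (v n)) v* f (Y n)) sequentially"
    by (rule eventually_mono[OF evY]) (use gen v vY in auto)
  ultimately have "(\<lambda>n. vright (pmap g (v n))) \<longlonglongrightarrow> vleft w v* f Z"
    by (subst tendsto_cong)
  then show ?thesis using Gl(2) LIMSEQ_unique by blast
qed


section \<open>Polynomials and their sign patterns\<close>

abbreviation "lookup \<equiv> Poly_Mapping.lookup"
abbreviation "keys \<equiv> Poly_Mapping.keys"
abbreviation "single \<equiv> Poly_Mapping.single"

definition mon :: "('n::finite \<Rightarrow>\<^sub>0 nat) \<Rightarrow> 'a::comm_semiring_1^'n \<Rightarrow> 'a" where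
  "mon m x = (\<Prod>i\<in>UNIV. (x $ i) ^ lookup m i)"

lemma mon_add: "mon (m + n) x = mon m x * mon n x"
  by (simp add: mon_def lookup_add power_add prod.distrib)

lemma mon_zero [simp]: "mon 0 x = 1" by (simp add: mon_def)

lemma mon_single: "mon (single a k) x = (x $ a) ^ k"
proof -
  have "mon (single a k) x = (\<Prod>i\<in>UNIV. if i = a then (x $ a) ^ k else 1)"
    unfolding mon_def by (intro prod.cong) (auto simp: lookup_single when_def)
  then show ?thesis by simp
qed

lemma peval_superset:
  assumes "finite K" "keys p \<subseteq> K"
  shows "peval p x = (\<Sum>m\<in>K. lookup p m * mon m x)"
  unfolding peval_def mon_def
  by (rule sum.mono_neutral_left) (use assms in \<open>auto simp: in_keys_iff\<close>)

lemma peval_zero [simp]: "peval 0 x = 0" by (simp add: peval_def)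

lemma peval_add: "peval (p + q) x = peval p x + peval q x"
proof -
  let ?K = "keys p \<union> keys q"
  have "peval (p + q) x = (\<Sum>m\<in>?K. lookup (p + q) m * mon m x)"
    by (rule peval_superset) (auto dest: subsetD[OF Poly_Mapping.keys_add])
  then show ?thesis
    by (simp add: peval_superset[of ?K p] peval_superset[of ?K q] lookup_add distrib_right sum.distrib)
qed

lemma peval_diff: "peval (p - q) x = peval p x - peval q (x :: 'a::comm_ring_1^'n::finite)"
  using peval_add[of "p - q" q x] by simp

lemma peval_sum: "peval (\<Sum>i\<in>I. p i) x = (\<Sum>i\<in>I. peval (p i) x)"
  by (induction I rule: infinite_finite_induct) (auto simp: peval_add)

lemma peval_single: "peval (single m c) x = c * mon m x"
  by (cases "c = 0") (auto simp: peval_superset[of "{m}"])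

lemma poly_mapping_sum_single: "p = (\<Sum>m\<in>keys p. single m (lookup p m))"
proof (rule poly_mapping_eqI)
  fix k
  have "(\<Sum>m\<in>keys p. lookup (single m (lookup p m)) k)
      = (\<Sum>m\<in>keys p. if m = k then lookup p k else 0)"
    by (intro sum.cong) (auto simp: lookup_single when_def)
  then show "lookup p k
      = lookup (\<Sum>m\<in>keys p. single m (lookup p m)) k"
    by (simp add: lookup_sum in_keys_iff)
qed

lemma single_mult_eq:
  fixes a :: "'n \<Rightarrow>\<^sub>0 nat" and q :: "('n \<Rightarrow>\<^sub>0 nat) \<Rightarrow>\<^sub>0 'a::comm_semiring_1"
  shows
  "single a 1 * q
    = (\<Sum>m\<in>keys q. single (a + m) (lookup q m))"
  by (subst poly_mapping_sum_single[of q]) (simp add: sum_distrib_left mult_single)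

lemma peval_single_mult: "peval (single a 1 * q) x = mon a x * peval q x"
  unfolding single_mult_eq
  by (simp add: peval_sum peval_single mon_add peval_superset[of "keys q" q] sum_distrib_left mult_ac)

lemma lookup_single_mult:
  fixes a :: "'n \<Rightarrow>\<^sub>0 nat" and q :: "('n \<Rightarrow>\<^sub>0 nat) \<Rightarrow>\<^sub>0 'a::comm_semiring_1"
  shows "lookup (single a 1 * q) (a + \<nu>) = lookup q \<nu>"
proof -
  have "lookup (single a 1 * q) (a + \<nu>)
     = (\<Sum>m\<in>keys q. if m = \<nu> then lookup q \<nu> else 0)"
    unfolding single_mult_eq lookup_sum by (intro sum.cong) (auto simp: lookup_single when_def)
  then show ?thesis by (simp add: in_keys_iff)
qed

lemma lookup_single_mult_nonzero:
  fixes a :: "'n \<Rightarrow>\<^sub>0 nat" and q :: "('n \<Rightarrow>\<^sub>0 nat) \<Rightarrow>\<^sub>0 'a::comm_semiring_1"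
  assumes "lookup (single a 1 * q) \<mu> \<noteq> 0"
  obtains \<nu> where "\<mu> = a + \<nu>" "lookup (single a 1 * q) \<mu> = lookup q \<nu>"
proof -
  have "\<exists>m\<in>keys q. a + m = \<mu>"
  proof (rule ccontr)
    assume "\<not> ?thesis"
    then have "lookup (single a 1 * q) \<mu> = 0"
      unfolding single_mult_eq lookup_sum by (intro sum.neutral) (auto simp: lookup_single when_def)
    with assms show False by simp
  qed
  then show thesis using that lookup_single_mult by blast
qed

text \<open>A base-\<open>N\<close> expansion separates finitely many exponent vectors.\<close>

lemma separating_weights:
  fixes K :: "('n::finite \<Rightarrow>\<^sub>0 nat) set"
  assumes "finite K"
  obtains w where "inj_on (\<lambda>m. \<Sum>i\<in>UNIV. w i * lookup m i) K"
proof -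
  have "\<exists>w :: 'n \<Rightarrow> nat. \<forall>m\<in>K. \<forall>n\<in>K. (\<Sum>i\<in>S. w i * lookup m i) = (\<Sum>i\<in>S. w i * lookup n i)
      \<longrightarrow> (\<forall>i\<in>S. lookup m i = lookup n i)" if "finite S" for S
    using that
  proof (induction S)
    case (insert j S)
    then obtain w :: "'n \<Rightarrow> nat" where w: "\<And>m n. m \<in> K \<Longrightarrow> n \<in> K \<Longrightarrow>
      (\<Sum>i\<in>S. w i * lookup m i) = (\<Sum>i\<in>S. w i * lookup n i) \<Longrightarrow>
      (\<forall>i\<in>S. lookup m i = lookup n i)" by blast
    define N where "N = Suc (Max (insert 0 ((\<lambda>m. lookup m j) ` K)))"
    have N: "lookup m j < N" if "m \<in> K" for m
      unfolding N_def using assms that by (auto intro!: le_imp_less_Suc Max_ge)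
    define w' where "w' i = (if i = j then 1 else N * w i)" for i
    have e: "(\<Sum>i\<in>insert j S. w' i * lookup m i)
        = lookup m j + N * (\<Sum>i\<in>S. w i * lookup m i)" for m
    proof -
      have "(\<Sum>i\<in>S. w' i * lookup m i) = (\<Sum>i\<in>S. N * (w i * lookup m i))"
        by (rule sum.cong) (use insert.hyps in \<open>auto simp: w'_def\<close>)
      then show ?thesis using insert.hyps by (simp add: w'_def sum_distrib_left)
    qed
    show ?case
    proof (intro exI[of _ w'] ballI impI)
      fix m n i assume m: "m \<in> K" and n: "n \<in> K" and i: "i \<in> insert j S"
        and eq: "(\<Sum>i\<in>insert j S. w' i * lookup m i) = (\<Sum>i\<in>insert j S. w' i * lookup n i)"
      let ?a = "lookup m j" and ?b = "lookup n j"
      let ?s = "\<Sum>i\<in>S. w i * lookup m i" and ?t = "\<Sum>i\<in>S. w i * lookup n i"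
      have "?a + N * ?s = ?b + N * ?t" using eq by (simp add: e)
      then have "(?a + N * ?s) mod N = (?b + N * ?t) mod N" "(?a + N * ?s) div N = (?b + N * ?t) div N" by simp_all
      then have "?a = ?b" "?s = ?t" using N[OF m] N[OF n] by simp_all
      then show "lookup m i = lookup n i" using w[OF m n] i by auto
    qed
  qed auto
  from this[of UNIV] obtain w :: "'n \<Rightarrow> nat" where w: "\<forall>m\<in>K. \<forall>n\<in>K.
      (\<Sum>i\<in>UNIV. w i * lookup m i) = (\<Sum>i\<in>UNIV. w i * lookup n i)
      \<longrightarrow> (\<forall>i\<in>UNIV. lookup m i = lookup n i)" by auto
  show thesis
    by (rule that[of w], rule inj_onI, rule poly_mapping_eqI) (use w in blast)
qed

text \<open>Along the curve x_i = t^(w i), t \<ge> 0, with separating weights, the monomials become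
  distinct powers of t, and a univariate polynomial with infinitely many roots vanishes. Nonnegative
  x are exactly the values of the |z_i|^2.\<close>

lemma peval_eq_zero_on_orthant:
  fixes p :: "('n::finite, real) mpolynomial"
  assumes "\<And>x. (\<And>i. 0 \<le> x $ i) \<Longrightarrow> peval p x = 0"
  shows "p = 0"
proof -
  obtain w :: "'n \<Rightarrow> nat"
    where w: "inj_on (\<lambda>m. \<Sum>i\<in>UNIV. w i * lookup m i) (keys p)"
    using separating_weights[OF Poly_Mapping.finite_keys[of p]] by blast
  define W where "W m = (\<Sum>i\<in>UNIV. w i * lookup m i)" for m
  define q where "q = (\<Sum>m\<in>keys p. Polynomial.monom (lookup p m) (W m))"
  have "poly q t = 0" if "t \<ge> 0" for t
  proof -
    define x :: "real^'n" where "x = (\<chi> i. t ^ w i)"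
    have "mon m x = t ^ W m" for m
      by (simp add: mon_def x_def W_def power_sum power_mult)
    then have "poly q t = peval p x"
      by (simp add: q_def poly_sum poly_monom peval_superset[of "keys p" p])
    also have "peval p x = 0" using assms that by (simp add: x_def)
    finally show ?thesis .
  qed
  then have "{0..} \<subseteq> {t. poly q t = 0}" by auto
  moreover have "infinite {0 :: real..}" by (simp add: infinite_Ici)
  ultimately have "q = 0" using poly_roots_finite finite_subset by blast
  have "lookup p m = 0" for m
  proof (cases "m \<in> keys p")
    case True
    have "Polynomial.coeff q (W m) = (\<Sum>n\<in>keys p. if n = m then lookup p m else 0)"
      unfolding q_def Polynomial.coeff_sum Polynomial.coeff_monom
      by (intro sum.cong) (use w True in \<open>auto simp: W_def inj_on_def\<close>)
    with True \<open>q = 0\<close> show ?thesis by simp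
  qed (simp add: in_keys_iff)
  then show ?thesis by (intro poly_mapping_eqI) simp
qed

section \<open>The polynomial attached to a monomial map\<close>

text \<open>For \<open>p\<close> with a single term this represents |p|^2 as a polynomial in the
  |z_i|^2; with several terms the cross products would be missing.\<close>

definition sq_poly :: "('n::finite, complex) mpolynomial \<Rightarrow> ('n, real) mpolynomial" where
  "sq_poly p = (\<Sum>m\<in>keys p. single m ((cmod (lookup p m))\<^sup>2))"

lemma lookup_sq_poly: "lookup (sq_poly p) m = (cmod (lookup p m))\<^sup>2"
proof -
  have "lookup (sq_poly p) m
      = (\<Sum>n\<in>keys p. if n = m then (cmod (lookup p m))\<^sup>2 else 0)"
    unfolding sq_poly_def lookup_sum by (intro sum.cong) (auto simp: lookup_single when_def)
  then show ?thesis by (simp add: in_keys_iff)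
qed

lemma cmod_mon: "(cmod (mon m z))\<^sup>2 = mon m (\<chi> i. (cmod (z $ i))\<^sup>2)"
  by (simp add: mon_def prod_norm[symmetric] prod_power_distrib norm_power power_mult[symmetric] mult.commute)

lemma peval_sq_poly:
  assumes "p = single a c"
  shows "peval (sq_poly p) (\<chi> i. (cmod (z $ i))\<^sup>2) = (cmod (peval p z))\<^sup>2"
proof -
  have "sq_poly p = single a ((cmod c)\<^sup>2)"
    by (rule poly_mapping_eqI) (auto simp: lookup_sq_poly assms lookup_single when_def)
  then show ?thesis
    unfolding assms by (simp add: peval_single norm_mult power_mult_distrib cmod_mon)
qed

definition norm_poly ::
  "('p::finite + 'q::finite \<Rightarrow> ('n::finite, complex) mpolynomial) \<Rightarrow> ('n, real) mpolynomial" where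
  "norm_poly g = (\<Sum>k\<in>UNIV. sq_poly (g (Inl k))) - (\<Sum>k\<in>UNIV. sq_poly (g (Inr k)))"

lemma lookup_norm_poly:
  "lookup (norm_poly g) m =
     (\<Sum>k\<in>UNIV. (cmod (lookup (g (Inl k)) m))\<^sup>2) -
     (\<Sum>k\<in>UNIV. (cmod (lookup (g (Inr k)) m))\<^sup>2)"
  by (simp add: norm_poly_def lookup_minus lookup_sum lookup_sq_poly)

lemma peval_norm_poly:
  assumes "monomial_map g"
  shows "peval (norm_poly g) (\<chi> i. (cmod (z $ i))\<^sup>2) = nform (pmap g z)"
proof -
  have "peval (sq_poly (g k)) (\<chi> i. (cmod (z $ i))\<^sup>2) = (cmod (peval (g k) z))\<^sup>2" for k
    using assms peval_sq_poly unfolding monomial_map_def by metis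
  then show ?thesis
    by (simp add: norm_poly_def peval_diff peval_sum nform_sums)
qed

text \<open>Every nonnegative x is realised by z_i = sqrt x_i, so the two polynomials agree on the
  orthant.\<close>

lemma norm_polynomial_unique:
  fixes g :: "'p::finite + 'q::finite \<Rightarrow> ('n::finite, complex) mpolynomial"
  assumes "monomial_map g" "norm_polynomial g P"
  shows "P = norm_poly g"
proof -
  have "P - norm_poly g = 0"
  proof (rule peval_eq_zero_on_orthant)
    fix x :: "real^'n" assume x: "\<And>i. 0 \<le> x $ i"
    define z :: "complex^'n" where "z = (\<chi> i. complex_of_real (sqrt (x $ i)))"
    have "x = (\<chi> i. (cmod (z $ i))\<^sup>2)" using x by (simp add: z_def vec_eq_iff)
    then show "peval (P - norm_poly g) x = 0"
      using assms(2) peval_norm_poly[OF assms(1), of z]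
      by (simp add: peval_diff norm_polynomial_def nform_sums)
  qed
  then show ?thesis by simp
qed

lemma monomial_map_keys:
  assumes "monomial_map g"
  shows "m \<in> keys (g k) \<Longrightarrow> n \<in> keys (g k) \<Longrightarrow> m = n"
proof -
  obtain a c where "g k = single a c" using assms unfolding monomial_map_def by blast
  then show "m \<in> keys (g k) \<Longrightarrow> n \<in> keys (g k) \<Longrightarrow> m = n"
    by (auto split: if_splits)
qed

lemma card_keys_monomial_family:
  assumes "\<And>k m n. m \<in> keys (h k) \<Longrightarrow> n \<in> keys (h k) \<Longrightarrow> m = n"
  shows "card (\<Union>k\<in>(UNIV :: 'k::finite set). keys (h k)) \<le> CARD('k)"
proof -
  have "card (keys (h k)) \<le> 1" for k
    using assms by (auto simp: card_le_Suc0_iff_eq)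
  then have "(\<Sum>k\<in>(UNIV :: 'k set). card (keys (h k))) \<le> (\<Sum>k\<in>(UNIV :: 'k set). 1)"
    by (intro sum_mono)
  then show ?thesis using card_UN_le[of "UNIV :: 'k set" "\<lambda>k. keys (h k)"] by simp
qed

lemma norm_poly_pos_key:
  assumes "lookup (norm_poly g) m > 0"
  shows "\<exists>k. m \<in> keys (g (Inl k))"
proof (rule ccontr)
  assume "\<not> ?thesis"
  then have "lookup (norm_poly g) m \<le> 0"
    by (simp add: lookup_norm_poly in_keys_iff sum_nonneg)
  with assms show False by simp
qed

lemma norm_poly_neg_key:
  assumes "lookup (norm_poly g) m < 0"
  shows "\<exists>k. m \<in> keys (g (Inr k))"
proof (rule ccontr)
  assume "\<not> ?thesis"
  then have "lookup (norm_poly g) m \<ge> 0"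
    by (simp add: lookup_norm_poly in_keys_iff sum_nonneg)
  with assms show False by simp
qed

text \<open>A positive coefficient needs a component among the first group, a negative one a
  component among the second, and each component carries at most one exponent.\<close>

lemma norm_poly_sign_counts:
  fixes g :: "'p::finite + 'q::finite \<Rightarrow> ('n::finite, complex) mpolynomial"
  assumes "monomial_map g"
  shows "finite {m. lookup (norm_poly g) m > 0}" "card {m. lookup (norm_poly g) m > 0} \<le> CARD('p)"
    "finite {m. lookup (norm_poly g) m < 0}" "card {m. lookup (norm_poly g) m < 0} \<le> CARD('q)"
proof -
  let ?P = "\<Union>k. keys (g (Inl k))" and ?N = "\<Union>k. keys (g (Inr k))"
  have P: "{m. lookup (norm_poly g) m > 0} \<subseteq> ?P" using norm_poly_pos_key by blast
  have N: "{m. lookup (norm_poly g) m < 0} \<subseteq> ?N" using norm_poly_neg_key by blast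
  have f: "finite ?P" "finite ?N" by auto
  show "finite {m. lookup (norm_poly g) m > 0}" "finite {m. lookup (norm_poly g) m < 0}"
    using P N f finite_subset by blast+
  have "card ?P \<le> CARD('p)" "card ?N \<le> CARD('q)"
    using card_keys_monomial_family[of "\<lambda>k. g (Inl k)"] card_keys_monomial_family[of "\<lambda>k. g (Inr k)"]
      monomial_map_keys[OF assms] by blast+
  then show "card {m. lookup (norm_poly g) m > 0} \<le> CARD('p)"
    "card {m. lookup (norm_poly g) m < 0} \<le> CARD('q)"
    using card_mono[OF f(1) P] card_mono[OF f(2) N] by linarith+
qed

text \<open>The exponent vector of one variable. Exponents are added, so \<open>sv a + \<nu>\<close>
  stands for the monomial \<open>\<nu>\<close> multiplied by the variable \<open>a\<close>.\<close>

definition sv :: "'n \<Rightarrow> 'n \<Rightarrow>\<^sub>0 nat" where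
  "sv a = single a 1"

lemma mon_sv: "mon (sv a) x = x $ a"
  by (simp add: sv_def mon_single del: One_nat_def)

definition sign_poly :: "('r::finite + 's::finite, real) mpolynomial" where
  "sign_poly = (\<Sum>i\<in>UNIV. single (sv (Inl i)) 1) - (\<Sum>j\<in>UNIV. single (sv (Inr j)) 1)"

lemma peval_sign_poly_mult: "peval (sign_poly * q) x = sign_form x * peval q x"
  by (simp add: sign_poly_def left_diff_distrib sum_distrib_right peval_diff peval_sum
      peval_single_mult sign_form_def mon_sv)

lemma peval_sign_poly_power: "peval (sign_poly ^ m * q) x = sign_form x ^ m * peval q x"
  by (induction m) (auto simp: peval_sign_poly_mult mult.assoc)

lemma eq_sign_poly_power_mult:
  assumes "\<And>x. peval P x = sign_form x ^ m * peval Q x"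
  shows "P = sign_poly ^ m * Q"
proof -
  have "P - sign_poly ^ m * Q = 0"
    by (rule peval_eq_zero_on_orthant) (simp add: peval_diff peval_sign_poly_power assms)
  then show ?thesis by simp
qed


section \<open>Quotients by the signature form\<close>

lemma lookup_sv: "lookup (sv a) b = (if a = b then 1 else 0)"
  by (simp add: sv_def lookup_single when_def)

lemma sv_eq_iff [simp]: "sv a = sv b \<longleftrightarrow> a = b"
  using lookup_sv[of a b] lookup_sv[of b b] by (auto split: if_splits)

text \<open>The basic move of the exponent analysis: two equal products with different distinguished
  variables share a cofactor, so each cancellation exhibits a neighbouring exponent.\<close>

lemma sv_swap:
  assumes "a \<noteq> b" "sv a + \<nu> = sv b + \<gamma>"
  obtains \<rho> where "\<nu> = sv b + \<rho>" "\<gamma> = sv a + \<rho>"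
proof
  have eq: "(if a = k then 1 else 0) + lookup \<nu> k = (if b = k then 1 else 0) + lookup \<gamma> k" for k
    using arg_cong[OF assms(2), of "\<lambda>\<mu>. lookup \<mu> k"] by (simp add: lookup_add lookup_sv)
  show "\<nu> = sv b + (\<nu> - sv b)"
  proof (rule poly_mapping_eqI)
    fix k show "lookup \<nu> k = lookup (sv b + (\<nu> - sv b)) k"
      using eq[of k] assms(1) by (auto simp: lookup_add lookup_minus lookup_sv split: if_splits)
  qed
  show "\<gamma> = sv a + (\<nu> - sv b)"
  proof (rule poly_mapping_eqI)
    fix k show "lookup \<gamma> k = lookup (sv a + (\<nu> - sv b)) k"
      using eq[of k] assms(1) by (auto simp: lookup_add lookup_minus lookup_sv split: if_splits)
  qed
qed

lemma exists_other:
  fixes i :: "'r::finite"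
  assumes "CARD('r) \<ge> 2" obtains k where "k \<noteq> i"
proof -
  have "\<not> (UNIV :: 'r set) \<subseteq> {i}"
  proof
    assume "(UNIV :: 'r set) \<subseteq> {i}"
    then have "CARD('r) \<le> card {i}" by (intro card_mono) auto
    with assms show False by simp
  qed
  with that show thesis by blast
qed

lemma sv_mult_nonzero:
  fixes q :: "('n::finite, real) mpolynomial"
  assumes "lookup (single (sv x) 1 * q) \<mu> \<noteq> 0"
  obtains \<nu> where "\<mu> = sv x + \<nu>" "lookup (single (sv x) 1 * q) \<mu> = lookup q \<nu>"
    "lookup q \<nu> \<noteq> 0"
  using lookup_single_mult_nonzero[OF assms] assms by metis

text \<open>The families \<open>e\<close> and \<open>f\<close> are kept general so that the x- and
  y-variables can later exchange their roles.\<close>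

lemma lookup_signed_sum_mult:
  fixes e f :: "'i::finite \<Rightarrow> 'n::finite" and q :: "('n, real) mpolynomial"
  shows "lookup (((\<Sum>i\<in>UNIV. single (sv (e i)) 1) - (\<Sum>j\<in>UNIV. single (sv (f j)) 1)) * q) \<mu>
    = (\<Sum>i\<in>UNIV. lookup (single (sv (e i)) 1 * q) \<mu>)
      - (\<Sum>j\<in>UNIV. lookup (single (sv (f j)) 1 * q) \<mu>)"
  by (simp add: left_diff_distrib sum_distrib_right lookup_minus lookup_sum)

text \<open>The part of highest \<open>D\<close>-degree of \<open>(X - Y)\<^sup>m q\<close> is \<open>X\<^sup>m\<close> times that of \<open>q\<close>, where \<open>X\<close> is the
  sum of the variables of \<open>D\<close>-degree one.\<close>

lemma top_degree_part:
  fixes e f :: "'i::finite \<Rightarrow> 'n::finite" and q :: "('n, real) mpolynomial"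
  defines "S \<equiv> (\<Sum>i\<in>UNIV. single (sv (e i)) 1) - (\<Sum>j\<in>UNIV. single (sv (f j)) 1)"
  assumes D: "\<And>i \<nu>. D (sv (e i) + \<nu>) = Suc (D \<nu>)" "\<And>j \<nu>. D (sv (f j) + \<nu>) = D \<nu>"
    and q: "\<And>\<mu>. lookup q \<mu> \<noteq> 0 \<Longrightarrow> D \<mu> \<le> a" "\<And>\<mu>. D \<mu> = a \<Longrightarrow> lookup q \<mu> \<ge> 0"
  shows "(\<forall>\<mu>. lookup (S ^ m * q) \<mu> \<noteq> 0 \<longrightarrow> D \<mu> \<le> a + m) \<and>
    (\<forall>\<mu>. D \<mu> = a + m \<longrightarrow> lookup (S ^ m * q) \<mu> \<ge> 0) \<and>
    (\<forall>\<alpha> ks. D \<alpha> = a \<and> lookup q \<alpha> > 0 \<and> length ks = m \<longrightarrow>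
       lookup (S ^ m * q) (sum_list (map (\<lambda>i. sv (e i)) ks) + \<alpha>) > 0)"
proof (induction m)
  case 0
  then show ?case using q by auto
next
  case (Suc m)
  define R where "R = S ^ m * q"
  let ?l = "\<lambda>x \<mu>. lookup (single (sv x) 1 * R) \<mu>"
  have R1: "D \<mu> \<le> a + m" if "lookup R \<mu> \<noteq> 0" for \<mu> using Suc that by (simp add: R_def)
  have R2: "lookup R \<mu> \<ge> 0" if "D \<mu> = a + m" for \<mu> using Suc that by (simp add: R_def)
  have eq: "lookup (S ^ Suc m * q) \<mu> = (\<Sum>i\<in>UNIV. ?l (e i) \<mu>) - (\<Sum>j\<in>UNIV. ?l (f j) \<mu>)" for \<mu>
    using lookup_signed_sum_mult[of e f R \<mu>] by (simp add: S_def R_def mult.assoc)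
  have le: "?l (e i) \<mu> \<noteq> 0 \<Longrightarrow> D \<mu> \<le> a + Suc m" for i \<mu>
    by (erule sv_mult_nonzero) (use D R1 in force)
  have lf: "?l (f j) \<mu> \<noteq> 0 \<Longrightarrow> D \<mu> \<le> a + m" for j \<mu>
    by (erule sv_mult_nonzero) (use D R1 in force)
  have le0: "?l (e i) \<mu> \<ge> 0" if "D \<mu> = a + Suc m" for i \<mu>
  proof (cases "?l (e i) \<mu> = 0")
    case False
    then obtain \<nu> where "\<mu> = sv (e i) + \<nu>" "?l (e i) \<mu> = lookup R \<nu>"
      by (rule sv_mult_nonzero)
    then show ?thesis using that D R2 by auto
  qed simp
  have lf0: "?l (f j) \<mu> = 0" if "D \<mu> = a + Suc m" for j \<mu> using lf[of j \<mu>] that by auto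
  show ?case
  proof (intro conjI allI impI)
    fix \<mu> assume "lookup (S ^ Suc m * q) \<mu> \<noteq> 0"
    then have "(\<exists>i. ?l (e i) \<mu> \<noteq> 0) \<or> (\<exists>j. ?l (f j) \<mu> \<noteq> 0)"
      unfolding eq by (metis (no_types, lifting) diff_0_right sum.neutral)
    then show "D \<mu> \<le> a + Suc m" using le[of _ \<mu>] lf[of _ \<mu>] by force
  next
    fix \<mu> assume "D \<mu> = a + Suc m"
    then show "0 \<le> lookup (S ^ Suc m * q) \<mu>"
      unfolding eq using le0 lf0 by (simp add: sum_nonneg)
  next
    fix \<alpha> and ks :: "'i list" assume *: "D \<alpha> = a \<and> lookup q \<alpha> > 0 \<and> length ks = Suc m"
    then obtain i js where ks: "ks = i # js" "length js = m" by (auto simp: length_Suc_conv)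
    define \<nu> where "\<nu> = sum_list (map (\<lambda>i. sv (e i)) js) + \<alpha>"
    have \<nu>: "sum_list (map (\<lambda>i. sv (e i)) ks) + \<alpha> = sv (e i) + \<nu>" by (simp add: \<nu>_def ks add.assoc)
    have pos: "lookup R \<nu> > 0" using Suc * ks by (simp add: R_def \<nu>_def)
    have "D (sum_list (map (\<lambda>i. sv (e i)) js) + \<alpha>) = length js + D \<alpha>"
      by (induction js) (auto simp: D add.assoc)
    then have D\<nu>: "D (sv (e i) + \<nu>) = a + Suc m" using * ks by (simp add: D \<nu>_def)
    have "0 < ?l (e i) (sv (e i) + \<nu>)" using pos by (simp add: lookup_single_mult)
    also have "\<dots> \<le> (\<Sum>i'\<in>UNIV. ?l (e i') (sv (e i) + \<nu>))"
      by (rule member_le_sum) (use le0[OF D\<nu>] in auto)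
    finally show "lookup (S ^ Suc m * q) (sum_list (map (\<lambda>i. sv (e i)) ks) + \<alpha>) > 0"
      unfolding eq \<nu> using lf0[OF D\<nu>] by simp
  qed
qed

section \<open>Counting products of an exponent with variables\<close>

definition xdeg :: "('r::finite + 's::finite \<Rightarrow>\<^sub>0 nat) \<Rightarrow> nat" where
  "xdeg \<mu> = (\<Sum>i\<in>UNIV. lookup \<mu> (Inl i))"

definition ydeg :: "('r::finite + 's::finite \<Rightarrow>\<^sub>0 nat) \<Rightarrow> nat" where
  "ydeg \<mu> = (\<Sum>i\<in>UNIV. lookup \<mu> (Inr i))"

lemma xdeg_zero [simp]: "xdeg 0 = 0" by (simp add: xdeg_def)

lemma xdeg_add [simp]: "xdeg (\<mu> + \<nu>) = xdeg \<mu> + xdeg \<nu>"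
  by (simp add: xdeg_def lookup_add sum.distrib)
lemma ydeg_add [simp]: "ydeg (\<mu> + \<nu>) = ydeg \<mu> + ydeg \<nu>"
  by (simp add: ydeg_def lookup_add sum.distrib)
lemma xdeg_sv [simp]: "xdeg (sv (Inl i)) = 1" "xdeg (sv (Inr j)) = 0"
  by (simp_all add: xdeg_def lookup_sv)
lemma ydeg_sv [simp]: "ydeg (sv (Inl i)) = 0" "ydeg (sv (Inr j)) = 1"
  by (simp_all add: ydeg_def lookup_sv)

text \<open>The r products x_i^n \<open>\<alpha>\<close> and one product x_k x_i^(n-1)
  \<open>\<alpha>\<close> already fill all r + 1 places. A third variable x_l gives the further
  product x_l x_i^(n-1) \<open>\<alpha>\<close>, and n > 2 gives x_i x_k^(n-1)
  \<open>\<alpha>\<close>; both are impossible.\<close>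

lemma too_many_top_monomials:
  fixes \<alpha> :: "'r::finite + 's::finite \<Rightarrow>\<^sub>0 nat"
  assumes r: "CARD('r) \<ge> 2" and n: "n \<ge> 2" and Pos: "finite Pos" "card Pos \<le> CARD('r) + 1"
    and mem: "\<And>ks. length ks = n \<Longrightarrow> sum_list (map (\<lambda>i. sv (Inl i)) ks) + \<alpha> \<in> Pos"
  shows "CARD('r) = 2" "n = 2" "\<And>\<mu>. \<mu> \<in> Pos \<Longrightarrow> xdeg \<mu> = xdeg \<alpha> + n"
proof -
  \<comment> \<open>The exponent of x_k x_i^(n-1) \<open>\<alpha>\<close>; the diagonal
    \<open>M i i\<close> is the pure power.\<close>
  define M where "M i k = sum_list (map (\<lambda>i. sv (Inl i)) (k # replicate (n - 1) i)) + \<alpha>" for i k :: 'r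
  have Mpos: "M i k \<in> Pos" for i k unfolding M_def by (rule mem) (use n in auto)
  have rep: "lookup (sum_list (replicate c (sv (Inl i)))) x = (if x = Inl i then c else 0)"
    for c i and x :: "'r + 's"
    by (induction c) (auto simp: lookup_add lookup_sv)
  have lM: "lookup (M i k) (Inl x) = (if x = k then 1 else 0) + (if x = i then n - 1 else 0)
      + lookup \<alpha> (Inl x)" for i k x
    by (auto simp: M_def lookup_add lookup_sv rep)
  obtain i :: 'r where True by blast
  obtain k where ki: "k \<noteq> i" using exists_other[OF r] by blast
  have diag: "M x x \<noteq> M y z" if "y \<noteq> z" for x y z
  proof
    assume "M x x = M y z"
    then have *: "(if w = x then n else 0) = (if w = z then 1 else 0) + (if w = y then n - 1 else 0)" for w
      using lM[of x x w] lM[of y z w] n by (auto split: if_splits)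
    show False using *[of y] *[of z] that n by (auto split: if_splits)
  qed
  have inj: "inj (\<lambda>x. M x x)"
  proof (rule injI)
    fix x y assume "M x x = M y y"
    then show "x = y" using lM[of x x x] lM[of y y x] n by (auto split: if_splits)
  qed
  have notin: "M y z \<notin> range (\<lambda>x. M x x)" if "y \<noteq> z" for y z
  proof
    assume "M y z \<in> range (\<lambda>x. M x x)"
    then obtain x where "M y z = M x x" by auto
    then show False using diag[OF that, of x] by simp
  qed
  have sub: "insert (M i k) (range (\<lambda>x. M x x)) \<subseteq> Pos" using Mpos by auto
  have "card (insert (M i k) (range (\<lambda>x. M x x))) = CARD('r) + 1"
    using notin[of i k] ki inj by (subst card_insert_disjoint) (auto simp: card_image)
  then have Pos_eq: "Pos = insert (M i k) (range (\<lambda>x. M x x))"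
    using card_subset_eq[OF Pos(1) sub] card_mono[OF Pos(1) sub] Pos(2) by simp
  show "CARD('r) = 2"
  proof (rule ccontr)
    assume "CARD('r) \<noteq> 2"
    then have "\<not> UNIV \<subseteq> {i, k}" using r ki card_mono[of "{i, k}" "UNIV :: 'r set"] by auto
    then obtain l where l: "l \<noteq> i" "l \<noteq> k" by blast
    have "M i l \<noteq> M i k"
    proof
      assume "M i l = M i k"
      then show False using lM[of i l l] lM[of i k l] l by auto
    qed
    then show False using Mpos[of i l] notin[of i l] l unfolding Pos_eq by auto
  qed
  show "n = 2"
  proof (rule ccontr)
    assume "n \<noteq> 2"
    then have "M k i \<noteq> M i k" using lM[of k i i] lM[of i k i] ki n by auto
    then show False using Mpos[of k i] notin[of k i] ki unfolding Pos_eq by auto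
  qed
  have "xdeg (sum_list (replicate c (sv (Inl i)) :: ('r + 's \<Rightarrow>\<^sub>0 nat) list)) = c" for c i
    by (induction c) simp_all
  then have "xdeg (M x y) = xdeg \<alpha> + n" for x y using n by (simp add: M_def)
  then show "xdeg \<mu> = xdeg \<alpha> + n" if "\<mu> \<in> Pos" for \<mu> using that unfolding Pos_eq by auto
qed

text \<open>If every product with \<open>\<alpha>'\<close> were a product with
  \<open>\<alpha>\<close>, an exchange would give \<open>\<alpha>'\<close> = u_k \<rho> and
  \<open>\<alpha>\<close> = u_i \<rho> for distinct variables u_i, u_k. Then u_k
  \<open>\<alpha>'\<close> contains u_k^2 \<rho>, whereas products with \<open>\<alpha>\<close>
  raise the power of u_k in \<rho> by at most one.\<close>

lemma range_shift_differs:
  fixes u :: "'i \<Rightarrow> 'n"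
  assumes u: "inj u" and "\<alpha> \<noteq> \<alpha>'"
  obtains i where "sv (u i) + \<alpha>' \<notin> range (\<lambda>i. sv (u i) + \<alpha>)"
proof (rule ccontr)
  assume "\<not> thesis"
  then have all: "\<exists>k. sv (u i) + \<alpha>' = sv (u k) + \<alpha>" for i using that by blast
  then obtain k where k: "sv (u undefined) + \<alpha>' = sv (u k) + \<alpha>" by blast
  then have ne: "u undefined \<noteq> u k" using assms(2) by auto
  obtain \<rho> where \<rho>: "\<alpha>' = sv (u k) + \<rho>" "\<alpha> = sv (u undefined) + \<rho>" using sv_swap[OF ne k] by blast
  obtain k' where "sv (u k) + \<alpha>' = sv (u k') + \<alpha>" using all by blast
  from arg_cong[OF this, of "\<lambda>\<mu>. lookup \<mu> (u k)"] show False
    using ne by (auto simp: \<rho> lookup_add lookup_sv split: if_splits)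
qed

text \<open>Two exponents produce r products each within r + 1 places, and 2 r > r + 1 forces a
  common product; hence they differ by exchanging one variable. A third variable would add two more
  products, so there are only two variables, and the three quadratic multiples of the cofactor
  exhaust \<open>N\<close>.\<close>

lemma adjacent_family:
  fixes u :: "'i::finite \<Rightarrow> 'n"
  assumes u: "inj u" and r: "CARD('i) \<ge> 2" and N: "finite N" "card N \<le> CARD('i) + 1"
    and mem: "\<And>\<beta> i. \<beta> \<in> X \<Longrightarrow> sv (u i) + \<beta> \<in> N" and \<beta>: "\<beta> \<in> X" "\<beta>' \<in> X" "\<beta> \<noteq> \<beta>'"
  obtains j l \<sigma> where "j \<noteq> l" "UNIV = {j, l}" "\<beta> = sv (u j) + \<sigma>" "\<beta>' = sv (u l) + \<sigma>"
    "X = {sv (u j) + \<sigma>, sv (u l) + \<sigma>}"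
proof -
  let ?R = "\<lambda>\<beta>. range (\<lambda>i. sv (u i) + \<beta>)"
  have cR: "card (?R \<beta>) = CARD('i)" for \<beta>
    using u by (subst card_image) (auto simp: inj_on_def)
  have "?R \<beta> \<inter> ?R \<beta>' \<noteq> {}"
  proof
    assume "?R \<beta> \<inter> ?R \<beta>' = {}"
    then have "card (?R \<beta> \<union> ?R \<beta>') = 2 * CARD('i)" by (subst card_Un_disjoint) (auto simp: cR)
    moreover have "card (?R \<beta> \<union> ?R \<beta>') \<le> card N" by (rule card_mono[OF N(1)]) (use mem \<beta> in auto)
    ultimately show False using N(2) r by simp
  qed
  then obtain l j where lj: "sv (u l) + \<beta> = sv (u j) + \<beta>'" by auto
  then have ne: "u l \<noteq> u j" using \<beta>(3) by auto
  then have jl: "j \<noteq> l" by auto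
  obtain \<sigma> where \<sigma>: "\<beta> = sv (u j) + \<sigma>" "\<beta>' = sv (u l) + \<sigma>" using sv_swap[OF ne lj] by blast
  have out: "sv (u n) + \<beta>' \<notin> ?R \<beta>" if "n \<noteq> j" for n
  proof
    assume "sv (u n) + \<beta>' \<in> ?R \<beta>"
    then obtain k where "sv (u n) + \<beta>' = sv (u k) + \<beta>" by auto
    from arg_cong[OF this, of "\<lambda>\<mu>. lookup \<mu> (u j)"] show False
      using jl that u by (auto simp: \<sigma> lookup_add lookup_sv inj_eq split: if_splits)
  qed
  have UN: "UNIV = {j, l}"
  proof (rule ccontr)
    assume "UNIV \<noteq> {j, l}"
    then obtain n where n: "n \<noteq> j" "n \<noteq> l" by auto
    have "card (insert (sv (u n) + \<beta>') (insert (sv (u l) + \<beta>') (?R \<beta>))) = CARD('i) + 2"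
      using out[OF n(1)] out[OF jl[symmetric]] n(2) u by (simp add: cR inj_eq)
    moreover have "card (insert (sv (u n) + \<beta>') (insert (sv (u l) + \<beta>') (?R \<beta>))) \<le> card N"
      by (rule card_mono[OF N(1)]) (use mem \<beta> in auto)
    ultimately show False using N(2) by simp
  qed
  have sub: "insert (sv (u l) + \<beta>') (?R \<beta>) \<subseteq> N" using mem \<beta> by auto
  have "card (insert (sv (u l) + \<beta>') (?R \<beta>)) = CARD('i) + 1" using out[OF jl[symmetric]] by (simp add: cR)
  then have N_eq: "N = insert (sv (u l) + \<beta>') (?R \<beta>)"
    using card_subset_eq[OF N(1) sub] card_mono[OF N(1) sub] N(2) by simp
  have N_eq': "N = {sv (u l) + (sv (u l) + \<sigma>), sv (u j) + (sv (u j) + \<sigma>), sv (u l) + (sv (u j) + \<sigma>)}"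
    unfolding N_eq UN \<sigma> by auto
  have "\<delta> \<in> {\<beta>, \<beta>'}" if "\<delta> \<in> X" for \<delta>
  proof (rule ccontr)
    assume \<delta>: "\<delta> \<notin> {\<beta>, \<beta>'}"
    have c: "sv (u j) + (sv (u l) + \<sigma>) = sv (u l) + (sv (u j) + \<sigma>)" by (simp add: add.left_commute)
    \<comment> \<open>The other two members of \<open>N\<close> would make \<open>\<delta>\<close>
      equal to \<open>\<beta>\<close> or \<open>\<beta>'\<close>. The same elimination for u_l
      \<open>\<delta>\<close> leaves u_j^2 \<sigma>, and the powers of u_j contradict each
      other.\<close>
    have "sv (u j) + \<delta> = sv (u l) + (sv (u l) + \<sigma>)"
      using mem[OF that, of j] \<delta> unfolding N_eq' \<sigma> by (auto simp: c[symmetric])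
    from arg_cong[OF this, of "\<lambda>\<mu>. lookup \<mu> (u j)"]
    have 1: "1 + lookup \<delta> (u j) = lookup \<sigma> (u j)"
      using ne by (simp add: lookup_add lookup_sv)
    have "sv (u l) + \<delta> = sv (u j) + (sv (u j) + \<sigma>)"
      using mem[OF that, of l] \<delta> unfolding N_eq' \<sigma> by auto
    from arg_cong[OF this, of "\<lambda>\<mu>. lookup \<mu> (u j)"]
    have "lookup \<delta> (u j) = 2 + lookup \<sigma> (u j)"
      using ne by (simp add: lookup_add lookup_sv)
    with 1 show False by simp
  qed
  then have "X = {sv (u j) + \<sigma>, sv (u l) + \<sigma>}" using \<beta> \<sigma> by auto
  with jl UN \<sigma> that show thesis by blast
qed

section \<open>Shape of a nonnegative quotient\<close>

locale sign_quotient =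
  fixes q :: "('r::finite + 'r, real) mpolynomial"
  assumes card2: "CARD('r) \<ge> 2"
    and nonneg: "\<And>\<mu>. lookup q \<mu> \<ge> 0"
    and nonzero: "q \<noteq> 0"
    and pos_count: "finite {\<mu>. lookup (sign_poly * q) \<mu> > 0}"
      "card {\<mu>. lookup (sign_poly * q) \<mu> > 0} \<le> CARD('r) + 1"
    and neg_count: "finite {\<mu>. lookup (sign_poly * q) \<mu> < 0}"
      "card {\<mu>. lookup (sign_poly * q) \<mu> < 0} \<le> CARD('r) + 1"
begin

definition p where "p = lookup (sign_poly * q)"
definition B where "B = keys q"
text \<open>Exponents of Q are layered by x-degree. An x-variable raises the layer and a y-variable
  keeps it, so the coefficients of P in layer \<open>hi + 1\<close> receive only positive
  contributions, and those in layer \<open>lo\<close> only negative ones.\<close>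

definition hi where "hi = Max (xdeg ` B)"
definition lo where "lo = Min (xdeg ` B)"
definition T where "T = {\<mu>\<in>B. xdeg \<mu> = hi}"
definition L where "L = {\<mu>\<in>B. xdeg \<mu> = lo}"

abbreviation "E i \<equiv> (sv (Inl i) :: 'r + 'r \<Rightarrow>\<^sub>0 nat)"
abbreviation "F j \<equiv> (sv (Inr j) :: 'r + 'r \<Rightarrow>\<^sub>0 nat)"

lemma B_iff: "\<mu> \<in> B \<longleftrightarrow> lookup q \<mu> > 0"
  using nonneg[of \<mu>] by (auto simp: B_def in_keys_iff)

lemma B_nonempty: "B \<noteq> {}"
  using nonzero poly_mapping_sum_single[of q] by (auto simp: B_def)

lemma xdeg_bounds: "\<mu> \<in> B \<Longrightarrow> lo \<le> xdeg \<mu> \<and> xdeg \<mu> \<le> hi"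
  by (auto simp: lo_def hi_def B_def)

lemma T_nonempty: obtains \<alpha> where "\<alpha> \<in> T"
proof -
  have "hi \<in> xdeg ` B" unfolding hi_def by (rule Max_in) (use B_nonempty in \<open>auto simp: B_def\<close>)
  then show thesis using that by (force simp: T_def)
qed

lemma L_nonempty: obtains \<beta> where "\<beta> \<in> L"
proof -
  have "lo \<in> xdeg ` B" unfolding lo_def by (rule Min_in) (use B_nonempty in \<open>auto simp: B_def\<close>)
  then show thesis using that by (force simp: L_def)
qed

lemma pos_card: "A \<subseteq> {\<mu>. p \<mu> > 0} \<Longrightarrow> card A \<le> CARD('r) + 1"
  using card_mono[OF pos_count(1), of A] pos_count(2) unfolding p_def by linarith

lemma neg_card: "A \<subseteq> {\<mu>. p \<mu> < 0} \<Longrightarrow> card A \<le> CARD('r) + 1"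
  using card_mono[OF neg_count(1), of A] neg_count(2) unfolding p_def by linarith

abbreviation "lm x \<mu> \<equiv> lookup (single (sv x) 1 * q) \<mu>"

lemma p_eq: "p \<mu> = (\<Sum>i\<in>UNIV. lm (Inl i) \<mu>) - (\<Sum>j\<in>UNIV. lm (Inr j) \<mu>)"
  unfolding p_def sign_poly_def by (rule lookup_signed_sum_mult)

lemma lm_nonneg: "lm x \<mu> \<ge> 0"
proof (cases "lm x \<mu> = 0")
  case False
  then show ?thesis by (rule sv_mult_nonzero) (simp add: nonneg)
qed simp

lemma lm_pos: "lm x \<mu> \<noteq> 0 \<Longrightarrow> \<exists>\<nu>\<in>B. \<mu> = sv x + \<nu>"
  by (erule sv_mult_nonzero) (auto simp: B_def in_keys_iff)

lemma lm_shift: "lm x (sv x + \<nu>) = lookup q \<nu>"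
  by (rule lookup_single_mult)

lemma lm_le_sum: "lm (Inl i) \<mu> \<le> (\<Sum>i\<in>UNIV. lm (Inl i) \<mu>)" "lm (Inr i) \<mu> \<le> (\<Sum>i\<in>UNIV. lm (Inr i) \<mu>)"
  by (rule member_le_sum; simp add: lm_nonneg)+

text \<open>Since Q is nonnegative, x_i \<open>\<nu>\<close> contributes a positive amount; a
  coefficient that is not positive therefore has a y_j-contribution as well, and comparing the two
  products replaces y_j by x_i inside B. The next lemma is the dual move.\<close>

lemma cancel_pos:
  assumes "p (E i + \<nu>) \<le> 0" "\<nu> \<in> B"
  obtains j \<rho> where "\<nu> = F j + \<rho>" "E i + \<rho> \<in> B"
proof -
  have "0 < lm (Inl i) (E i + \<nu>)" using assms(2) by (simp add: lm_shift B_iff)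
  then have "(\<Sum>j\<in>UNIV. lm (Inr j) (E i + \<nu>)) \<noteq> 0"
    using assms(1) lm_le_sum(1)[of i "E i + \<nu>"] by (simp add: p_eq)
  then obtain j where "lm (Inr j) (E i + \<nu>) \<noteq> 0" by (meson sum.neutral)
  then obtain \<gamma> where \<gamma>: "\<gamma> \<in> B" "E i + \<nu> = F j + \<gamma>" using lm_pos by blast
  then show thesis using sv_swap[of "Inl i" "Inr j" \<nu> \<gamma>] that by blast
qed

lemma cancel_neg:
  assumes "p (F j + \<nu>) \<ge> 0" "\<nu> \<in> B"
  obtains i \<rho> where "\<nu> = E i + \<rho>" "F j + \<rho> \<in> B"
proof -
  have "0 < lm (Inr j) (F j + \<nu>)" using assms(2) by (simp add: lm_shift B_iff)
  then have "(\<Sum>i\<in>UNIV. lm (Inl i) (F j + \<nu>)) \<noteq> 0"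
    using assms(1) lm_le_sum(2)[of j "F j + \<nu>"] by (simp add: p_eq)
  then obtain i where "lm (Inl i) (F j + \<nu>) \<noteq> 0" by (meson sum.neutral)
  then obtain \<gamma> where \<gamma>: "\<gamma> \<in> B" "F j + \<nu> = E i + \<gamma>" using lm_pos by blast
  then show thesis using sv_swap[of "Inr j" "Inl i" \<nu> \<gamma>] that by blast
qed

lemma pos_top:
  assumes "\<alpha> \<in> T" shows "p (E i + \<alpha>) > 0"
proof (rule ccontr)
  assume "\<not> ?thesis"
  then obtain j \<rho> where "\<alpha> = F j + \<rho>" "E i + \<rho> \<in> B"
    using cancel_pos[of i \<alpha>] assms by (auto simp: T_def)
  then show False using xdeg_bounds[of "E i + \<rho>"] assms by (simp add: T_def)
qed

lemma neg_bottom: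
  assumes "\<beta> \<in> L" shows "p (F j + \<beta>) < 0"
proof (rule ccontr)
  assume "\<not> ?thesis"
  then obtain i \<rho> where "\<beta> = E i + \<rho>" "F j + \<rho> \<in> B"
    using cancel_neg[of j \<beta>] assms by (auto simp: L_def)
  then show False using xdeg_bounds[of "F j + \<rho>"] assms by (simp add: L_def)
qed

text \<open>One top exponent already gives r positive coefficients in layer \<open>hi + 1\<close>;
  only one of the r + 1 places is left.\<close>

lemma pos_mid_unique:
  assumes "p \<mu> > 0" "p \<mu>' > 0" "xdeg \<mu> \<le> hi" "xdeg \<mu>' \<le> hi"
  shows "\<mu> = \<mu>'"
proof (rule ccontr)
  assume ne: "\<mu> \<noteq> \<mu>'"
  obtain \<alpha> where \<alpha>: "\<alpha> \<in> T" using T_nonempty .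
  let ?R = "range (\<lambda>i. E i + \<alpha>)"
  have "xdeg \<nu> = Suc hi" if "\<nu> \<in> ?R" for \<nu> using that \<alpha> by (auto simp: T_def)
  then have "\<mu> \<notin> ?R" "\<mu>' \<notin> ?R" using assms by force+
  moreover have "card ?R = CARD('r)" by (subst card_image) (auto simp: inj_on_def)
  ultimately have "card (insert \<mu> (insert \<mu>' ?R)) = CARD('r) + 2" using ne by simp
  moreover have "card (insert \<mu> (insert \<mu>' ?R)) \<le> CARD('r) + 1" by (rule pos_card) (use assms pos_top[OF \<alpha>] in auto)
  ultimately show False by linarith
qed

lemma neg_mid_unique:
  assumes "p \<mu> < 0" "p \<mu>' < 0" "xdeg \<mu> > lo" "xdeg \<mu>' > lo"
  shows "\<mu> = \<mu>'"
proof (rule ccontr)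
  assume ne: "\<mu> \<noteq> \<mu>'"
  obtain \<beta> where \<beta>: "\<beta> \<in> L" using L_nonempty .
  let ?R = "range (\<lambda>i. F i + \<beta>)"
  have "xdeg \<nu> = lo" if "\<nu> \<in> ?R" for \<nu> using that \<beta> by (auto simp: L_def)
  then have "\<mu> \<notin> ?R" "\<mu>' \<notin> ?R" using assms by force+
  moreover have "card ?R = CARD('r)" by (subst card_image) (auto simp: inj_on_def)
  ultimately have "card (insert \<mu> (insert \<mu>' ?R)) = CARD('r) + 2" using ne by simp
  moreover have "card (insert \<mu> (insert \<mu>' ?R)) \<le> CARD('r) + 1" by (rule neg_card) (use assms neg_bottom[OF \<beta>] in auto)
  ultimately show False by linarith
qed

text \<open>Two top exponents give at least r + 1 different products with the x-variables, so layer
  \<open>hi + 1\<close> takes every place.\<close>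

lemma pos_mid_empty:
  assumes "\<alpha> \<in> T" "\<alpha>' \<in> T" "\<alpha> \<noteq> \<alpha>'" "xdeg \<mu> \<le> hi"
  shows "p \<mu> \<le> 0"
proof (rule ccontr)
  assume "\<not> ?thesis"
  then have pm: "p \<mu> > 0" by simp
  let ?R = "range (\<lambda>i. E i + \<alpha>)"
  have "inj (Inl :: 'r \<Rightarrow> 'r + 'r)" by simp
  then obtain i where i: "E i + \<alpha>' \<notin> ?R" using range_shift_differs assms(3) by metis
  have "xdeg \<nu> = Suc hi" if "\<nu> \<in> insert (E i + \<alpha>') ?R" for \<nu> using that assms(1,2) by (auto simp: T_def)
  then have "\<mu> \<notin> insert (E i + \<alpha>') ?R" using assms(4) by force
  moreover have "card ?R = CARD('r)" by (subst card_image) (auto simp: inj_on_def)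
  ultimately have "card (insert \<mu> (insert (E i + \<alpha>') ?R)) = CARD('r) + 2" using i by simp
  moreover have "card (insert \<mu> (insert (E i + \<alpha>') ?R)) \<le> CARD('r) + 1" by (rule pos_card) (use pm pos_top assms(1,2) in auto)
  ultimately show False by linarith
qed

lemma neg_mid_empty:
  assumes "\<beta> \<in> L" "\<beta>' \<in> L" "\<beta> \<noteq> \<beta>'" "xdeg \<mu> > lo"
  shows "p \<mu> \<ge> 0"
proof (rule ccontr)
  assume "\<not> ?thesis"
  then have pm: "p \<mu> < 0" by simp
  let ?R = "range (\<lambda>i. F i + \<beta>)"
  have "inj (Inr :: 'r \<Rightarrow> 'r + 'r)" by simp
  then obtain i where i: "F i + \<beta>' \<notin> ?R" using range_shift_differs assms(3) by metis
  have "xdeg \<nu> = lo" if "\<nu> \<in> insert (F i + \<beta>') ?R" for \<nu> using that assms(1,2) by (auto simp: L_def)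
  then have "\<mu> \<notin> insert (F i + \<beta>') ?R" using assms(4) by force
  moreover have "card ?R = CARD('r)" by (subst card_image) (auto simp: inj_on_def)
  ultimately have "card (insert \<mu> (insert (F i + \<beta>') ?R)) = CARD('r) + 2" using i by simp
  moreover have "card (insert \<mu> (insert (F i + \<beta>') ?R)) \<le> CARD('r) + 1" by (rule neg_card) (use pm neg_bottom assms(1,2) in auto)
  ultimately show False by linarith
qed

lemma T_adjacent:
  assumes "\<alpha> \<in> T" "\<alpha>' \<in> T" "\<alpha> \<noteq> \<alpha>'"
  obtains j l \<sigma> where "j \<noteq> l" "UNIV = {j, l}" "\<alpha> = E j + \<sigma>" "\<alpha>' = E l + \<sigma>" "T = {E j + \<sigma>, E l + \<sigma>}"
proof -
  have "inj (Inl :: 'r \<Rightarrow> 'r + 'r)" by simp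
  from adjacent_family[OF this card2 pos_count _ assms, of thesis] show thesis
    using pos_top that unfolding p_def by blast
qed

lemma L_adjacent:
  assumes "\<beta> \<in> L" "\<beta>' \<in> L" "\<beta> \<noteq> \<beta>'"
  obtains j l \<sigma> where "j \<noteq> l" "UNIV = {j, l}" "\<beta> = F j + \<sigma>" "\<beta>' = F l + \<sigma>" "L = {F j + \<sigma>, F l + \<sigma>}"
proof -
  have "inj (Inr :: 'r \<Rightarrow> 'r + 'r)" by simp
  from adjacent_family[OF this card2 neg_count _ assms, of thesis] show thesis
    using neg_bottom that unfolding p_def by blast
qed

lemma add_lookup_eq:
  assumes "sv x + \<nu> = sv y + \<gamma>"
  shows "(if x = k then 1 else 0) + lookup \<nu> k
     = (if y = k then 1 else 0) + lookup \<gamma> k"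
  using arg_cong[OF assms, of "\<lambda>\<mu>. lookup \<mu> k"] by (simp add: lookup_add lookup_sv)

text \<open>The absence of a negative coefficient at y_j \<open>\<alpha>\<close> gives an exchange
  \<open>\<alpha>\<close> = x_i \<rho> with y_j \<rho> in B. For k \<noteq> i, a cancellation at x_k
  y_j \<rho> would place a second exponent in the top layer. \<open>single_bottom\<close> is the
  dual statement.\<close>

lemma single_top:
  assumes "lo < hi" "T = {\<alpha>}" "p (F j + \<alpha>) \<ge> 0"
  obtains i \<rho> where "\<alpha> = E i + \<rho>" "F j + \<rho> \<in> B" "\<And>k. k \<noteq> i \<Longrightarrow> p (E k + (F j + \<rho>)) > 0"
proof -
  have \<alpha>: "\<alpha> \<in> B" "xdeg \<alpha> = hi" using assms(2) by (auto simp: T_def)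
  obtain i \<rho> where i: "\<alpha> = E i + \<rho>" "F j + \<rho> \<in> B" using cancel_neg[OF assms(3) \<alpha>(1)] .
  have "p (E k + (F j + \<rho>)) > 0" if k: "k \<noteq> i" for k
  proof (rule ccontr)
    assume "\<not> ?thesis"
    then obtain n \<tau> where n: "F j + \<rho> = F n + \<tau>" "E k + \<tau> \<in> B" using cancel_pos[of k "F j + \<rho>"] i by auto
    have "xdeg \<tau> = xdeg \<rho>" using arg_cong[OF n(1), of xdeg] by simp
    then have "E k + \<tau> \<in> T" using n(2) \<alpha> i(1) by (simp add: T_def)
    then have "E k + \<tau> = E i + \<rho>" using assms(2) i(1) by simp
    then show False using add_lookup_eq[of "Inl k" \<tau> "Inl i" \<rho> "Inl i"] add_lookup_eq[OF n(1), of "Inl i"] k by simp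
  qed
  with i that show thesis by blast
qed

lemma single_bottom:
  assumes "lo < hi" "L = {\<beta>}" "p (E i + \<beta>) \<le> 0"
  obtains j \<rho> where "\<beta> = F j + \<rho>" "E i + \<rho> \<in> B" "\<And>l. l \<noteq> j \<Longrightarrow> p (F l + (E i + \<rho>)) < 0"
proof -
  have \<beta>: "\<beta> \<in> B" "xdeg \<beta> = lo" using assms(2) by (auto simp: L_def)
  obtain j \<rho> where j: "\<beta> = F j + \<rho>" "E i + \<rho> \<in> B" using cancel_pos[OF assms(3) \<beta>(1)] .
  have "p (F l + (E i + \<rho>)) < 0" if l: "l \<noteq> j" for l
  proof (rule ccontr)
    assume "\<not> ?thesis"
    then obtain n \<tau> where n: "E i + \<rho> = E n + \<tau>" "F l + \<tau> \<in> B" using cancel_neg[of l "E i + \<rho>"] j by auto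
    have "xdeg \<tau> = xdeg \<rho>" using arg_cong[OF n(1), of xdeg] by simp
    then have "F l + \<tau> \<in> L" using n(2) \<beta> j(1) by (simp add: L_def)
    then have "F l + \<tau> = F j + \<rho>" using assms(2) j(1) by simp
    then show False using add_lookup_eq[of "Inr l" \<tau> "Inr j" \<rho> "Inr j"] add_lookup_eq[OF n(1), of "Inr j"] l by simp
  qed
  with j that show thesis by blast
qed

text \<open>The assumptions say that the exponent arises from only two products, one of each sign.
  Where the coefficient vanishes, the two coefficients of Q are thus equal.\<close>

lemma coefficient_between:
  assumes "\<And>k \<nu>. \<nu> \<in> B \<Longrightarrow> E i + (F j + \<rho>) = E k + \<nu> \<Longrightarrow> k = i"
    and "\<And>k \<nu>. \<nu> \<in> B \<Longrightarrow> E i + (F j + \<rho>) = F k + \<nu> \<Longrightarrow> k = j"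
  shows "p (E i + (F j + \<rho>)) = lookup q (F j + \<rho>) - lookup q (E i + \<rho>)"
proof -
  let ?\<mu> = "E i + (F j + \<rho>)"
  have "(\<Sum>k\<in>UNIV. lm (Inl k) ?\<mu>) = (\<Sum>k\<in>UNIV. if k = i then lookup q (F j + \<rho>) else 0)"
  proof (rule sum.cong)
    fix k show "lm (Inl k) ?\<mu> = (if k = i then lookup q (F j + \<rho>) else 0)"
      using lm_shift[of "Inl i" "F j + \<rho>"] lm_pos[of "Inl k" ?\<mu>] assms(1) by auto
  qed simp
  moreover have "(\<Sum>k\<in>UNIV. lm (Inr k) ?\<mu>) = (\<Sum>k\<in>UNIV. if k = j then lookup q (E i + \<rho>) else 0)"
  proof (rule sum.cong)
    have c: "?\<mu> = F j + (E i + \<rho>)" by (simp add: add.left_commute)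
    fix k show "lm (Inr k) ?\<mu> = (if k = j then lookup q (E i + \<rho>) else 0)"
      using lm_shift[of "Inr j" "E i + \<rho>"] lm_pos[of "Inr k" ?\<mu>] assms(2) by (auto simp: c)
  qed simp
  ultimately show ?thesis by (simp add: p_eq)
qed

text \<open>If top and bottom coincide, two distinct exponents would differ by an exchange of
  x-variables and at the same time by an exchange of y-variables.\<close>

lemma one_level:
  assumes "lo = hi" obtains \<alpha> where "B = {\<alpha>}"
proof -
  have "xdeg \<mu> = hi" if "\<mu> \<in> B" for \<mu> using xdeg_bounds[OF that] assms by simp
  then have TB: "T = B" "L = B" using assms by (auto simp: T_def L_def)
  obtain \<alpha> where \<alpha>: "\<alpha> \<in> B" using B_nonempty by blast
  have "\<alpha>' = \<alpha>" if \<alpha>': "\<alpha>' \<in> B" for \<alpha>'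
  proof (rule ccontr)
    assume ne: "\<alpha>' \<noteq> \<alpha>"
    obtain j l \<sigma> where 1: "j \<noteq> l" "\<alpha> = E j + \<sigma>" "\<alpha>' = E l + \<sigma>"
      using T_adjacent[of \<alpha> \<alpha>'] \<alpha> \<alpha>' ne TB by metis
    obtain j' l' \<sigma>' where 2: "j' \<noteq> l'" "\<alpha> = F j' + \<sigma>'" "\<alpha>' = F l' + \<sigma>'"
      using L_adjacent[of \<alpha> \<alpha>'] \<alpha> \<alpha>' ne TB by metis
    have "lookup \<alpha> (Inl j) = lookup \<alpha>' (Inl j)" using 2 by (simp add: lookup_add lookup_sv)
    then show False using 1 by (simp add: lookup_add lookup_sv)
  qed
  with \<alpha> that show thesis by blast
qed

text \<open>Among the products x_i \<open>\<beta>\<close> with the only bottom exponent, at most one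
  has a positive coefficient, and at most one a nonpositive coefficient. With r \<ge> 2 this means r
  = 2 and exactly one of each. The nonpositive one yields the exchange between y_j \<rho> and x_i
  \<rho>.\<close>

lemma two_levels_single:
  assumes lh: "lo < hi" and L: "L = {\<beta>}"
  obtains i j \<rho> where "CARD('r) = 2" "B = {E i + \<rho>, F j + \<rho>}"
    "lookup q (E i + \<rho>) = lookup q (F j + \<rho>)"
proof -
  have \<beta>: "\<beta> \<in> B" "xdeg \<beta> = lo" using L by (auto simp: L_def)
  have uniqP: "i = k" if "p (E i + \<beta>) > 0" "p (E k + \<beta>) > 0" for i k
    using pos_mid_unique[OF that] lh \<beta> by simp
  \<comment> \<open>Two nonpositive coefficients would, by \<open>single_bottom\<close>, produce two
    different negative coefficients above the bottom layer.\<close>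
  have uniqN: "i = k" if N: "p (E i + \<beta>) \<le> 0" "p (E k + \<beta>) \<le> 0" for i k
  proof (rule ccontr)
    assume ik: "i \<noteq> k"
    obtain j \<rho> where j: "\<beta> = F j + \<rho>" "\<And>l. l \<noteq> j \<Longrightarrow> p (F l + (E i + \<rho>)) < 0"
      using single_bottom[OF lh L N(1)] by metis
    obtain j' \<rho>' where j': "\<beta> = F j' + \<rho>'" "\<And>l. l \<noteq> j' \<Longrightarrow> p (F l + (E k + \<rho>')) < 0"
      using single_bottom[OF lh L N(2)] by metis
    obtain l where l: "l \<noteq> j" using exists_other[OF card2] by blast
    obtain l' where l': "l' \<noteq> j'" using exists_other[OF card2] by blast
    have x: "xdeg \<rho> = lo" using \<beta>(2) unfolding j(1) by simp
    have x': "xdeg \<rho>' = lo" using \<beta>(2) unfolding j'(1) by simp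
    have eq: "F l + (E i + \<rho>) = F l' + (E k + \<rho>')"
      by (rule neg_mid_unique[OF j(2)[OF l] j'(2)[OF l']]) (simp_all add: x x')
    have "lookup \<rho> (Inl i) = lookup \<rho>' (Inl i)"
      using j(1) j'(1) add_lookup_eq[of "Inr j" \<rho> "Inr j'" \<rho>' "Inl i"] by simp
    then show False using add_lookup_eq[OF eq, of "Inl i"] ik by (simp add: lookup_add lookup_sv)
  qed
  obtain i1 :: 'r where True by blast
  obtain i2 where i12: "i2 \<noteq> i1" using exists_other[OF card2] by blast
  obtain i0 i where i0: "p (E i0 + \<beta>) > 0" and i: "p (E i + \<beta>) \<le> 0"
    using uniqP[of i1 i2] uniqN[of i1 i2] i12 by (metis linorder_not_less)
  have "i0 \<noteq> i" using i0 i by auto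
  have UN: "UNIV = {i0, i}" using uniqP[OF i0] uniqN[OF i] by force
  then have card: "CARD('r) = 2" using \<open>i0 \<noteq> i\<close> by (simp add: UN)
  obtain j \<rho> where j: "\<beta> = F j + \<rho>" "E i + \<rho> \<in> B" "\<And>l. l \<noteq> j \<Longrightarrow> p (F l + (E i + \<rho>)) < 0"
    using single_bottom[OF lh L i] by metis
  obtain l where l: "l \<noteq> j" using exists_other[OF card2] by blast
  have x\<rho>: "xdeg \<rho> = lo" using \<beta> j(1) by auto
  obtain \<alpha> where \<alpha>: "\<alpha> \<in> T" using T_nonempty .
  have "T = {\<alpha>}"
    using pos_mid_empty[OF \<alpha>, of _ "E i0 + \<beta>"] i0 lh \<beta> \<alpha> by force
  \<comment> \<open>Otherwise y_l \<open>\<alpha>\<close> is not negative, as the one negative place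
    above the bottom is taken by y_l x_i \<rho>. Then \<open>single_top\<close> gives a positive
    coefficient in layer \<open>hi\<close>, in addition to that of x_i0 \<open>\<beta>\<close> in
    layer \<open>lo + 1\<close>.\<close>
  have hi: "hi = Suc lo"
  proof (rule ccontr)
    assume "hi \<noteq> Suc lo"
    have "p (F l + \<alpha>) \<ge> 0"
    proof (rule ccontr)
      assume "\<not> ?thesis"
      then have "F l + \<alpha> = F l + (E i + \<rho>)"
        using neg_mid_unique[of "F l + \<alpha>" "F l + (E i + \<rho>)"] j(3)[OF l] \<alpha> x\<rho> lh by (simp add: T_def)
      then have "\<alpha> = E i + \<rho>" by simp
      then show False using \<alpha> x\<rho> \<open>hi \<noteq> Suc lo\<close> by (simp add: T_def)
    qed
    then obtain k \<tau> where k: "\<alpha> = E k + \<tau>" "\<And>k'. k' \<noteq> k \<Longrightarrow> p (E k' + (F l + \<tau>)) > 0"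
      using single_top[OF lh \<open>T = {\<alpha>}\<close>] by metis
    obtain k' where k': "k' \<noteq> k" using exists_other[OF card2] by blast
    have x: "xdeg \<alpha> = hi" using \<alpha> by (simp add: T_def)
    then have "xdeg (E k' + (F l + \<tau>)) = hi" by (simp add: k(1))
    then have "E k' + (F l + \<tau>) = E i0 + \<beta>"
      using pos_mid_unique[OF k(2)[OF k'] i0] \<beta> lh by simp
    then show False using \<open>hi \<noteq> Suc lo\<close> \<beta> \<open>xdeg (E k' + (F l + \<tau>)) = hi\<close> by simp
  qed
  have "E i + \<rho> \<in> T" using j(2) x\<rho> hi by (simp add: T_def)
  then have T: "T = {E i + \<rho>}" using \<open>T = {\<alpha>}\<close> by simp
  have B: "B = {E i + \<rho>, F j + \<rho>}"
  proof -
    have "B = T \<union> L" using xdeg_bounds hi by (force simp: T_def L_def)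
    then show ?thesis using T L j(1) by auto
  qed
  \<comment> \<open>A negative value would compete with y_l x_i \<rho> for the single place above
    the bottom, and a positive one contradicts the choice of \<open>i\<close>. The zero then equates
    the two coefficients of Q.\<close>
  have "p (E i + (F j + \<rho>)) = 0"
  proof (rule ccontr)
    assume "p (E i + (F j + \<rho>)) \<noteq> 0"
    then consider "p (E i + (F j + \<rho>)) < 0" | "p (E i + (F j + \<rho>)) > 0" by linarith
    then show False
    proof cases
      case 1
      then have "E i + (F j + \<rho>) = F l + (E i + \<rho>)"
        using neg_mid_unique[OF _ j(3)[OF l]] x\<rho> by simp
      then have "F j + (E i + \<rho>) = F l + (E i + \<rho>)" by (simp add: add.left_commute)
      then show False using l by simp
    next
      case 2
      then show False using i j(1) by simp
    qed
  qed
  moreover have "p (E i + (F j + \<rho>)) = lookup q (F j + \<rho>) - lookup q (E i + \<rho>)"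
  proof (rule coefficient_between)
    fix k \<nu> assume "\<nu> \<in> B" and eq: "E i + (F j + \<rho>) = E k + \<nu>"
    moreover have "xdeg \<nu> = lo" using arg_cong[OF eq, of xdeg] x\<rho> by simp
    ultimately have "\<nu> = F j + \<rho>" using B x\<rho> by auto
    then show "k = i" using eq by simp
  next
    fix k \<nu> assume "\<nu> \<in> B" and eq: "E i + (F j + \<rho>) = F k + \<nu>"
    moreover have "xdeg \<nu> = Suc lo" using arg_cong[OF eq, of xdeg] x\<rho> by simp
    ultimately have "\<nu> = E i + \<rho>" using B x\<rho> by auto
    then have "F j + (E i + \<rho>) = F k + (E i + \<rho>)" using eq by (simp add: add.left_commute)
    then show "k = j" by simp
  qed
  ultimately show thesis using that[OF card B] by simp
qed

text \<open>Two bottom exponents use up all negative coefficients. A single top exponent would then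
  give two different positive coefficients in layer \<open>hi\<close>, so the top has two exponents
  as well and uses up all positive ones. Every coefficient strictly above \<open>lo\<close> and at
  most at \<open>hi\<close> is therefore zero.\<close>

lemma two_levels_double:
  assumes lh: "lo < hi" and L2: "\<beta>1 \<in> L" "\<beta>2 \<in> L" "\<beta>1 \<noteq> \<beta>2"
  obtains \<sigma> where "CARD('r) = 2" "B = range (\<lambda>i. E i + \<sigma>) \<union> range (\<lambda>j. F j + \<sigma>)"
    "\<And>i j. lookup q (E i + \<sigma>) = lookup q (F j + \<sigma>)"
proof -
  obtain j l \<sigma> where jl: "j \<noteq> l" "UNIV = {j, l}" and L: "L = {F j + \<sigma>, F l + \<sigma>}"
    using L_adjacent[OF L2] by metis
  have card: "CARD('r) = 2" using jl by (simp add: jl(2))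
  have L': "F n + \<sigma> \<in> L" for n using jl(2) L by auto
  have Lcases: "\<exists>n. \<mu> = F n + \<sigma>" if "\<mu> \<in> L" for \<mu> using that L by auto
  have x\<sigma>: "xdeg \<sigma> = lo" using L'[of j] by (simp add: L_def)
  have nonneg_mid: "p \<mu> \<ge> 0" if "xdeg \<mu> > lo" for \<mu> by (rule neg_mid_empty[OF L2 that])
  obtain \<alpha> where \<alpha>: "\<alpha> \<in> T" using T_nonempty .
  have "\<exists>\<alpha>'\<in>T. \<alpha>' \<noteq> \<alpha>"
  proof (rule ccontr)
    assume "\<not> ?thesis"
    then have T: "T = {\<alpha>}" using \<alpha> by blast
    have x\<alpha>: "xdeg \<alpha> = hi" using \<alpha> by (simp add: T_def)
    have pn: "p (F n + \<alpha>) \<ge> 0" for n by (rule nonneg_mid) (simp add: x\<alpha> lh)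
    obtain i \<rho> where i: "\<alpha> = E i + \<rho>" "\<And>k. k \<noteq> i \<Longrightarrow> p (E k + (F j + \<rho>)) > 0"
      using single_top[OF lh T pn[of j]] by metis
    obtain i' \<rho>' where i': "\<alpha> = E i' + \<rho>'" "\<And>k. k \<noteq> i' \<Longrightarrow> p (E k + (F l + \<rho>')) > 0"
      using single_top[OF lh T pn[of l]] by metis
    obtain k where k: "k \<noteq> i" using exists_other[OF card2] by blast
    obtain k' where k': "k' \<noteq> i'" using exists_other[OF card2] by blast
    have x: "Suc (xdeg \<rho>) = hi" using x\<alpha> unfolding i(1) by simp
    have x': "Suc (xdeg \<rho>') = hi" using x\<alpha> unfolding i'(1) by simp
    have "E k + (F j + \<rho>) = E k' + (F l + \<rho>')"
      by (rule pos_mid_unique[OF i(2)[OF k] i'(2)[OF k']]) (use x x' in auto)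
    from add_lookup_eq[OF this, of "Inr j"] add_lookup_eq[of "Inl i" \<rho> "Inl i'" \<rho>' "Inr j"]
    show False using i(1) i'(1) jl(1) by (simp add: lookup_add lookup_sv)
  qed
  then obtain \<alpha>' where \<alpha>': "\<alpha>' \<in> T" "\<alpha>' \<noteq> \<alpha>" by blast
  have nonpos_mid: "p \<mu> \<le> 0" if "xdeg \<mu> \<le> hi" for \<mu>
    by (rule pos_mid_empty[OF \<alpha> \<alpha>'(1) \<alpha>'(2)[symmetric] that])
  have bound: "lookup \<mu> (Inr n) \<le> Suc (lookup \<sigma> (Inr n))" if "\<mu> \<in> L" for \<mu> n
    using Lcases[OF that] by (auto simp: lookup_add lookup_sv)
  \<comment> \<open>Cancelling x_i y_j \<sigma> through y_j itself gives the claim. Through another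
    y_j', a second cancellation by y_j would lead to a bottom exponent whose power of y_j exceeds
    \<open>bound\<close>.\<close>
  have mem: "E i + \<sigma> \<in> B" for i
  proof -
    have "p (E i + (F j + \<sigma>)) \<le> 0" by (rule nonpos_mid) (use x\<sigma> lh in simp)
    moreover have "F j + \<sigma> \<in> B" using L'[of j] by (simp add: L_def)
    ultimately obtain j' \<rho> where j': "F j + \<sigma> = F j' + \<rho>" "E i + \<rho> \<in> B" using cancel_pos by blast
    show ?thesis
    proof (cases "j' = j")
      case True
      then show ?thesis using j' by simp
    next
      case False
      then have "(Inr j :: 'r + 'r) \<noteq> Inr j'" by simp
      then obtain \<rho>0 where \<rho>0: "\<sigma> = F j' + \<rho>0" "\<rho> = F j + \<rho>0" using sv_swap[OF _ j'(1)] by blast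
      have x\<rho>: "xdeg \<rho> = lo" using x\<sigma> \<rho>0 by simp
      have "p (F j + (E i + \<rho>)) \<ge> 0" by (rule nonneg_mid) (simp add: x\<rho>)
      then obtain k \<rho>' where k: "E i + \<rho> = E k + \<rho>'" "F j + \<rho>' \<in> B" using cancel_neg j'(2) by blast
      have "xdeg \<rho>' = lo" using arg_cong[OF k(1), of xdeg] x\<rho> by simp
      then have "F j + \<rho>' \<in> L" using k(2) by (simp add: L_def)
      then show ?thesis
        using bound[of "F j + \<rho>'" j] add_lookup_eq[OF k(1), of "Inr j"] False
        by (simp add: \<rho>0 lookup_add lookup_sv)
    qed
  qed
  \<comment> \<open>With two or more layers in between, x_j^2 \<sigma> must cancel through some y_n.
    For the other variable y_m, two further cancellations descend to the bottom layer while adding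
    y_m twice, against \<open>bound\<close>.\<close>
  have hi: "hi = Suc lo"
  proof (rule ccontr)
    assume "hi \<noteq> Suc lo"
    then have hi2: "Suc (Suc lo) \<le> hi" using lh by simp
    have "p (E j + (E j + \<sigma>)) \<le> 0" by (rule nonpos_mid) (simp add: x\<sigma> hi2)
    then obtain n \<rho> where n: "E j + \<sigma> = F n + \<rho>" "E j + \<rho> \<in> B" using cancel_pos mem by blast
    obtain m where m: "m \<noteq> n" using exists_other[OF card2] by blast
    have x\<rho>: "xdeg \<rho> = Suc lo" using arg_cong[OF n(1), of xdeg] x\<sigma> by simp
    have "p (F m + (E j + \<rho>)) \<ge> 0" by (rule nonneg_mid) (simp add: x\<rho>)
    then obtain k \<tau> where k: "E j + \<rho> = E k + \<tau>" "F m + \<tau> \<in> B" using cancel_neg n(2) by blast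
    have x\<tau>: "xdeg \<tau> = Suc lo" using arg_cong[OF k(1), of xdeg] x\<rho> by simp
    have "p (F m + (F m + \<tau>)) \<ge> 0" by (rule nonneg_mid) (simp add: x\<tau>)
    then obtain k2 \<upsilon> where k2: "F m + \<tau> = E k2 + \<upsilon>" "F m + \<upsilon> \<in> B" using cancel_neg k(2) by blast
    have "xdeg \<upsilon> = lo" using arg_cong[OF k2(1), of xdeg] x\<tau> by simp
    then have "F m + \<upsilon> \<in> L" using k2(2) by (simp add: L_def)
    then show False
      using bound[of "F m + \<upsilon>" m] add_lookup_eq[OF k2(1), of "Inr m"] add_lookup_eq[OF k(1), of "Inr m"]
        add_lookup_eq[OF n(1), of "Inr m"] m by (simp add: lookup_add lookup_sv)
  qed
  have "E j + \<sigma> \<in> T" "E l + \<sigma> \<in> T" using mem x\<sigma> hi by (auto simp: T_def)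
  moreover have "E j + \<sigma> \<noteq> E l + \<sigma>" using jl(1) by simp
  moreover obtain a b \<tau> where "T = {E a + \<tau>, E b + \<tau>}" using T_adjacent[OF \<alpha> \<alpha>'(1) \<alpha>'(2)[symmetric]] by metis
  moreover have "{c, d} = {x, y}" if "x \<in> {c, d}" "y \<in> {c, d}" "x \<noteq> y" for x y c d :: "'r + 'r \<Rightarrow>\<^sub>0 nat"
    using that by auto
  ultimately have T: "T = {E j + \<sigma>, E l + \<sigma>}" by metis
  have B: "B = range (\<lambda>i. E i + \<sigma>) \<union> range (\<lambda>j. F j + \<sigma>)"
  proof -
    have "B = T \<union> L" using xdeg_bounds hi by (force simp: T_def L_def)
    then show ?thesis using T L jl(2) by auto
  qed
  have "lookup q (E i + \<sigma>) = lookup q (F n + \<sigma>)" for i n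
  proof -
    have "p (E i + (F n + \<sigma>)) = 0"
      using nonneg_mid[of "E i + (F n + \<sigma>)"] nonpos_mid[of "E i + (F n + \<sigma>)"] x\<sigma> lh by simp
    moreover have "p (E i + (F n + \<sigma>)) = lookup q (F n + \<sigma>) - lookup q (E i + \<sigma>)"
    proof (rule coefficient_between)
      fix k \<nu> assume "\<nu> \<in> B" and eq: "E i + (F n + \<sigma>) = E k + \<nu>"
      moreover have "xdeg \<nu> = lo" using arg_cong[OF eq, of xdeg] x\<sigma> by simp
      ultimately obtain n' where "\<nu> = F n' + \<sigma>" using B x\<sigma> by auto
      then show "k = i" using add_lookup_eq[OF eq, of "Inl k"] by (auto simp: lookup_add lookup_sv split: if_splits)
    next
      fix k \<nu> assume "\<nu> \<in> B" and eq: "E i + (F n + \<sigma>) = F k + \<nu>"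
      moreover have "xdeg \<nu> = Suc lo" using arg_cong[OF eq, of xdeg] x\<sigma> by simp
      ultimately obtain n' where "\<nu> = E n' + \<sigma>" using B x\<sigma> by auto
      then show "k = n" using add_lookup_eq[OF eq, of "Inr k"] by (auto simp: lookup_add lookup_sv split: if_splits)
    qed
    ultimately show ?thesis by simp
  qed
  with card B that show thesis by blast
qed

lemma classification:
  obtains (monomial) \<rho> c where "c > 0" "q = single \<rho> c"
  | (binomial) i j \<rho> c where "CARD('r) = 2" "c > 0" "B = {E i + \<rho>, F j + \<rho>}"
      "\<And>\<mu>. \<mu> \<in> B \<Longrightarrow> lookup q \<mu> = c"
  | (quadrinomial) \<rho> c where "CARD('r) = 2" "c > 0" "B = range (\<lambda>i. E i + \<rho>) \<union> range (\<lambda>j. F j + \<rho>)"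
      "\<And>\<mu>. \<mu> \<in> B \<Longrightarrow> lookup q \<mu> = c"
proof -
  obtain \<beta> where \<beta>: "\<beta> \<in> L" using L_nonempty .
  have "lo \<le> hi" using xdeg_bounds[of \<beta>] \<beta> by (auto simp: L_def)
  then have "lo = hi \<or> lo < hi" by linarith
  moreover have "L = {\<beta>} \<or> (\<exists>\<beta>'\<in>L. \<beta> \<noteq> \<beta>')" using \<beta> by auto
  ultimately consider "lo = hi" | "lo < hi" "L = {\<beta>}" | \<beta>' where "lo < hi" "\<beta>' \<in> L" "\<beta> \<noteq> \<beta>'"
    by blast
  then show thesis
  proof cases
    case 1
    then obtain \<alpha> where \<alpha>: "B = {\<alpha>}" using one_level by blast
    then have "q = single \<alpha> (lookup q \<alpha>)"
      using poly_mapping_sum_single[of q] by (simp add: B_def)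
    then show thesis using monomial[of "lookup q \<alpha>" \<alpha>] \<alpha> B_iff[of \<alpha>] by auto
  next
    case 2
    then obtain i j \<rho> where *: "CARD('r) = 2" "B = {E i + \<rho>, F j + \<rho>}"
      "lookup q (E i + \<rho>) = lookup q (F j + \<rho>)" using two_levels_single by metis
    show thesis
      by (rule binomial[OF *(1) _ *(2), of "lookup q (E i + \<rho>)"])
         (use *(2,3) B_iff[of "E i + \<rho>"] in auto)
  next
    case 3
    then obtain \<rho> where *: "CARD('r) = 2" "B = range (\<lambda>i. E i + \<rho>) \<union> range (\<lambda>j. F j + \<rho>)"
      "\<And>i j. lookup q (E i + \<rho>) = lookup q (F j + \<rho>)"
      using two_levels_double[OF _ \<beta>] by metis
    have val: "lookup q \<mu> = lookup q (F undefined + \<rho>)" if "\<mu> \<in> B" for \<mu>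
    proof -
      consider i where "\<mu> = E i + \<rho>" | j where "\<mu> = F j + \<rho>" using \<open>\<mu> \<in> B\<close> *(2) by auto
      then show ?thesis
      proof cases
        case 2
        then show ?thesis using *(3)[of undefined j] *(3)[of undefined undefined] by simp
      qed (use *(3) in simp)
    qed
    have "F undefined + \<rho> \<in> B" using *(2) by blast
    then show thesis using quadrinomial[OF *(1) _ *(2) val] B_iff by blast
  qed
qed

end


section \<open>Classification of the monomial maps\<close>

lemma exp_sum_add: "exp_sum (\<mu> + \<nu>) = exp_sum \<mu> + exp_sum \<nu>"
  by (simp add: exp_sum_def lookup_add sum.distrib)

lemma exp_sum_sv: "exp_sum (sv a) = 1"
  by (simp add: exp_sum_def lookup_sv)

lemma exp_sum_eq_0: "exp_sum \<mu> = 0 \<Longrightarrow> \<mu> = 0"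
  by (rule poly_mapping_eqI) (simp add: exp_sum_def)

lemma lookup_pos_split:
  assumes "lookup \<mu> a > (0 :: nat)" obtains \<nu> where "\<mu> = sv a + \<nu>"
proof
  show "\<mu> = sv a + (\<mu> - sv a)"
    by (rule poly_mapping_eqI) (use assms in \<open>auto simp: lookup_add lookup_minus lookup_sv\<close>)
qed

lemma exp_sum_Suc:
  assumes "exp_sum \<mu> = Suc n" obtains a \<nu> where "\<mu> = sv a + \<nu>" "exp_sum \<nu> = n"
proof -
  obtain a where "lookup \<mu> a \<noteq> 0"
    using assms unfolding exp_sum_def by (metis nat.simps(3) sum.neutral)
  then obtain \<nu> where "\<mu> = sv a + \<nu>" using lookup_pos_split by (metis gr0I)
  moreover from this have "exp_sum \<nu> = n" using assms by (simp add: exp_sum_add exp_sum_sv)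
  ultimately show thesis using that by blast
qed

lemma exp_sum_1: assumes "exp_sum \<mu> = 1" obtains a where "\<mu> = sv a"
  using assms exp_sum_Suc[of \<mu> 0] exp_sum_eq_0 by (metis One_nat_def add.right_neutral)

lemma exp_sum_2: assumes "exp_sum \<mu> = 2" obtains a b where "\<mu> = sv a + sv b"
proof -
  obtain a \<nu> where "\<mu> = sv a + \<nu>" "exp_sum \<nu> = 1" using exp_sum_Suc[of \<mu> 1] assms by auto
  then show thesis using exp_sum_1[of \<nu>] that by metis
qed

lemma peval_one_term:
  fixes h :: "('n::finite, real) mpolynomial"
  assumes "\<And>m. m \<in> keys h \<Longrightarrow> m \<noteq> \<mu> \<Longrightarrow> mon m x = 0"
  shows "peval h x = lookup h \<mu> * mon \<mu> x"
proof -
  have "peval h x = (\<Sum>m\<in>insert \<mu> (keys h). lookup h m * mon m x)"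
    by (rule peval_superset) auto
  also have "\<dots> = (\<Sum>m\<in>{\<mu>}. lookup h m * mon m x)"
    by (rule sum.mono_neutral_right) (use assms in auto)
  finally show ?thesis by simp
qed

text \<open>In the absence of squares, the points x_i = y_j = 1 isolate the mixed coefficients. Once
  these vanish, x_i = x_k = 1, y_j = 2 isolates the coefficient of x_i x_k, and symmetrically for
  two y-variables.\<close>

lemma quadratic_form_zero:
  fixes h :: "('r::finite + 'r, real) mpolynomial"
  assumes hom: "homogeneous 2 h" and sq: "\<And>a. lookup h (sv a + sv a) = 0"
    and van: "\<And>x. (\<And>a. 0 \<le> x $ a) \<Longrightarrow> sign_form x = 0 \<Longrightarrow> x \<noteq> 0 \<Longrightarrow> peval h x = 0"
  shows "h = 0"
proof -
  have key: "\<exists>a b. m = sv a + sv b \<and> a \<noteq> b" if "m \<in> keys h" for m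
  proof -
    have "exp_sum m = 2" using hom that by (auto simp: homogeneous_def)
    then obtain a b where "m = sv a + sv b" by (rule exp_sum_2)
    moreover have "a \<noteq> b" using that sq[of a] calculation by (auto simp: in_keys_iff)
    ultimately show ?thesis by blast
  qed
  have mixed: "lookup h (sv (Inl i) + sv (Inr j)) = 0" for i j
  proof -
    define x :: "real^('r + 'r)" where "x = (\<chi> a. if a = Inl i \<or> a = Inr j then 1 else 0)"
    have "peval h x = lookup h (sv (Inl i) + sv (Inr j)) * mon (sv (Inl i) + sv (Inr j)) x"
    proof (rule peval_one_term)
      fix m assume m: "m \<in> keys h" "m \<noteq> sv (Inl i) + sv (Inr j)"
      obtain a b where "m = sv a + sv b" "a \<noteq> b" using key[OF m(1)] by blast
      then show "mon m x = 0" using m(2) by (auto simp: mon_add mon_sv x_def add.commute)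
    qed
    moreover have "peval h x = 0"
    proof (rule van)
      show "sign_form x = 0" by (simp add: sign_form_def x_def)
      show "x \<noteq> 0" by (auto simp: vec_eq_iff x_def)
    qed (simp add: x_def)
    ultimately show ?thesis by (simp add: mon_add mon_sv x_def)
  qed
  have left: "lookup h (sv (Inl i) + sv (Inl k)) = 0" if ik: "i \<noteq> k" for i k
  proof -
    fix j :: 'r
    define x :: "real^('r + 'r)" where
      "x = (\<chi> a. (if a = Inl i then 1 else 0) + (if a = Inl k then 1 else 0) + (if a = Inr j then 2 else 0))"
    have x0: "x $ a \<noteq> 0 \<Longrightarrow> a = Inl i \<or> a = Inl k \<or> a = Inr j" for a by (auto simp: x_def split: if_splits)
    have "peval h x = lookup h (sv (Inl i) + sv (Inl k)) * mon (sv (Inl i) + sv (Inl k)) x"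
    proof (rule peval_one_term, rule ccontr)
      fix m assume m: "m \<in> keys h" "m \<noteq> sv (Inl i) + sv (Inl k)" "mon m x \<noteq> 0"
      obtain a b where ab: "m = sv a + sv b" "a \<noteq> b" using key[OF m(1)] by blast
      then have "x $ a \<noteq> 0" "x $ b \<noteq> 0" using m(3) by (auto simp: mon_add mon_sv)
      moreover have "lookup h (sv a + sv b) \<noteq> 0" using m(1) ab by (simp add: in_keys_iff)
      ultimately show False
        using x0[of a] x0[of b] m(2) ab mixed[of i j] mixed[of k j] by (auto simp: add.commute)
    qed
    moreover have "peval h x = 0"
    proof (rule van)
      show "sign_form x = 0" by (simp add: sign_form_def x_def sum.distrib)
      have "x $ Inr j \<noteq> 0" by (simp add: x_def)
      then show "x \<noteq> 0" by auto
    qed (simp add: x_def)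
    ultimately show ?thesis using ik by (simp add: mon_add mon_sv x_def)
  qed
  have right: "lookup h (sv (Inr i) + sv (Inr k)) = 0" if ik: "i \<noteq> k" for i k
  proof -
    fix j :: 'r
    define x :: "real^('r + 'r)" where
      "x = (\<chi> a. (if a = Inr i then 1 else 0) + (if a = Inr k then 1 else 0) + (if a = Inl j then 2 else 0))"
    have x0: "x $ a \<noteq> 0 \<Longrightarrow> a = Inr i \<or> a = Inr k \<or> a = Inl j" for a by (auto simp: x_def split: if_splits)
    have "peval h x = lookup h (sv (Inr i) + sv (Inr k)) * mon (sv (Inr i) + sv (Inr k)) x"
    proof (rule peval_one_term, rule ccontr)
      fix m assume m: "m \<in> keys h" "m \<noteq> sv (Inr i) + sv (Inr k)" "mon m x \<noteq> 0"
      obtain a b where ab: "m = sv a + sv b" "a \<noteq> b" using key[OF m(1)] by blast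
      then have "x $ a \<noteq> 0" "x $ b \<noteq> 0" using m(3) by (auto simp: mon_add mon_sv)
      moreover have "lookup h (sv a + sv b) \<noteq> 0" using m(1) ab by (simp add: in_keys_iff)
      ultimately show False
        using x0[of a] x0[of b] m(2) ab mixed[of j i] mixed[of j k] by (auto simp: add.commute)
    qed
    moreover have "peval h x = 0"
    proof (rule van)
      show "sign_form x = 0" by (simp add: sign_form_def x_def sum.distrib)
      have "x $ Inl j \<noteq> 0" by (simp add: x_def)
      then show "x \<noteq> 0" by auto
    qed (simp add: x_def)
    ultimately show ?thesis using ik by (simp add: mon_add mon_sv x_def)
  qed
  have "m \<notin> keys h" for m
  proof
    assume m: "m \<in> keys h"
    obtain a b where ab: "m = sv a + sv b" "a \<noteq> b" using key[OF m(1)] by blast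
    have "lookup h m = 0"
      using ab mixed left right by (cases a; cases b) (auto simp: add.commute[of "sv (Inr _)" "sv (Inl _)"])
    then show False using m by (simp add: in_keys_iff)
  qed
  then have "keys h = {}" by blast
  then show ?thesis using poly_mapping_sum_single[of h] by simp
qed

lemma homogeneous_add: "homogeneous d p \<Longrightarrow> homogeneous d q \<Longrightarrow> homogeneous d (p + q)"
  unfolding homogeneous_def using Poly_Mapping.keys_add[of p q] by blast

lemma homogeneous_sum: "(\<And>i. i \<in> I \<Longrightarrow> homogeneous d (p i)) \<Longrightarrow> homogeneous d (\<Sum>i\<in>I. p i)"
  by (induction I rule: infinite_finite_induct) (auto simp: homogeneous_add, simp_all add: homogeneous_def)

lemma homogeneous_diff:
  fixes p q :: "('n::finite, real) mpolynomial"
  assumes "homogeneous d p" "homogeneous d q" shows "homogeneous d (p - q)"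
  unfolding homogeneous_def
proof
  fix m assume "m \<in> keys (p - q)"
  then have "m \<in> keys p \<or> m \<in> keys q" by (auto simp: in_keys_iff lookup_minus)
  then show "exp_sum m = d" using assms by (auto simp: homogeneous_def)
qed

lemma homogeneous_single_mult:
  fixes q :: "('n::finite, real) mpolynomial"
  assumes "homogeneous d q" shows "homogeneous (Suc d) (single (sv a) 1 * q)"
  unfolding homogeneous_def
proof
  fix m assume "m \<in> keys (single (sv a) 1 * q)"
  then have "lookup (single (sv a) 1 * q) m \<noteq> 0" by (simp add: in_keys_iff)
  then obtain \<nu> where "m = sv a + \<nu>" "lookup q \<nu> \<noteq> 0" by (rule sv_mult_nonzero)
  then show "exp_sum m = Suc d" using assms by (simp add: homogeneous_def in_keys_iff exp_sum_add exp_sum_sv)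
qed

lemma homogeneous_sign_mult: "homogeneous d q \<Longrightarrow> homogeneous (Suc d) (sign_poly * q)"
  unfolding sign_poly_def left_diff_distrib sum_distrib_right
  by (intro homogeneous_diff homogeneous_sum homogeneous_single_mult)

lemma mon_nonzero: "(\<And>a. lookup \<mu> a > 0 \<Longrightarrow> x $ a \<noteq> 0) \<Longrightarrow> mon \<mu> x \<noteq> (0 :: 'a::field)"
  unfolding mon_def by (auto simp: prod_zero_iff)

section \<open>Positivity and the absence of common factors\<close>

locale monomial_ball_map =
  fixes g :: "'r::finite option + 'r option \<Rightarrow> ('r + 'r, complex) mpolynomial"
  assumes card2: "CARD('r) \<ge> 2" and ball: "ball_rational_map g" and mono: "monomial_map g"
begin

lemma rat: "rational_map g" using ball by (simp add: ball_rational_map_def)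

lemma peval_sqrt:
  assumes "\<And>a. 0 \<le> x $ a"
  shows "peval (norm_poly g) x = nform (pmap g (\<chi> a. complex_of_real (sqrt (x $ a))))"
    "nform (\<chi> a. complex_of_real (sqrt (x $ a))) = sign_form x"
proof -
  have "x = (\<chi> i. (cmod ((\<chi> a. complex_of_real (sqrt (x $ a))) $ i))\<^sup>2)" using assms by (simp add: vec_eq_iff)
  then show "peval (norm_poly g) x = nform (pmap g (\<chi> a. complex_of_real (sqrt (x $ a))))"
    using peval_norm_poly[OF mono, of "\<chi> a. complex_of_real (sqrt (x $ a))"] by simp
  show "nform (\<chi> a. complex_of_real (sqrt (x $ a))) = sign_form x"
    using assms by (simp add: nform_sums sign_form_def)
qed

lemma norm_poly_nonneg:
  assumes "\<And>a. 0 \<le> x $ a" "sign_form x > 0" shows "peval (norm_poly g) x \<ge> 0"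
proof -
  define z where "z = (\<chi> a. complex_of_real (sqrt (x $ a)))"
  have "z \<in> pcone" using peval_sqrt(2)[OF assms(1)] assms(2) by (simp add: pcone_def z_def)
  then have "nform (pmap g z) \<ge> 0"
    using ball_map_nform_pos[OF ball] by (cases "pmap g z = 0") (auto intro: less_imp_le)
  then show ?thesis using peval_sqrt(1)[OF assms(1)] by (simp add: z_def)
qed

lemma generic_point:
  obtains z :: "complex^('r + 'r)" where "z \<in> pcone" "z $ v = 0" "\<And>a. a \<noteq> v \<Longrightarrow> z $ a \<noteq> 0"
proof -
  \<comment> \<open>R^2 = r + 1 exceeds the at most r units from the y-coordinates, and r \<ge> 2
    leaves a nonzero x-coordinate even if \<open>v\<close> is an x-index.\<close>
  define R where "R = complex_of_real (sqrt (real (CARD('r) + 1)))"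
  define z :: "complex^('r + 'r)" where
    "z = (\<chi> a. if a = v then 0 else (case a of Inl i \<Rightarrow> R | Inr j \<Rightarrow> 1))"
  have R: "(cmod R)\<^sup>2 = real (CARD('r) + 1)" unfolding R_def norm_of_real by simp
  then have "R \<noteq> 0" by auto
  obtain i where i: "Inl i \<noteq> v" using exists_other[OF card2] by (metis Inl_inject)
  have "(\<Sum>j\<in>UNIV. (cmod (z $ Inr j))\<^sup>2) \<le> (\<Sum>j\<in>(UNIV :: 'r set). 1)"
    by (rule sum_mono) (simp add: z_def)
  also have "\<dots> < (cmod (z $ Inl i))\<^sup>2" using i R by (simp add: z_def)
  also have "\<dots> \<le> (\<Sum>i\<in>UNIV. (cmod (z $ Inl i))\<^sup>2)" by (rule member_le_sum) auto
  finally have "z \<in> pcone" by (simp add: pcone_def nform_sums)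
  moreover have "z $ v = 0" "\<And>a. a \<noteq> v \<Longrightarrow> z $ a \<noteq> 0"
    using \<open>R \<noteq> 0\<close> by (auto simp: z_def split: sum.splits)
  ultimately show thesis using that by blast
qed

text \<open>If \<open>P\<close> vanishes on a coordinate hyperplane, then so do all components of \<open>g\<close>, which is excluded
  because they have no common factor.\<close>

lemma no_common_variable:
  assumes P: "norm_poly g = sign_poly * Q" and v: "\<And>\<mu>. \<mu> \<in> keys Q \<Longrightarrow> lookup \<mu> v > 0"
  shows False
proof -
  obtain z where z: "z \<in> pcone" "z $ v = 0" "\<And>a. a \<noteq> v \<Longrightarrow> z $ a \<noteq> 0" using generic_point[of v] by blast
  let ?x = "(\<chi> i. (cmod (z $ i))\<^sup>2) :: real^('r + 'r)"
  have "mon \<mu> ?x = 0" if \<mu>: "\<mu> \<in> keys Q" for \<mu>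
  proof -
    obtain \<nu> where "\<mu> = sv v + \<nu>" using lookup_pos_split[OF v[OF \<mu>]] by blast
    then show ?thesis using z(2) by (simp add: mon_add mon_sv)
  qed
  then have "peval Q ?x = 0" by (simp add: peval_superset[of "keys Q" Q])
  then have "nform (pmap g z) = 0"
    using peval_norm_poly[OF mono, of z] by (simp add: P peval_sign_poly_mult)
  \<comment> \<open>A nonzero image of a point of the cone has positive form.\<close>
  then have "pmap g z = 0" using ball_map_nform_pos[OF ball z(1)] by auto
  \<comment> \<open>Only the coordinate \<open>v\<close> of \<open>z\<close> vanishes, so a monomial
    that is zero at \<open>z\<close> contains that variable.\<close>
  have "single (sv v) 1 dvd g k" for k
  proof -
    obtain \<alpha> c where g: "g k = single \<alpha> c" using mono unfolding monomial_map_def by blast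
    show ?thesis
    proof (cases "c = 0")
      case False
      have "peval (g k) z = 0" using \<open>pmap g z = 0\<close> by (metis pmap_nth zero_index)
      then have "mon \<alpha> z = 0" using False by (simp add: g peval_single)
      then have "lookup \<alpha> v > 0" using mon_nonzero[of \<alpha> z] z(3) by (metis gr0I)
      then obtain \<beta> where "\<alpha> = sv v + \<beta>" by (rule lookup_pos_split)
      then have "g k = single (sv v) 1 * single \<beta> c" by (simp add: g mult_single)
      then show ?thesis by (rule dvdI)
    qed (simp add: g)
  qed
  then have "single (sv v) 1 dvd (1 :: ('r + 'r, complex) mpolynomial)"
    using rat unfolding rational_map_def by blast
  then obtain q where "(1 :: ('r + 'r, complex) mpolynomial) = single (sv v) 1 * q" by (rule dvdE)
  then have "lookup (single (sv v) 1 * q) 0 = 1"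
    by (metis lookup_one_zero)
  then obtain \<nu> where "0 = sv v + \<nu>" using lookup_single_mult_nonzero[of "sv v" q 0] by auto
  from arg_cong[OF this, of "\<lambda>\<mu>. lookup \<mu> v"] show False by (simp add: lookup_add lookup_sv)
qed

text \<open>With Q = 0 the condition on its exponents is vacuous, so any variable yields the
  contradiction.\<close>

lemma norm_poly_nonzero: "norm_poly g \<noteq> 0"
proof
  assume "norm_poly g = 0"
  then show False using no_common_variable[of 0 undefined] by simp
qed

lemma component_homogeneous: obtains d where "\<And>k. homogeneous d (g k)" "homogeneous d (norm_poly g)"
proof -
  obtain d where d: "\<And>k. homogeneous d (g k)" using rational_map_homogeneous[OF rat] by blast
  have "homogeneous d (norm_poly g)"
    unfolding homogeneous_def
  proof
    fix m assume "m \<in> keys (norm_poly g)"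
    then have "lookup (norm_poly g) m < 0 \<or> lookup (norm_poly g) m > 0"
      by (auto simp: in_keys_iff)
    then obtain k where "m \<in> keys (g k)" using norm_poly_pos_key norm_poly_neg_key by metis
    then show "exp_sum m = d" using d by (auto simp: homogeneous_def)
  qed
  with d that show thesis by blast
qed

lemma degree_le_map_degree:
  assumes "\<And>k. homogeneous d (g k)" shows "d \<le> map_degree g"
proof -
  obtain k where k: "g k \<noteq> 0" using rat by (auto simp: rational_map_def)
  then obtain m where m: "m \<in> keys (g k)" using poly_mapping_sum_single[of "g k"] by fastforce
  then have "exp_sum m = d" using assms by (auto simp: homogeneous_def)
  then have "d \<le> total_degree (g k)" unfolding total_degree_def using m by (intro Max_ge) auto
  also have "\<dots> \<le> map_degree g" unfolding map_degree_def by (rule Max_ge) auto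
  finally show ?thesis .
qed

definition Pos where "Pos = {\<mu>. lookup (norm_poly g) \<mu> > 0}"
definition Neg where "Neg = {\<mu>. lookup (norm_poly g) \<mu> < 0}"

lemma sign_counts: "finite Pos" "card Pos \<le> CARD('r) + 1" "finite Neg" "card Neg \<le> CARD('r) + 1"
  using norm_poly_sign_counts[OF mono] by (simp_all add: Pos_def Neg_def card_UNIV_option)

section \<open>Reduction to a nonnegative quotient with m = 1\<close>

text \<open>Write a_i, b_j for the coefficients of Q. Positivity at x_i = 1, y_j = t < 1 gives a_i +
  t b_j \<ge> 0, so a_i \<ge> 0, and a negative b_j makes every a_i positive. All monomials of
  degree m + 1 in x then have positive coefficients; the count permits this only for m = 1 and
  without positive coefficients of lower x-degree, whereas y_j^2 has coefficient -b_j.\<close>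

lemma linear_quotient_nonneg:
  assumes P: "norm_poly g = sign_poly ^ m * Q" and m: "m > 0" and Q: "homogeneous 1 Q"
  shows "lookup Q \<mu> \<ge> 0"
proof -
  let ?a = "\<lambda>i. lookup Q (sv (Inl i))" and ?b = "\<lambda>j. lookup Q (sv (Inr j))"
  have key: "\<exists>a. \<mu> = sv a" if "lookup Q \<mu> \<noteq> 0" for \<mu>
  proof -
    have "exp_sum \<mu> = 1" using Q that by (auto simp: homogeneous_def in_keys_iff)
    then show ?thesis by (rule exp_sum_1) blast
  qed
  have ev: "peval Q x = (\<Sum>i\<in>UNIV. ?a i * x $ Inl i) + (\<Sum>j\<in>UNIV. ?b j * x $ Inr j)" for x
  proof -
    have "peval Q x = (\<Sum>m\<in>range sv. lookup Q m * mon m x)"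
      by (rule peval_superset) (use key in \<open>auto simp: in_keys_iff\<close>)
    also have "\<dots> = (\<Sum>a\<in>UNIV. lookup Q (sv a) * x $ a)"
      by (subst sum.reindex) (auto simp: inj_on_def mon_sv)
    also have "\<dots> = (\<Sum>i\<in>UNIV. ?a i * x $ Inl i) + (\<Sum>j\<in>UNIV. ?b j * x $ Inr j)"
      unfolding UNIV_sum by (subst sum.union_disjoint) (auto simp: sum.reindex)
    finally show ?thesis .
  qed
  have Qnn: "peval Q x \<ge> 0" if "\<And>a. 0 \<le> x $ a" "sign_form x > 0" for x
  proof -
    have "sign_form x ^ m * peval Q x \<ge> 0"
      using norm_poly_nonneg[OF that] by (simp add: P peval_sign_poly_power)
    moreover have "sign_form x ^ m > 0" using that(2) by simp
    ultimately show ?thesis by (simp add: zero_le_mult_iff)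
  qed
  have line: "?a i + t * ?b j \<ge> 0" if t: "0 \<le> t" "t < 1" for i j t
  proof -
    define x :: "real^('r + 'r)" where "x = (\<chi> a. (if a = Inl i then 1 else 0) + (if a = Inr j then t else 0))"
    have "peval Q x \<ge> 0" by (rule Qnn) (use t in \<open>auto simp: x_def sign_form_def\<close>)
    then show ?thesis
      by (simp add: ev x_def if_distrib[of "(*) _"] mult.commute cong: if_cong)
  qed
  have a0: "?a i \<ge> 0" for i using line[of 0 i undefined] by simp
  have b0: "?b j \<ge> 0" for j
  proof (rule ccontr)
    assume "\<not> ?b j \<ge> 0"
    then have bj: "?b j < 0" by simp
    have ai: "?a i > 0" for i using line[of "1/2" i j] bj by simp
    let ?\<alpha> = "sv (Inl (undefined :: 'r)) :: 'r + 'r \<Rightarrow>\<^sub>0 nat"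
    have top: "(\<forall>\<mu>. lookup (sign_poly ^ m * Q) \<mu> \<noteq> 0 \<longrightarrow> xdeg \<mu> \<le> 1 + m) \<and>
      (\<forall>\<mu>. xdeg \<mu> = 1 + m \<longrightarrow> lookup (sign_poly ^ m * Q) \<mu> \<ge> 0) \<and>
      (\<forall>\<alpha> ks. xdeg \<alpha> = 1 \<and> lookup Q \<alpha> > 0 \<and> length ks = m \<longrightarrow>
       lookup (sign_poly ^ m * Q) (sum_list (map (\<lambda>i. sv (Inl i)) ks) + \<alpha>) > 0)"
      unfolding sign_poly_def
    proof (rule top_degree_part)
      fix \<mu> assume "lookup Q \<mu> \<noteq> 0"
      then obtain a where "\<mu> = sv a" using key by blast
      then show "xdeg \<mu> \<le> 1" by (cases a) auto
    next
      fix \<mu> :: "'r + 'r \<Rightarrow>\<^sub>0 nat" assume *: "xdeg \<mu> = 1"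
      show "0 \<le> lookup Q \<mu>"
      proof (cases "lookup Q \<mu> = 0")
        case False
        then obtain a where "\<mu> = sv a" using key by blast
        then show ?thesis using * a0 by (cases a) auto
      qed simp
    qed auto
    \<comment> \<open>One variable comes from Q and m from the power of s, so the count applies with
      word length m + 1 and base exponent 0.\<close>
    have mem: "sum_list (map (\<lambda>i. sv (Inl i)) ks) + 0 \<in> Pos" if ksl: "length ks = Suc m" for ks :: "'r list"
    proof -
      obtain i js where ks: "ks = i # js" "length js = m" using ksl by (auto simp: length_Suc_conv)
      have "lookup (sign_poly ^ m * Q) (sum_list (map (\<lambda>i. sv (Inl i)) js) + sv (Inl i)) > 0"
        using top ai ks by auto
      then show ?thesis by (simp add: Pos_def P ks add.commute)
    qed
    have n2: "Suc m \<ge> 2" using m by simp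
    have tm: "Suc m = 2" "\<And>\<mu>. \<mu> \<in> Pos \<Longrightarrow> xdeg \<mu> = xdeg (0 :: 'r + 'r \<Rightarrow>\<^sub>0 nat) + Suc m"
      using too_many_top_monomials[OF card2 n2 sign_counts(1,2), of 0] mem by blast+
    have m1: "m = 1" using tm(1) by simp
    have xd: "xdeg \<mu> = 2" if "\<mu> \<in> Pos" for \<mu> using tm(2)[OF that] m1 by simp
    let ?\<mu> = "sv (Inr j) + sv (Inr j) :: 'r + 'r \<Rightarrow>\<^sub>0 nat"
    let ?l = "\<lambda>x. lookup (single (sv x) 1 * Q) ?\<mu>"
    have l0: "?l x = 0" if "x \<noteq> Inr j" for x
    proof (rule ccontr)
      assume "?l x \<noteq> 0"
      then obtain \<nu> where "?\<mu> = sv x + \<nu>" by (rule sv_mult_nonzero)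
      from arg_cong[OF this, of "\<lambda>\<mu>. lookup \<mu> x"] that show False by (simp add: lookup_add lookup_sv)
    qed
    have "lookup (norm_poly g) ?\<mu> = (\<Sum>i\<in>UNIV. ?l (Inl i)) - (\<Sum>k\<in>UNIV. ?l (Inr k))"
      unfolding P m1 sign_poly_def power_one_right by (rule lookup_signed_sum_mult)
    also have "(\<Sum>i\<in>UNIV. ?l (Inl i)) = 0" using l0 by simp
    also have "(\<Sum>k\<in>UNIV. ?l (Inr k)) = (\<Sum>k\<in>UNIV. if k = j then ?b j else 0)"
      by (rule sum.cong) (use l0 lookup_single_mult[of "sv (Inr j)" Q "sv (Inr j)"] in auto)
    finally have "lookup (norm_poly g) ?\<mu> > 0" using bj by simp
    then show False using xd[of ?\<mu>] by (simp add: Pos_def)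
  qed
  show ?thesis
  proof (cases "lookup Q \<mu> = 0")
    case False
    then obtain a where "\<mu> = sv a" using key by blast
    then show ?thesis using a0 b0 by (cases a) auto
  qed simp
qed

text \<open>For m \<ge> 2 the top products in x leave only m = 2, with every positive coefficient of
  x-degree a + 2. But s^2 = (-s)^2 is symmetric in the two groups of variables, so the top products
  in y are positive as well, and their x-degree is at most a.\<close>

lemma exponent_one:
  assumes P: "norm_poly g = sign_poly ^ m * Q" and m: "m > 0" and Q: "\<And>\<mu>. lookup Q \<mu> \<ge> 0"
  shows "m = 1"
proof (rule ccontr)
  assume "m \<noteq> 1"
  then have m2: "m \<ge> 2" using m by simp
  have keys: "keys Q \<noteq> {}"
    using norm_poly_nonzero P poly_mapping_sum_single[of Q] by force
  define a where "a = Max (xdeg ` keys Q)"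
  define b where "b = Max (ydeg ` keys Q)"
  have "a \<in> xdeg ` keys Q" "b \<in> ydeg ` keys Q"
    unfolding a_def b_def using keys by (auto intro!: Max_in)
  then obtain \<alpha> \<beta> where \<alpha>: "lookup Q \<alpha> > 0" "xdeg \<alpha> = a"
    and \<beta>: "lookup Q \<beta> > 0" "ydeg \<beta> = b"
    using Q by (force simp: in_keys_iff less_le)
  have xa: "xdeg \<mu> \<le> a" and yb: "ydeg \<mu> \<le> b" if "lookup Q \<mu> \<noteq> 0" for \<mu>
    unfolding a_def b_def using that by (auto intro!: Max_ge simp: in_keys_iff)
  have top: "lookup (sign_poly ^ m * Q) (sum_list (map (\<lambda>i. sv (Inl i)) ks) + \<alpha>) > 0"
    if "length ks = m" for ks
    using top_degree_part[where e = Inl and f = Inr and D = xdeg and q = Q and a = a and m = m] xa Q \<alpha> that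
    unfolding sign_poly_def by auto
  have mem: "sum_list (map (\<lambda>i. sv (Inl i)) ks) + \<alpha> \<in> Pos" if "length ks = m" for ks
    using top[OF that] by (simp add: Pos_def P)
  have tm: "m = 2" "\<And>\<mu>. \<mu> \<in> Pos \<Longrightarrow> xdeg \<mu> = xdeg \<alpha> + m"
    using too_many_top_monomials[OF card2 m2 sign_counts(1,2), of \<alpha>] mem by blast+
  have m2: "m = 2" by (rule tm(1))
  \<comment> \<open>This is -s, with the y-variables in the positive role, as
    \<open>top_degree_part\<close> expects.\<close>
  define S' where "S' = (\<Sum>i\<in>UNIV. single (sv (Inr i)) (1::real))
    - (\<Sum>j\<in>UNIV. single (sv (Inl j :: 'r + 'r)) 1)"
  have "S' = - sign_poly" by (simp add: S'_def sign_poly_def)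
  then have S': "S' ^ 2 = sign_poly ^ 2" by simp
  define \<gamma> where "\<gamma> = sum_list (map (\<lambda>i. sv (Inr i)) [undefined, undefined]) + \<beta>"
  have "lookup (S' ^ 2 * Q) \<gamma> > 0"
    using top_degree_part[where e = Inr and f = Inl and D = ydeg and q = Q and a = b and m = 2] yb Q \<beta>
    unfolding S'_def \<gamma>_def by (auto simp del: list.map sum_list.Cons)
  then have "\<gamma> \<in> Pos" by (simp add: Pos_def P m2 S')
  then have "xdeg \<gamma> = a + 2" using tm(2) m2 \<alpha>(2) by simp
  moreover have "xdeg \<gamma> = xdeg \<beta>" by (simp add: \<gamma>_def)
  ultimately show False using xa[of \<beta>] \<beta>(1) by simp
qed

text \<open>Properness makes P vanish on the part of s = 0 in the orthant. In degree at most 2 this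
  can be turned into divisibility by s by comparing coefficients at a few points, and positivity
  supplies the sign of the quotient.\<close>

lemma low_degree_quotient:
  assumes proper: "proper_ball_rational_map g" and deg: "map_degree g \<le> 2"
  obtains Q where "norm_poly g = sign_poly * Q" "\<And>\<mu>. lookup Q \<mu> \<ge> 0"
proof -
  obtain d where dg: "\<And>k. homogeneous d (g k)" and d: "homogeneous d (norm_poly g)" using component_homogeneous by blast
  have d2: "d \<le> 2" using degree_le_map_degree[OF dg] deg by simp
  let ?P = "norm_poly g"
  have van: "peval ?P x = 0" if x: "\<And>a. 0 \<le> x $ a" "sign_form x = 0" "x \<noteq> 0" for x
  proof -
    define z where "z = (\<chi> a. complex_of_real (sqrt (x $ a)))"
    have "nform z = 0" using peval_sqrt(2)[OF x(1)] x(2) by (simp add: z_def)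
    moreover have "z \<noteq> 0"
    proof
      assume "z = 0"
      then have "x $ a = 0" for a using x(1)[of a] by (auto simp: z_def vec_eq_iff)
      then show False using x(3) by (simp add: vec_eq_iff)
    qed
    ultimately show ?thesis
      using proper_map_boundary[OF proper] peval_sqrt(1)[OF x(1)] by (simp add: z_def)
  qed
  define xx :: "'r \<Rightarrow> 'r \<Rightarrow> real^('r + 'r)" where "xx i j = (\<chi> a. if a = Inl i \<or> a = Inr j then 1 else 0)" for i j
  have xx: "sign_form (xx i j) = 0" "xx i j \<noteq> 0" "0 \<le> xx i j $ a" for i j a
    by (auto simp: xx_def sign_form_def vec_eq_iff)
  consider "d = 0" | "d = 1" | "d = 2" using d2 by linarith
  then show thesis
  proof cases
    case 1
    then have "m = 0" if "m \<in> keys ?P" for m using d that exp_sum_eq_0 by (auto simp: homogeneous_def)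
    then have "keys ?P \<subseteq> {0}" by auto
    then have ev: "peval ?P x = lookup ?P 0" for x by (simp add: peval_superset[of "{0}"])
    have "lookup ?P 0 = 0" using van[OF xx(3) xx(1) xx(2)] ev by simp
    then have "peval ?P x = 0" for x using ev by simp
    then have "?P = 0" by (intro peval_eq_zero_on_orthant) simp
    then show thesis using norm_poly_nonzero by simp
  next
    case 2
    have key: "\<exists>a. m = sv a" if "m \<in> keys ?P" for m
    proof -
      have "exp_sum m = 1" using d 2 that by (auto simp: homogeneous_def)
      then show ?thesis by (rule exp_sum_1) blast
    qed
    let ?c = "\<lambda>a. lookup ?P (sv a)"
    have ev: "peval ?P x = (\<Sum>i\<in>UNIV. ?c (Inl i) * x $ Inl i) + (\<Sum>j\<in>UNIV. ?c (Inr j) * x $ Inr j)" for x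
    proof -
      have "peval ?P x = (\<Sum>m\<in>range sv. lookup ?P m * mon m x)"
        by (rule peval_superset) (use key in auto)
      also have "\<dots> = (\<Sum>a\<in>UNIV. ?c a * x $ a)"
        by (subst sum.reindex) (auto simp: inj_on_def mon_sv)
      also have "\<dots> = (\<Sum>i\<in>UNIV. ?c (Inl i) * x $ Inl i) + (\<Sum>j\<in>UNIV. ?c (Inr j) * x $ Inr j)"
        unfolding UNIV_sum by (subst sum.union_disjoint) (auto simp: sum.reindex)
      finally show ?thesis .
    qed
    have c: "?c (Inl i) + ?c (Inr j) = 0" for i j
      using van[OF xx(3) xx(1) xx(2), of i j] by (simp add: ev xx_def if_distrib[of "(*) _"] cong: if_cong)
    define c0 where "c0 = ?c (Inl undefined)"
    have cr: "?c (Inr j) = - c0" for j using c[of undefined j] by (simp add: c0_def)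
    have cl: "?c (Inl i) = c0" for i using c[of i undefined] cr by simp
    have P: "?P = sign_poly ^ 1 * single 0 c0"
      by (rule eq_sign_poly_power_mult)
         (simp add: ev cr cl peval_single sign_form_def sum_distrib_left sum_negf algebra_simps)
    define x :: "real^('r + 'r)" where "x = (\<chi> a. if a = Inl undefined then 1 else 0)"
    have "peval ?P x \<ge> 0" by (rule norm_poly_nonneg) (auto simp: x_def sign_form_def)
    then have "c0 \<ge> 0" by (simp add: ev x_def if_distrib[of "(*) _"] cl cong: if_cong)
    then show thesis using that[of "single 0 c0"] P by (simp add: lookup_single when_def)
  next
    case 3
    \<comment> \<open>In s Q the coefficient of x_i^2 is that of x_i in Q, and the coefficient of
      y_j^2 is minus that of y_j. With these signs s Q has the squares of P, and the difference
      satisfies \<open>quadratic_form_zero\<close>.\<close>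
    define Q :: "('r + 'r, real) mpolynomial" where
      "Q = (\<Sum>i\<in>UNIV. single (sv (Inl i)) (lookup ?P (sv (Inl i) + sv (Inl i))))
         - (\<Sum>j\<in>UNIV. single (sv (Inr j)) (lookup ?P (sv (Inr j) + sv (Inr j))))"
    have hQ: "homogeneous 1 Q"
      unfolding Q_def by (intro homogeneous_diff homogeneous_sum) (auto simp: homogeneous_def exp_sum_sv split: if_splits)
    have lQ: "lookup Q (sv a) = (case a of Inl i \<Rightarrow> 1 | Inr j \<Rightarrow> -1) * lookup ?P (sv a + sv a)" for a
    proof -
      have "lookup Q (sv a)
        = (\<Sum>i\<in>UNIV. if Inl i = a then lookup ?P (sv (Inl i) + sv (Inl i)) else 0)
         - (\<Sum>j\<in>UNIV. if Inr j = a then lookup ?P (sv (Inr j) + sv (Inr j)) else 0)"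
        unfolding Q_def by (simp add: lookup_minus lookup_sum lookup_single when_def)
      then show ?thesis by (cases a) auto
    qed
    define h where "h = ?P - sign_poly * Q"
    have "h = 0"
    proof (rule quadratic_form_zero)
      show "homogeneous 2 h"
        unfolding h_def using d 3 homogeneous_sign_mult[OF hQ] by (intro homogeneous_diff) (auto simp: numeral_2_eq_2)
      show "lookup h (sv a + sv a) = 0" for a
      proof -
        let ?l = "\<lambda>x. lookup (single (sv x) 1 * Q) (sv a + sv a)"
        have l0: "?l x = 0" if "x \<noteq> a" for x
        proof (rule ccontr)
          assume "?l x \<noteq> 0"
          then obtain \<nu> where "sv a + sv a = sv x + \<nu>" by (rule sv_mult_nonzero)
          from arg_cong[OF this, of "\<lambda>\<mu>. lookup \<mu> x"] that show False by (simp add: lookup_add lookup_sv)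
        qed
        have la: "?l a = lookup Q (sv a)" by (rule lookup_single_mult)
        have "lookup (sign_poly * Q) (sv a + sv a) = (\<Sum>i\<in>UNIV. ?l (Inl i)) - (\<Sum>k\<in>UNIV. ?l (Inr k))"
          unfolding sign_poly_def by (rule lookup_signed_sum_mult)
        also have "\<dots> = (\<Sum>i\<in>UNIV. if Inl i = a then ?l a else 0) - (\<Sum>k\<in>UNIV. if Inr k = a then ?l a else 0)"
          by (intro arg_cong2[of _ _ _ _ "(-)"] sum.cong) (use l0 in auto)
        also have "\<dots> = lookup ?P (sv a + sv a)" unfolding la lQ by (cases a) auto
        finally show ?thesis by (simp add: h_def lookup_minus)
      qed
      show "peval h x = 0" if "\<And>a. 0 \<le> x $ a" "sign_form x = 0" "x \<noteq> 0" for x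
        using van[OF that] that(2) by (simp add: h_def peval_diff peval_sign_poly_mult)
    qed
    then have P: "?P = sign_poly * Q" by (simp add: h_def)
    then show thesis using linear_quotient_nonneg[of 1 Q] hQ that by simp
  qed
qed

lemma quotient_nonneg:
  assumes proper: "proper_ball_rational_map g"
    and Q: "map_degree g \<le> 2 \<or> (\<exists>Q. is_quotient_polynomial g Q \<and>
            (total_degree Q = 1 \<or> (\<forall>m. lookup Q m \<ge> 0)))"
  obtains Q where "norm_poly g = sign_poly * Q" "\<And>\<mu>. lookup Q \<mu> \<ge> 0"
  using Q
proof
  assume "map_degree g \<le> 2"
  then show thesis using low_degree_quotient[OF proper] that by blast
next
  assume "\<exists>Q. is_quotient_polynomial g Q \<and> (total_degree Q = 1 \<or> (\<forall>m. lookup Q m \<ge> 0))"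
  then obtain Q where Q: "is_quotient_polynomial g Q" "total_degree Q = 1 \<or> (\<forall>m. lookup Q m \<ge> 0)" by blast
  then obtain P m d where P: "norm_polynomial g P" "m > 0" "homogeneous d Q" "\<And>x. peval P x = sign_form x ^ m * peval Q x"
    unfolding is_quotient_polynomial_def by blast
  have PQ: "norm_poly g = sign_poly ^ m * Q"
    using eq_sign_poly_power_mult[OF P(4)] norm_polynomial_unique[OF mono P(1)] by simp
  have nn: "lookup Q \<mu> \<ge> 0" for \<mu>
    using Q(2)
  proof
    assume t: "total_degree Q = 1"
    have "1 \<in> insert 0 (exp_sum ` keys Q)"
      unfolding t[unfolded total_degree_def, symmetric] by (rule Max_in) auto
    then have "d = 1" using P(3) by (auto simp: homogeneous_def)
    then show ?thesis using linear_quotient_nonneg[OF PQ P(2)] P(3) by simp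
  qed blast
  then have "m = 1" using exponent_one[OF PQ P(2)] by blast
  then show thesis using that[of Q] PQ nn by simp
qed

lemma monomial_map_cases:
  assumes PQ: "norm_poly g = sign_poly * Q" and nn: "\<And>\<mu>. lookup Q \<mu> \<ge> 0"
  obtains (linear) c where "c > 0" "\<And>z. nform (pmap g z) = c * nform z" "\<And>k. homogeneous 1 (g k)"
  | (binomial) i j c where "CARD('r) = 2" "c > 0"
      "\<And>x. peval (norm_poly g) x = sign_form x * (c * (x $ Inl i + x $ Inr j))"
  | (quadrinomial) c where "CARD('r) = 2" "c > 0"
      "\<And>x. peval (norm_poly g) x = sign_form x * (c * ((\<Sum>i\<in>UNIV. x $ Inl i) + (\<Sum>j\<in>UNIV. x $ Inr j)))"
proof -
  have "Q \<noteq> 0" using PQ norm_poly_nonzero by auto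
  then interpret sq: sign_quotient Q
    using card2 nn sign_counts by unfold_locales (auto simp: Pos_def Neg_def PQ)
  \<comment> \<open>A nontrivial monomial dividing all terms of Q contains a variable common to them
    all.\<close>
  have \<rho>0: "\<rho> = 0" if "\<And>\<mu>. \<mu> \<in> keys Q \<Longrightarrow> \<exists>\<nu>. \<mu> = \<nu> + \<rho>" for \<rho>
  proof (rule ccontr)
    assume "\<rho> \<noteq> 0"
    then obtain v where v: "lookup \<rho> v > 0" by (metis gr0I lookup_zero poly_mapping_eqI)
    show False
      by (rule no_common_variable[OF PQ, of v]) (use that v in \<open>force simp: lookup_add\<close>)
  qed
  have evQ: "peval Q x = (\<Sum>\<mu>\<in>sq.B. lookup Q \<mu> * mon \<mu> x)" for x
    by (rule peval_superset) (auto simp: sq.B_def)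
  show thesis
  proof (cases rule: sq.classification)
    case (monomial \<rho> c)
    have "\<rho> = 0" by (rule \<rho>0) (use monomial in \<open>auto intro: exI[of _ 0]\<close>)
    then have P: "peval (norm_poly g) x = c * sign_form x" for x
      by (simp add: PQ peval_sign_poly_mult monomial peval_single)
    have nf: "nform (pmap g z) = c * nform z" for z
      unfolding peval_norm_poly[OF mono, symmetric] P by (simp add: sign_form_def nform_sums)
    obtain d where d: "\<And>k. homogeneous d (g k)" using rational_map_homogeneous[OF rat] by blast
    obtain z :: "complex^('r + 'r)" where z: "z \<in> pcone" using generic_point by blast
    \<comment> \<open>The degree is read off by scaling: doubling z multiplies the form of the image
      by 4^d on one side and by 4 on the other.\<close>
    have "nform (pmap g (2 *s z)) = 4 ^ d * (c * nform z)"
    proof -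
      have "((2::real) ^ d)\<^sup>2 = (2\<^sup>2) ^ d" by (simp only: power_mult[symmetric] mult.commute)
      then show ?thesis unfolding pmap_homogeneous[OF d] by (simp add: nform_cmult nf norm_power)
    qed
    moreover have "nform (pmap g (2 *s z)) = 4 * (c * nform z)" by (simp add: nf nform_cmult)
    moreover have "c \<noteq> 0" "nform z \<noteq> 0" using z monomial by (simp_all add: pcone_def)
    ultimately have "(4::real) ^ d = 4 ^ 1" by simp
    then have "d = 1" using power_inject_exp[of "4::real" d 1] by simp
    then show thesis using linear[OF monomial(1) nf] d by simp
  next
    case (binomial i j \<rho> c)
    have "\<rho> = 0" by (rule \<rho>0) (use binomial in \<open>auto simp: sq.B_def\<close>)
    then have B: "sq.B = {sv (Inl i), sv (Inr j)}" using binomial by simp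
    have "peval Q x = (\<Sum>\<mu>\<in>sq.B. c * mon \<mu> x)" for x
      unfolding evQ by (rule sum.cong) (use binomial in auto)
    then have "peval Q x = c * (x $ Inl i + x $ Inr j)" for x
      by (simp add: B mon_sv distrib_left)
    then show thesis using that(2)[OF binomial(1,2), of i j] by (simp add: PQ peval_sign_poly_mult)
  next
    case (quadrinomial \<rho> c)
    have "\<rho> = 0" by (rule \<rho>0) (use quadrinomial in \<open>auto simp: sq.B_def\<close>)
    then have B: "sq.B = range (\<lambda>i. sv (Inl i)) \<union> range (\<lambda>j. sv (Inr j))" using quadrinomial by simp
    have "peval Q x = (\<Sum>\<mu>\<in>sq.B. c * mon \<mu> x)" for x
      unfolding evQ by (rule sum.cong) (use quadrinomial in auto)
    moreover have "(\<Sum>\<mu>\<in>sq.B. c * mon \<mu> x) = c * ((\<Sum>i\<in>UNIV. x $ Inl i) + (\<Sum>j\<in>UNIV. x $ Inr j))" for x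
      unfolding B by (subst sum.union_disjoint) (auto simp: sum.reindex inj_on_def mon_sv distrib_left sum_distrib_left)
    ultimately show thesis using that(3)[OF quadrinomial(1,2)] by (simp add: PQ peval_sign_poly_mult)
  qed
qed

end


section \<open>Maps induced by linear isometries\<close>

lemma sum_option: "(\<Sum>k\<in>(UNIV :: 'r::finite option set). f k) = f None + (\<Sum>i\<in>UNIV. f (Some i))"
  by (simp add: UNIV_option_conv sum.reindex)

section \<open>Contractions that extend Z by a row and a column\<close>

text \<open>The domain is open, so it contains t Z for some t > 1; the weak inequality for t Z is
  the strict one for Z unless Z w = 0.\<close>

lemma type1_domain_column_strict:
  fixes Z :: "complex^'s::finite^'r::finite"
  assumes Z: "Z \<in> type1_domain" and w: "w \<noteq> 0"
  shows "norm (Z *v w) < norm w"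
proof (cases "Z *v w = 0")
  case False
  obtain e where e: "e > 0" "ball Z e \<subseteq> type1_domain"
    using open_type1_domain Z open_contains_ball by blast
  define t where "t = 1 + e / (2 * (norm Z + 1))"
  have nz: "norm Z + 1 > 0" by (simp add: add_nonneg_pos)
  have t: "t > 1" using e nz by (simp add: t_def)
  have "dist Z (t *\<^sub>R Z) = e * (norm Z / (2 * (norm Z + 1)))"
  proof -
    have "Z - t *\<^sub>R Z = (- (e / (2 * (norm Z + 1)))) *\<^sub>R Z" by (simp add: t_def algebra_simps)
    then show ?thesis using e nz by (simp add: dist_norm)
  qed
  also have "\<dots> < e * 1" using e nz by (intro mult_strict_left_mono) (auto simp: divide_simps)
  finally have "t *\<^sub>R Z \<in> type1_domain" using e by auto
  then have "norm ((t *\<^sub>R Z) *v w) \<le> norm w" by (rule type1_domain_column_le)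
  moreover have "(t *\<^sub>R Z) *v w = t *\<^sub>R (Z *v w)"
    by (simp add: vec_eq_iff matrix_vector_mult_def scaleR_sum_right)
  ultimately have "t * norm (Z *v w) \<le> norm w" using t by simp
  moreover have "norm (Z *v w) < t * norm (Z *v w)" using t False by simp
  ultimately show ?thesis by linarith
qed (use w in simp)

lemma adjoint_in_type1_domain:
  fixes Z :: "complex^'s::finite^'r::finite"
  assumes "Z \<in> type1_domain" shows "adjoint_mat Z \<in> type1_domain"
proof (rule type1_domainI)
  fix v :: "complex^'s" assume v: "v \<noteq> 0"
  define w where "w = (\<chi> i. cnj (v $ i))"
  have "w \<noteq> 0" using v by (simp add: w_def vec_eq_iff)
  have "(v v* adjoint_mat Z) $ i = cnj ((Z *v w) $ i)" for i
    by (simp add: vector_matrix_mult_def matrix_vector_mult_def adjoint_mat_def w_def mult.commute)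
  then have "norm (v v* adjoint_mat Z) = norm (Z *v w)"
    by (intro power2_eq_imp_eq[of "norm (v v* adjoint_mat Z)"]) (simp_all only: norm_vec_sq complex_mod_cnj norm_ge_zero)
  moreover have "norm w = norm v" by (rule power2_eq_imp_eq) (simp_all add: norm_vec_sq w_def)
  ultimately show "norm (v v* adjoint_mat Z) < norm v"
    using type1_domain_column_strict[OF assms \<open>w \<noteq> 0\<close>] by simp
qed

text \<open>Entry by entry the identity has the error term 4 Im l Im(x_i cnj y_i), which sums to
  zero by assumption. It is applied with y the image of x under a Hermitian matrix.\<close>

lemma swap_norm_identity:
  fixes x y :: "complex^'n::finite"
  assumes "Im (\<Sum>i\<in>UNIV. x $ i * cnj (y $ i)) = 0"
  shows "(norm (x + l *s y))\<^sup>2 - (norm (l *s x + y))\<^sup>2 = (1 - (cmod l)\<^sup>2) * ((norm x)\<^sup>2 - (norm y)\<^sup>2)"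
proof -
  have pt: "(cmod (a + l * b))\<^sup>2 - (cmod (l * a + b))\<^sup>2
      = (1 - (cmod l)\<^sup>2) * ((cmod a)\<^sup>2 - (cmod b)\<^sup>2) + 4 * Im l * Im (a * cnj b)" for a b
    unfolding cmod_power2 by (simp add: power2_eq_square algebra_simps)
  have "(norm (x + l *s y))\<^sup>2 - (norm (l *s x + y))\<^sup>2
      = (\<Sum>i\<in>UNIV. (1 - (cmod l)\<^sup>2) * ((cmod (x $ i))\<^sup>2 - (cmod (y $ i))\<^sup>2) + 4 * Im l * Im (x $ i * cnj (y $ i)))"
    by (simp add: norm_vec_sq sum_subtractf[symmetric] pt)
  also have "\<dots> = (1 - (cmod l)\<^sup>2) * ((norm x)\<^sup>2 - (norm y)\<^sup>2) + 4 * Im l * Im (\<Sum>i\<in>UNIV. x $ i * cnj (y $ i))"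
    unfolding norm_vec_sq sum_subtractf[symmetric] Im_sum by (simp add: sum.distrib sum_distrib_left)
  finally show ?thesis using assms by simp
qed

lemma hermitian_form_real:
  fixes H :: "complex^'n::finite^'n"
  assumes "adjoint_mat H = H"
  shows "Im (\<Sum>i\<in>UNIV. v $ i * cnj ((v v* H) $ i)) = 0" "Im (\<Sum>i\<in>UNIV. v $ i * cnj ((H *v v) $ i)) = 0"
proof -
  have H: "cnj (H $ i $ j) = H $ j $ i" for i j
    using arg_cong[OF assms, of "\<lambda>M. M $ j $ i"] by (simp add: adjoint_mat_def)
  have real: "Im s = 0" if "cnj s = s" for s using that by (simp add: complex_eq_iff)
  show "Im (\<Sum>i\<in>UNIV. v $ i * cnj ((v v* H) $ i)) = 0"
  proof (rule real)
    have "(\<Sum>i\<in>UNIV. v $ i * cnj ((v v* H) $ i)) = (\<Sum>i\<in>UNIV. \<Sum>j\<in>UNIV. v $ i * cnj (v $ j) * H $ i $ j)"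
      by (simp add: vector_matrix_mult_def sum_distrib_left H mult.assoc)
    moreover have "cnj \<dots> = (\<Sum>i\<in>UNIV. \<Sum>j\<in>UNIV. v $ i * cnj (v $ j) * H $ i $ j)"
      by (subst sum.swap) (simp add: H mult_ac)
    ultimately show "cnj (\<Sum>i\<in>UNIV. v $ i * cnj ((v v* H) $ i)) = (\<Sum>i\<in>UNIV. v $ i * cnj ((v v* H) $ i))" by simp
  qed
  show "Im (\<Sum>i\<in>UNIV. v $ i * cnj ((H *v v) $ i)) = 0"
  proof (rule real)
    have "(\<Sum>i\<in>UNIV. v $ i * cnj ((H *v v) $ i)) = (\<Sum>i\<in>UNIV. \<Sum>j\<in>UNIV. v $ i * cnj (v $ j) * H $ j $ i)"
      by (simp add: matrix_vector_mult_def sum_distrib_left H mult_ac)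
    moreover have "cnj \<dots> = (\<Sum>i\<in>UNIV. \<Sum>j\<in>UNIV. v $ i * cnj (v $ j) * H $ j $ i)"
      by (subst sum.swap) (simp add: H mult_ac)
    ultimately show "cnj (\<Sum>i\<in>UNIV. v $ i * cnj ((H *v v) $ i)) = (\<Sum>i\<in>UNIV. v $ i * cnj ((H *v v) $ i))" by simp
  qed
qed

text \<open>For Hermitian \<open>H\<close> the disc \<open>l \<mapsto> (1 + l H)\<^sup>-\<^sup>1 (l + H)\<close> through \<open>H\<close> has unitary boundary values, where
  a contraction extending \<open>Z\<close> by a row cannot have a nonzero entry in that row below \<open>Z\<close>.\<close>

lemma extension_row_zero_hermitian:
  fixes F :: "complex^'r::finite^'r \<Rightarrow> complex^('r option)^('r option)"
  assumes F: "\<And>Z. Z \<in> type1_domain \<Longrightarrow> F Z \<in> type1_domain" and hol: "mat_holomorphic_on F type1_domain"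
    and ext: "\<And>Z i j. Z \<in> type1_domain \<Longrightarrow> F Z $ Some i $ Some j = Z $ i $ j"
    and H: "H \<in> type1_domain" "adjoint_mat H = H"
  shows "F H $ None $ Some j = 0"
proof -
  define N where "N l = mat 1 + cscale_mat l H" for l
  define R where "R l = cscale_mat l (mat 1) + H" for l
  have vN: "v v* N l = v + l *s (v v* H)" for v l
    by (simp add: N_def vector_matrix_mult_add_rdistrib)
       (simp add: vec_eq_iff vector_matrix_mult_def cscale_mat_def sum_distrib_left mult_ac)
  have vR: "v v* R l = l *s v + v v* H" for v l
  proof -
    have "v v* cscale_mat l (mat 1) = l *s (v v* mat 1)"
      by (simp only: vec_eq_iff vector_matrix_mult_def cscale_mat_def vec_lambda_beta sum_distrib_left
          vector_smult_component) (simp add: mult_ac)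
    then show ?thesis by (simp add: R_def vector_matrix_mult_add_rdistrib)
  qed
  have Nv: "N l *v v = v + l *s (H *v v)" for v l
    by (simp add: N_def matrix_vector_mult_add_rdistrib)
       (simp add: vec_eq_iff matrix_vector_mult_def cscale_mat_def sum_distrib_left mult_ac)
  have Rv: "R l *v v = l *s v + H *v v" for v l
  proof -
    have "cscale_mat l (mat 1) *v v = l *s (mat 1 *v v)"
      by (simp only: vec_eq_iff matrix_vector_mult_def cscale_mat_def vec_lambda_beta sum_distrib_left
          vector_smult_component) (simp add: mult_ac)
    then show ?thesis by (simp add: R_def matrix_vector_mult_add_rdistrib)
  qed
  have strict: "norm (v v* R l) < norm (v v* N l)" if "cmod l < 1" "v \<noteq> 0" for v l
  proof -
    have "(norm (v v* N l))\<^sup>2 - (norm (v v* R l))\<^sup>2 = (1 - (cmod l)\<^sup>2) * ((norm v)\<^sup>2 - (norm (v v* H))\<^sup>2)"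
      unfolding vN vR by (rule swap_norm_identity[OF hermitian_form_real(1)[OF H(2)]])
    also have "\<dots> > 0"
    proof (rule mult_pos_pos)
      show "0 < 1 - (cmod l)\<^sup>2" using that(1) by (simp add: power_less_one_iff abs_square_less_1)
      have "(norm (v v* H))\<^sup>2 < (norm v)\<^sup>2" using type1_domainD[OF H(1) that(2)] by (intro power_strict_mono) auto
      then show "0 < (norm v)\<^sup>2 - (norm (v v* H))\<^sup>2" by simp
    qed
    finally have "(norm (v v* R l))\<^sup>2 < (norm (v v* N l))\<^sup>2" by simp
    then show ?thesis by (rule power_less_imp_less_base) simp
  qed
  have inv: "invertible (N l)" if l: "cmod l < 1" for l
  proof (rule invertible_if_row_kernel_trivial)
    fix v assume "v v* N l = 0"
    then show "v = 0" using strict[OF l, of v] by (metis norm_ge_zero norm_zero not_less)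
  qed
  define Z where "Z l = matrix_inv (N l) ** R l" for l
  have NZ: "N l ** Z l = R l" if "cmod l < 1" for l
    using matrix_inv_inverse(2)[OF inv[OF that]] by (simp add: Z_def matrix_mul_assoc)
  have Zdom: "Z l \<in> type1_domain" if l: "cmod l < 1" for l
  proof (rule type1_domainI)
    fix v :: "complex^'r" assume v: "v \<noteq> 0"
    define w where "w = v v* matrix_inv (N l)"
    have wN: "w v* N l = v"
      using matrix_inv_inverse(1)[OF inv[OF l]] by (simp add: w_def vector_matrix_mul_assoc)
    then have "w \<noteq> 0" using v by auto
    have "v v* Z l = w v* R l" by (simp add: Z_def w_def vector_matrix_mul_assoc)
    then show "norm (v v* Z l) < norm v" using strict[OF l \<open>w \<noteq> 0\<close>] wN by simp
  qed
  \<comment> \<open>Both are affine in H. Commutation turns N Z = R into Z N = R, which describes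
    the action on columns, where the extra row of F is tested.\<close>
  have comm: "N l ** R l = R l ** N l" for l
  proof -
    have "v v* (N l ** R l) = v v* (R l ** N l)" for v
      unfolding vector_matrix_mul_assoc[symmetric] vN vR
      by (simp add: vector_matrix_left_distrib scalar_vector_matrix_assoc vec_eq_iff algebra_simps)
    then show ?thesis
      by (metis matrix_eq matrix_transpose_mul transpose_matrix_vector transpose_transpose)
  qed
  have ZN: "Z l *v (N l *v u) = R l *v u" if "cmod l < 1" for l u
  proof -
    have "Z l ** N l = matrix_inv (N l) ** (N l ** R l)" by (simp add: Z_def comm matrix_mul_assoc)
    also have "\<dots> = R l" using matrix_inv_inverse(1)[OF inv[OF that]] by (simp add: matrix_mul_assoc)
    finally show ?thesis by (simp add: matrix_vector_mul_assoc)
  qed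
  have row0: "(\<Sum>j\<in>UNIV. F H $ None $ Some j * u $ j) = 0" for u
  proof -
    \<comment> \<open>The last entry of F (Z l) applied to the column N l u padded by 0. The factor
      N l makes the defect |N u|^2 - |Z N u|^2 equal to (1 - |l|^2)(|u|^2 - |H u|^2), which tends to
      0 at the unit circle.\<close>
    define \<psi> where "\<psi> l = (\<Sum>j\<in>UNIV. F (Z l) $ None $ Some j * (N l *v u) $ j)" for l
    have bound: "(cmod (\<psi> l))\<^sup>2 \<le> (1 - (cmod l)\<^sup>2) * (norm u)\<^sup>2" if l: "cmod l < 1" for l
    proof -
      define b where "b = N l *v u"
      define w :: "complex^('r option)" where "w = (\<chi> k. case k of None \<Rightarrow> 0 | Some j \<Rightarrow> b $ j)"
      have nw: "(norm w)\<^sup>2 = (norm b)\<^sup>2" by (simp add: norm_vec_sq sum_option w_def)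
      have "(F (Z l) *v w) $ None = \<psi> l"
        by (simp add: matrix_vector_mult_def sum_option w_def \<psi>_def b_def)
      moreover have "(F (Z l) *v w) $ Some i = (Z l *v b) $ i" for i
        by (simp add: matrix_vector_mult_def sum_option w_def ext[OF Zdom[OF l]])
      ultimately have "(norm (F (Z l) *v w))\<^sup>2 = (cmod (\<psi> l))\<^sup>2 + (norm (Z l *v b))\<^sup>2"
        unfolding norm_vec_sq[of "F (Z l) *v w"] sum_option by (simp add: norm_vec_sq)
      moreover have "(norm (F (Z l) *v w))\<^sup>2 \<le> (norm w)\<^sup>2"
        using type1_domain_column_le[OF F[OF Zdom[OF l]]] by (intro power_mono) auto
      ultimately have "(cmod (\<psi> l))\<^sup>2 \<le> (norm b)\<^sup>2 - (norm (Z l *v b))\<^sup>2" using nw by simp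
      also have "\<dots> = (1 - (cmod l)\<^sup>2) * ((norm u)\<^sup>2 - (norm (H *v u))\<^sup>2)"
      proof -
        have b: "b = u + l *s (H *v u)" by (simp add: b_def Nv)
        have Zb: "Z l *v b = l *s u + H *v u" using ZN[OF l, of u] by (simp add: b_def Rv)
        show ?thesis unfolding Zb unfolding b by (rule swap_norm_identity[OF hermitian_form_real(2)[OF H(2)]])
      qed
      also have "\<dots> \<le> (1 - (cmod l)\<^sup>2) * (norm u)\<^sup>2"
      proof (rule mult_left_mono)
        show "0 \<le> 1 - (cmod l)\<^sup>2" using l by (simp add: power_le_one)
      qed simp
      finally show ?thesis .
    qed
    have hol\<psi>: "\<psi> holomorphic_on ball 0 1"
    proof (rule cdiff_at_imp_holomorphic)
      fix l :: complex assume l: "l \<in> ball 0 1"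
      have Nent: "cdiff_at (*) (*) (\<lambda>l. N l $ i $ j) l" for i j
        unfolding N_def by (simp add: cscale_mat_def, intro cdiff_at_intros cdiff_at_ident)
      have Zc: "cdiff_at (*) (*) (\<lambda>l. Z l $ i $ j) l" for i j
      proof -
        have "cdiff_at (*) (*) (\<lambda>l. (\<chi> i. Z l $ i $ j) $ i) l"
        proof (rule cdiff_at_solve[OF open_ball l Nent])
          show "cdiff_at (*) (*) (\<lambda>l. (\<chi> i. R l $ i $ j) $ i) l" for i
            unfolding R_def by (simp add: cscale_mat_def, intro cdiff_at_intros cdiff_at_ident)
          show "det (N u) \<noteq> 0" if "u \<in> ball 0 1" for u
            using inv[of u] that by (simp add: invertible_det_nz)
          show "N u *v (\<chi> i. Z u $ i $ j) = (\<chi> i. R u $ i $ j)" if "u \<in> ball 0 1" for u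
            using NZ[of u] that by (simp add: vec_eq_iff matrix_matrix_mult_def matrix_vector_mult_def)
        qed
        then show ?thesis by simp
      qed
      have "cdiff_at (*) cscale_mat Z l" by (rule cdiff_at_matI[OF Zc])
      moreover have "cdiff_at cscale_mat cscale_mat F (Z l)"
        using hol Zdom l by (simp add: mat_holomorphic_on_iff)
      ultimately have "cdiff_at (*) cscale_mat (\<lambda>l. F (Z l)) l" by (rule cdiff_at_compose)
      then have "cdiff_at (*) (*) (\<lambda>l. F (Z l) $ i $ j) l" for i j by (rule cdiff_at_mat_entry)
      moreover have "cdiff_at (*) (*) (\<lambda>l. (N l *v u) $ j) l" for j
        unfolding matrix_vector_mult_def by (simp, intro cdiff_at_intros Nent)
      ultimately show "cdiff_at (*) (*) \<psi> l"
        unfolding \<psi>_def by (intro cdiff_at_sum cdiff_at_mult)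
    qed
    have le: "(cmod (\<psi> 0))\<^sup>2 \<le> (1 - r\<^sup>2) * (norm u)\<^sup>2" if r: "0 < r" "r < 1" for r
    proof -
      have "(1 - r\<^sup>2) * (norm u)\<^sup>2 \<ge> 0" using r by (simp add: power_le_one)
      \<comment> \<open>The Cauchy estimate of order 0 is the maximum principle on the circle of
        radius r.\<close>
      have "norm ((deriv ^^ 0) \<psi> 0) \<le> fact 0 * sqrt ((1 - r\<^sup>2) * (norm u)\<^sup>2) / r ^ 0"
      proof (rule Cauchy_inequality)
        show "\<psi> holomorphic_on ball 0 r" by (rule holomorphic_on_subset[OF hol\<psi>]) (use r in auto)
        have "cball 0 r \<subseteq> ball (0::complex) 1" using r by auto
        then show "continuous_on (cball 0 r) \<psi>"
          by (meson hol\<psi> holomorphic_on_imp_continuous_on continuous_on_subset)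
        show "norm (\<psi> x) \<le> sqrt ((1 - r\<^sup>2) * (norm u)\<^sup>2)" if "norm (0 - x) = r" for x
          using bound[of x] that r by (intro real_le_rsqrt) simp
      qed (use r in auto)
      then have "cmod (\<psi> 0) \<le> sqrt ((1 - r\<^sup>2) * (norm u)\<^sup>2)" by simp
      then have "(cmod (\<psi> 0))\<^sup>2 \<le> (sqrt ((1 - r\<^sup>2) * (norm u)\<^sup>2))\<^sup>2" by (intro power_mono) auto
      then show ?thesis using \<open>(1 - r\<^sup>2) * (norm u)\<^sup>2 \<ge> 0\<close> by simp
    qed
    have "\<psi> 0 = 0"
    proof (rule ccontr)
      assume "\<psi> 0 \<noteq> 0"
      define t K where "t = (cmod (\<psi> 0))\<^sup>2" and "K = (norm u)\<^sup>2"
      have t: "t > 0" using \<open>\<psi> 0 \<noteq> 0\<close> by (simp add: t_def)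
      have "t \<le> 3/4 * K" using le[of "1/2"] by (simp add: t_def K_def power2_eq_square)
      then have K: "K > t" using t by linarith
      \<comment> \<open>This radius makes 1 - r^2 = t / (2 K), hence t \<le> t / 2. That it lies
        between 0 and 1 uses K > t, which came from the radius 1/2.\<close>
      define r where "r = sqrt (1 - t / (2 * K))"
      have q: "0 < t / (2 * K)" "t / (2 * K) < 1" using t K by (auto simp: divide_simps)
      then have "0 < r" "r < 1" "r\<^sup>2 = 1 - t / (2 * K)" by (auto simp: r_def)
      then have "t \<le> t / (2 * K) * K" using le[of r] by (simp add: t_def K_def)
      then show False using t K by simp
    qed
    moreover have "N 0 = mat 1" by (simp add: N_def cscale_mat_def vec_eq_iff)
    moreover have "Z 0 = H"
    proof -
      have "R 0 = H" by (simp add: R_def cscale_mat_def vec_eq_iff)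
      then show ?thesis using NZ[of 0] \<open>N 0 = mat 1\<close> by simp
    qed
    ultimately show ?thesis by (simp add: \<psi>_def)
  qed
  have "(\<Sum>k\<in>UNIV. F H $ None $ Some k * axis j 1 $ k) = F H $ None $ Some j"
    by (simp add: axis_def if_distrib[of "(*) _"] cong: if_cong)
  then show ?thesis using row0[of "axis j 1"] by simp
qed

text \<open>Hermitian matrices form a totally real subspace of maximal dimension.\<close>

lemma extension_row_zero:
  fixes F :: "complex^'r::finite^'r \<Rightarrow> complex^('r option)^('r option)"
  assumes F: "\<And>Z. Z \<in> type1_domain \<Longrightarrow> F Z \<in> type1_domain" and hol: "mat_holomorphic_on F type1_domain"
    and ext: "\<And>Z i j. Z \<in> type1_domain \<Longrightarrow> F Z $ Some i $ Some j = Z $ i $ j"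
    and Z: "Z \<in> type1_domain"
  shows "F Z $ None $ Some j = 0"
proof -
  define H1 where "H1 = (1/2) *\<^sub>R Z + (1/2) *\<^sub>R adjoint_mat Z"
  define H2 where "H2 = cscale_mat (- \<i> / 2) (Z - adjoint_mat Z)"
  have H1e: "H1 $ i $ j = (Z $ i $ j + cnj (Z $ j $ i)) / 2" for i j
    unfolding H1_def vector_add_component vector_scaleR_component adjoint_mat_def vec_lambda_beta
    by (simp add: scaleR_conv_of_real)
  have h1: "adjoint_mat H1 = H1"
    by (simp add: adjoint_mat_def vec_eq_iff H1e add.commute)
  have h2: "adjoint_mat H2 = H2"
    by (simp add: H2_def adjoint_mat_def cscale_mat_def vec_eq_iff algebra_simps)
  have Zeq: "H1 + cscale_mat \<i> H2 = Z"
    by (simp add: H1e H2_def adjoint_mat_def cscale_mat_def vec_eq_iff) (simp add: field_simps)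
  have H1: "H1 \<in> type1_domain"
    unfolding H1_def by (rule convexD[OF convex_type1_domain Z adjoint_in_type1_domain[OF Z]]) auto
  define S where "S = {\<zeta>. H1 + cscale_mat \<zeta> H2 \<in> type1_domain}"
  have cd: "cdiff_at cscale_mat (*) (\<lambda>Z. F Z $ None $ Some j) x" if "x \<in> type1_domain" for x
    using hol that by (auto simp: mat_holomorphic_on_iff intro: cdiff_at_mat_entry)
  note line = holomorphic_on_line[OF complex_scaling_mat open_type1_domain convex_type1_domain cd, where x = H1 and d = H2,
      folded S_def]
  \<comment> \<open>On the complex line H1 + \<zeta> H2, real \<zeta> give Hermitian matrices, where
    the entry vanishes, and \<zeta> = \<i> gives Z.\<close>
  have "F (H1 + cscale_mat \<i> H2) $ None $ Some j = 0"
  proof (rule analytic_continuation[OF line(3,1,2), where U = "S \<inter> \<real>" and \<xi> = 0])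
    have "cscale_mat 0 H2 = 0" by (simp add: cscale_mat_def vec_eq_iff)
    then show "0 \<in> S" using H1 by (simp add: S_def)
    then obtain e where e: "e > 0" "ball 0 e \<subseteq> S" using line(1) open_contains_ball by blast
    show "0 islimpt S \<inter> \<real>"
      unfolding islimpt_approachable
    proof (intro allI impI)
      fix d :: real assume "d > 0"
      define x where "x = complex_of_real (min d e / 2)"
      have "x \<noteq> 0" "cmod x < d" "cmod x < e" using \<open>d > 0\<close> e(1) by (auto simp: x_def)
      then show "\<exists>x'\<in>S \<inter> \<real>. x' \<noteq> 0 \<and> dist x' 0 < d"
        using e(2) by (intro bexI[of _ x]) (auto simp: x_def)
    qed
    show "F (H1 + cscale_mat \<zeta> H2) $ None $ Some j = 0" if \<zeta>: "\<zeta> \<in> S \<inter> \<real>" for \<zeta>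
    proof (rule extension_row_zero_hermitian[OF F hol ext])
      show "H1 + cscale_mat \<zeta> H2 \<in> type1_domain" using \<zeta> by (simp add: S_def)
      have "cnj (H1 $ j $ i) = H1 $ i $ j" "cnj (H2 $ j $ i) = H2 $ i $ j" for i j
        using arg_cong[OF h1, of "\<lambda>M. M $ i $ j"] arg_cong[OF h2, of "\<lambda>M. M $ i $ j"] by (simp_all add: adjoint_mat_def)
      moreover have "cnj \<zeta> = \<zeta>" using \<zeta> by (simp add: Reals_cnj_iff)
      ultimately show "adjoint_mat (H1 + cscale_mat \<zeta> H2) = H1 + cscale_mat \<zeta> H2"
        by (simp add: adjoint_mat_def cscale_mat_def vec_eq_iff)
    qed
    show "\<i> \<in> S" using Zeq Z by (simp add: S_def)
  qed auto
  then show ?thesis by (simp add: Zeq)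
qed

section \<open>The indefinite Hermitian form and Witt extension\<close>

definition hform :: "complex^('r::finite + 's::finite) \<Rightarrow> complex^('r + 's) \<Rightarrow> complex" where
  "hform u v = (\<Sum>i\<in>UNIV. u $ Inl i * cnj (v $ Inl i)) - (\<Sum>j\<in>UNIV. u $ Inr j * cnj (v $ Inr j))"

lemma hform_add_left: "hform (u + v) w = hform u w + hform v w"
  by (simp add: hform_def algebra_simps sum.distrib)
lemma hform_add_right: "hform u (v + w) = hform u v + hform u w"
  by (simp add: hform_def algebra_simps sum.distrib)
lemma hform_diff_left: "hform (u - v) w = hform u w - hform v w"
  by (simp add: hform_def algebra_simps sum_subtractf)
lemma hform_cmult_left: "hform (c *s u) v = c * hform u v"
  by (simp add: hform_def algebra_simps sum_distrib_left)
lemma hform_cmult_right: "hform u (c *s v) = cnj c * hform u v"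
  by (simp add: hform_def algebra_simps sum_distrib_left)
lemma hform_cnj: "cnj (hform u v) = hform v u"
  by (simp add: hform_def mult.commute)
lemma hform_zero_left [simp]: "hform 0 v = 0" by (simp add: hform_def)
lemma hform_sum_left: "hform (\<Sum>i\<in>I. u i) v = (\<Sum>i\<in>I. hform (u i) v)"
  by (induction I rule: infinite_finite_induct) (auto simp: hform_add_left)

lemma hform_self: "hform u u = complex_of_real (nform u)"
  unfolding hform_def nform_sums of_real_diff of_real_sum complex_norm_square by simp

lemma nform_add: "nform (u + v) = nform u + nform v + 2 * Re (hform u v)"
proof -
  have "complex_of_real (nform (u + v)) = hform u u + hform v v + (hform u v + cnj (hform u v))"
    unfolding hform_self[symmetric] by (simp add: hform_add_left hform_add_right hform_cnj)
  also have "\<dots> = complex_of_real (nform u + nform v + 2 * Re (hform u v))"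
    by (simp add: hform_self complex_add_cnj)
  finally show ?thesis by (simp only: of_real_eq_iff)
qed

lemma hform_polarization:
  "hform u v = (complex_of_real (nform (u + v) - nform u - nform v)
     + \<i> * complex_of_real (nform (u + \<i> *s v) - nform u - nform (\<i> *s v))) / 2"
proof -
  have 1: "nform (u + v) - nform u - nform v = 2 * Re (hform u v)" by (simp add: nform_add)
  have 2: "nform (u + \<i> *s v) - nform u - nform (\<i> *s v) = 2 * Im (hform u v)"
    by (simp add: nform_add hform_cmult_right)
  show ?thesis unfolding 1 2 by (simp add: complex_eq_iff)
qed

definition sg :: "'a + 'b \<Rightarrow> complex" where
  "sg a = (case a of Inl _ \<Rightarrow> 1 | Inr _ \<Rightarrow> -1)"

lemma sg_simps [simp]: "sg (Inl i) = 1" "sg (Inr j) = -1" "sg a * sg a = 1" "cnj (sg a) = sg a"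
  by (auto simp: sg_def split: sum.splits)

lemma sum_plus: "(\<Sum>k\<in>(UNIV :: ('a::finite + 'b::finite) set). f k) = (\<Sum>i\<in>UNIV. f (Inl i)) + (\<Sum>j\<in>UNIV. f (Inr j))"
  unfolding UNIV_sum by (subst sum.union_disjoint) (auto simp: sum.reindex)

lemma hform_sg: "hform u v = (\<Sum>k\<in>UNIV. sg k * u $ k * cnj (v $ k))"
  by (simp add: hform_def sum_plus sum_negf)

lemma vector_matrix_sum_rows: "z v* M = (\<Sum>a\<in>UNIV. z $ a *s M $ a)"
  by (simp add: vec_eq_iff vector_matrix_mult_def)

text \<open>By polarization, preserving \<open>nform\<close> means preserving \<open>hform\<close>;
  the rows of M are the images of the standard basis.\<close>

lemma gram_of_isometry:
  fixes M :: "complex^('p::finite + 'q::finite)^('r::finite + 's::finite)"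
  assumes "\<And>z. nform (z v* M) = nform z"
  shows "hform (M $ a) (M $ b) = (if a = b then sg a else 0)"
proof -
  have ax: "axis a 1 v* M = M $ a" for a
    by (simp add: vec_eq_iff vector_matrix_mult_def axis_def if_distrib[of "\<lambda>x. x * _"] cong: if_cong)
  have "hform (u v* M) (v v* M) = hform u v" for u v
  proof -
    have "u v* M + v v* M = (u + v) v* M" "u v* M + \<i> *s (v v* M) = (u + \<i> *s v) v* M"
      "\<i> *s (v v* M) = (\<i> *s v) v* M"
      by (simp_all add: vector_matrix_left_distrib scalar_vector_matrix_assoc)
    then show ?thesis unfolding hform_polarization[of "u v* M"] hform_polarization[of u] by (simp only: assms)
  qed
  from this[of "axis a 1" "axis b 1"] have "hform (M $ a) (M $ b) = hform (axis a 1) (axis b 1)"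
    unfolding ax .
  also have "\<dots> = (if a = b then sg a else 0)"
    by (simp add: hform_sg axis_def if_distrib[of "\<lambda>x. _ * x"] if_distrib[of cnj] cong: if_cong)
  finally show ?thesis .
qed

lemma isometry_of_gram:
  fixes M :: "complex^('p::finite + 'q::finite)^('r::finite + 's::finite)"
  assumes "\<And>a b. hform (M $ a) (M $ b) = (if a = b then sg a else 0)"
  shows "nform (z v* M) = nform z"
proof -
  have r: "hform (M $ a) (z v* M) = cnj (z $ a) * sg a" for a
  proof -
    have "hform (M $ a) (z v* M) = cnj (hform (z v* M) (M $ a))" by (simp add: hform_cnj)
    also have "hform (z v* M) (M $ a) = z $ a * sg a"
      unfolding vector_matrix_sum_rows hform_sum_left
      by (simp add: hform_cmult_left assms if_distrib[of "\<lambda>x. _ * x"] cong: if_cong)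
    finally show ?thesis by simp
  qed
  have "complex_of_real (nform (z v* M)) = (\<Sum>a\<in>UNIV. z $ a * hform (M $ a) (z v* M))"
    unfolding hform_self[symmetric]
    by (subst (1) vector_matrix_sum_rows) (simp add: hform_sum_left hform_cmult_left)
  also have "\<dots> = (\<Sum>a\<in>UNIV. sg a * z $ a * cnj (z $ a))" unfolding r by (simp add: mult_ac)
  also have "\<dots> = hform z z" by (rule hform_sg[symmetric])
  finally show ?thesis by (simp add: hform_self)
qed

text \<open>Padding the r equations by a zero row gives a singular square matrix, whose kernel is
  nontrivial.\<close>

lemma underdetermined_system:
  fixes b :: "'r::finite \<Rightarrow> complex^('r option)"
  obtains x where "x \<noteq> 0" "\<And>i. (\<Sum>k\<in>UNIV. b i $ k * x $ k) = 0"
proof -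
  define N :: "complex^('r option)^('r option)" where "N = (\<chi> k. case k of None \<Rightarrow> 0 | Some i \<Rightarrow> b i)"
  have "row None N = 0" by (simp add: row_def N_def vec_eq_iff)
  then have "det N = 0" by (rule det_zero_row(2))
  then have "\<not> invertible N" by (simp add: invertible_det_nz)
  then have "\<not> (\<forall>x. N *v x = 0 \<longrightarrow> x = 0)"
    by (metis invertible_left_inverse matrix_left_invertible_ker)
  then obtain x where x: "N *v x = 0" "x \<noteq> 0" by blast
  have "(\<Sum>k\<in>UNIV. b i $ k * x $ k) = (N *v x) $ Some i" for i
    by (simp add: matrix_vector_mult_def N_def)
  with x that show thesis by simp
qed

text \<open>\<open>pr v\<close> lists the coordinates of the orthogonal projection to the span of
  the rows; the factor \<open>sg a\<close> appears because the rows have norms 1 and -1. The second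
  claim is Pythagoras.\<close>

lemma projection_off_isometry:
  fixes M :: "complex^('p::finite + 'q::finite)^('r::finite + 's::finite)"
  assumes iso: "\<And>z. nform (z v* M) = nform z"
  defines "pr v \<equiv> (\<chi> a. sg a * hform v (M $ a))"
  shows "hform (v - pr v v* M) (M $ a) = 0" "nform (v - pr v v* M) = nform v - nform (pr v)"
proof -
  note gram = gram_of_isometry[OF iso]
  show orth: "hform (v - pr v v* M) (M $ a) = 0" for a
  proof -
    have "hform (pr v v* M) (M $ a) = pr v $ a * sg a"
      unfolding vector_matrix_sum_rows hform_sum_left
      by (simp add: hform_cmult_left gram if_distrib[of "\<lambda>x. _ * x"] cong: if_cong)
    also have "\<dots> = (sg a * sg a) * hform v (M $ a)" by (simp only: pr_def vec_lambda_beta mult_ac)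
    finally show ?thesis by (simp add: hform_diff_left)
  qed
  have "hform (pr v v* M) (v - pr v v* M) = 0"
  proof -
    have "hform (M $ a) (v - pr v v* M) = 0" for a using orth[of a] hform_cnj[of "v - pr v v* M" "M $ a"] by simp
    then show ?thesis unfolding vector_matrix_sum_rows[of "pr v" M] hform_sum_left by (simp add: hform_cmult_left vector_matrix_sum_rows[symmetric])
  qed
  then show "nform (v - pr v v* M) = nform v - nform (pr v)"
    using nform_add[of "pr v v* M" "v - pr v v* M"] by (simp add: iso)
qed

text \<open>Witt extension of an isometric embedding of signature \<open>(r, r)\<close> into signature \<open>(r + 1, r + 1)\<close>.\<close>

lemma isometry_extension:
  fixes M :: "complex^('r::finite option + 'r option)^('r + 'r)"
  assumes iso: "\<And>z. nform (z v* M) = nform z"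
  obtains T :: "complex^('r option + 'r option)^('r option + 'r option)"
  where "\<And>z. nform (z v* T) = nform z" "\<And>i. T $ Inl (Some i) = M $ Inl i" "\<And>j. T $ Inr (Some j) = M $ Inr j"
proof -
  note gram = gram_of_isometry[OF iso]
  define pr where "pr v = (\<chi> a. sg a * hform v (M $ a))" for v
  note proj = projection_off_isometry[OF iso, folded pr_def]
  have norm_pos: "(norm x)\<^sup>2 > 0" if "x \<noteq> 0" for x :: "complex^('r option)" using that by simp
  \<comment> \<open>The r equations say that (x, 0) is orthogonal to the left halves of the positive
    rows. Its projection then has only negative coordinates, so removing it increases the form |x|^2
    > 0.\<close>
  obtain x :: "complex^('r option)" where x: "x \<noteq> 0" "\<And>i. (\<Sum>k\<in>UNIV. cnj (M $ Inl i $ Inl k) * x $ k) = 0"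
    using underdetermined_system[of "\<lambda>i. \<chi> k. cnj (M $ Inl i $ Inl k)"] by auto
  define w0 where "w0 = vjoin x 0 - pr (vjoin x 0) v* M"
  have "vleft (pr (vjoin x 0)) = 0"
    using x(2) by (simp add: vec_eq_iff pr_def hform_def mult.commute)
  then have w0: "nform w0 > 0"
    using norm_pos[OF x(1)] unfolding w0_def proj(2) by (simp add: nform_def add_pos_nonneg)
  have w0M: "hform w0 (M $ a) = 0" for a unfolding w0_def by (rule proj(1))
  define wp where "wp = complex_of_real (1 / sqrt (nform w0)) *s w0"
  have wpp: "nform wp = 1" using w0 by (simp add: wp_def nform_cmult power_divide norm_divide)
  have wpM: "hform wp (M $ a) = 0" for a by (simp add: wp_def hform_cmult_left w0M)
  obtain y :: "complex^('r option)" where y: "y \<noteq> 0" "\<And>i. (\<Sum>k\<in>UNIV. cnj (M $ Inr i $ Inr k) * y $ k) = 0"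
    using underdetermined_system[of "\<lambda>i. \<chi> k. cnj (M $ Inr i $ Inr k)"] by auto
  define u where "u = vjoin 0 y - pr (vjoin 0 y) v* M"
  have "vright (pr (vjoin 0 y)) = 0"
    using y(2) by (simp add: vec_eq_iff pr_def hform_def mult.commute)
  then have u: "nform u < 0"
  proof -
    have e: "nform (vjoin 0 y) = - (norm y)\<^sup>2" "nform (pr (vjoin 0 y)) = (norm (vleft (pr (vjoin 0 y))))\<^sup>2"
      using \<open>vright (pr (vjoin 0 y)) = 0\<close> by (simp_all add: nform_def)
    show ?thesis
      unfolding u_def proj(2) e using norm_pos[OF y(1)] zero_le_power2[of "norm (vleft (pr (vjoin 0 y)))"] by linarith
  qed
  have uM: "hform u (M $ a) = 0" for a unfolding u_def by (rule proj(1))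
  \<comment> \<open>A Gram-Schmidt step against the positive vector \<open>wp\<close>; it can only
    lower the form, so the vector stays negative.\<close>
  define u1 where "u1 = u - hform u wp *s wp"
  have u1M: "hform u1 (M $ a) = 0" for a by (simp add: u1_def hform_diff_left hform_cmult_left uM wpM)
  have u1p: "hform u1 wp = 0" by (simp add: u1_def hform_diff_left hform_cmult_left hform_self wpp)
  have "hform (hform u wp *s wp) u1 = 0" using u1p hform_cnj[of u1 wp] by (simp add: hform_cmult_left)
  then have "nform u = (cmod (hform u wp))\<^sup>2 + nform u1"
    using nform_add[of "hform u wp *s wp" u1] by (simp add: u1_def nform_cmult wpp)
  moreover have "(cmod (hform u wp))\<^sup>2 \<ge> 0" by simp
  ultimately have u1: "nform u1 < 0" using u by linarith
  define wm where "wm = complex_of_real (1 / sqrt (- nform u1)) *s u1"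
  have wmm: "nform wm = -1" using u1 by (simp add: wm_def nform_cmult power_divide norm_divide)
  have wmM: "hform wm (M $ a) = 0" and wmp: "hform wm wp = 0" for a
    by (simp_all add: wm_def hform_cmult_left u1M u1p)
  have sym: "hform (M $ a) wp = 0" "hform (M $ a) wm = 0" "hform wp wm = 0" for a
    using hform_cnj[of wp "M $ a"] hform_cnj[of wm "M $ a"] hform_cnj[of wm wp] wpM wmM wmp by simp_all
  define T :: "complex^('r option + 'r option)^('r option + 'r option)" where
    "T = (\<chi> a. case a of Inl None \<Rightarrow> wp | Inl (Some i) \<Rightarrow> M $ Inl i | Inr None \<Rightarrow> wm | Inr (Some j) \<Rightarrow> M $ Inr j)"
  have self: "hform wp wp = 1" "hform wm wm = -1" by (simp_all add: hform_self wpp wmm)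
  have "hform (T $ a) (T $ b) = (if a = b then sg a else 0)" for a b
    by (auto simp: T_def gram sym wpM wmM wmp self split: sum.splits option.splits)
  then have "nform (z v* T) = nform z" for z by (rule isometry_of_gram)
  then show thesis by (rule that) (simp_all add: T_def)
qed

lemma isometry_inverse:
  fixes T :: "complex^('n::finite + 'n)^('n + 'n)"
  assumes iso: "\<And>z. nform (z v* T) = nform z"
  obtains S where "T ** S = mat 1" "S ** T = mat 1" "\<And>z. nform (z v* S) = nform z"
proof -
  \<comment> \<open>The inverse of an isometry is J T' J, where T' is the adjoint of T and J the
    diagonal matrix of signs.\<close>
  define S :: "complex^('n + 'n)^('n + 'n)" where "S = (\<chi> k a. sg k * cnj (T $ a $ k) * sg a)"
  have "(T ** S) $ a $ b = (if a = b then 1 else 0)" for a b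
  proof -
    have "(T ** S) $ a $ b = hform (T $ a) (T $ b) * sg b"
      unfolding matrix_matrix_mult_def S_def hform_sg sum_distrib_right by (simp add: mult_ac)
    then show ?thesis by (simp add: gram_of_isometry[OF iso])
  qed
  then have TS: "T ** S = mat 1" by (simp add: vec_eq_iff mat_def)
  then have ST: "S ** T = mat 1" by (simp add: matrix_left_right_inverse)
  have "nform (z v* S) = nform z" for z
    using iso[of "z v* S"] by (simp add: vector_matrix_mul_assoc ST)
  with TS ST that show thesis by blast
qed

section \<open>Block form of a map induced by an isometry\<close>

definition blockLL :: "complex^('n::finite + 'n)^('n + 'n) \<Rightarrow> complex^'n^'n" where
  "blockLL T = (\<chi> i j. T $ Inl i $ Inl j)"
definition blockLR :: "complex^('n::finite + 'n)^('n + 'n) \<Rightarrow> complex^'n^'n" where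
  "blockLR T = (\<chi> i j. T $ Inl i $ Inr j)"
definition blockRL :: "complex^('n::finite + 'n)^('n + 'n) \<Rightarrow> complex^'n^'n" where
  "blockRL T = (\<chi> i j. T $ Inr i $ Inl j)"
definition blockRR :: "complex^('n::finite + 'n)^('n + 'n) \<Rightarrow> complex^'n^'n" where
  "blockRR T = (\<chi> i j. T $ Inr i $ Inr j)"

lemmas block_defs = blockLL_def blockLR_def blockRL_def blockRR_def

lemma vjoin_mult_blocks:
  "vleft (vjoin u v v* T) = u v* blockLL T + v v* blockRL T"
  "vright (vjoin u v v* T) = u v* blockLR T + v v* blockRR T"
  by (simp_all add: vec_eq_iff vector_matrix_mult_def block_defs sum_plus)

lemma block_inverse:
  assumes "T ** S = mat 1"
  shows "blockLL T ** blockLL S + blockLR T ** blockRL S = mat 1"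
    "blockLL T ** blockLR S + blockLR T ** blockRR S = 0"
    "blockRL T ** blockLL S + blockRR T ** blockRL S = 0"
    "blockRL T ** blockLR S + blockRR T ** blockRR S = mat 1"
proof -
  have e: "(\<Sum>k\<in>UNIV. T $ a $ Inl k * S $ Inl k $ b) + (\<Sum>k\<in>UNIV. T $ a $ Inr k * S $ Inr k $ b) = (if a = b then 1 else 0)" for a b
    using arg_cong[OF assms, of "\<lambda>M. M $ a $ b"] by (simp add: matrix_matrix_mult_def sum_plus mat_def)
  show "blockLL T ** blockLL S + blockLR T ** blockRL S = mat 1"
    "blockLL T ** blockLR S + blockLR T ** blockRR S = 0"
    "blockRL T ** blockLL S + blockRR T ** blockRL S = 0"
    "blockRL T ** blockLR S + blockRR T ** blockRR S = mat 1"
    by (simp_all add: vec_eq_iff matrix_matrix_mult_def block_defs e mat_def)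
qed

lemma pseudo_unitary_blocks:
  assumes "\<And>z. nform (z v* T) = nform z"
  shows "pseudo_unitary (blockLL T) (blockLR T) (blockRL T) (blockRR T)"
  unfolding pseudo_unitary_def
proof (intro allI)
  fix u v
  show "(norm (u v* blockLL T + v v* blockRL T))\<^sup>2 - (norm (u v* blockLR T + v v* blockRR T))\<^sup>2 = (norm u)\<^sup>2 - (norm v)\<^sup>2"
    using assms[of "vjoin u v"] by (simp add: nform_def vjoin_mult_blocks)
qed

lemma id_automorphism: "(\<lambda>Z. Z) \<in> automorphisms type1_domain"
proof (rule automorphismI[where \<psi> = "\<lambda>Z. Z"])
  show "mat_holomorphic_on (\<lambda>Z. Z) type1_domain"
    unfolding mat_holomorphic_on_iff by (intro conjI ballI cdiff_at_matI cdiff_at_entry open_type1_domain)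
  then show "mat_holomorphic_on (\<lambda>Z. Z) type1_domain" .
qed auto

lemma peval_linear:
  fixes p :: "('n::finite, complex) mpolynomial"
  assumes "homogeneous 1 p"
  shows "peval p z = (\<Sum>a\<in>UNIV. z $ a * lookup p (sv a))"
proof -
  have "m \<in> range sv" if "m \<in> keys p" for m
  proof -
    have "exp_sum m = 1" using assms that by (auto simp: homogeneous_def)
    then show ?thesis by (rule exp_sum_1) blast
  qed
  then have "peval p z = (\<Sum>m\<in>range sv. lookup p m * mon m z)"
    by (intro peval_superset) auto
  also have "\<dots> = (\<Sum>a\<in>UNIV. z $ a * lookup p (sv a))"
    by (subst sum.reindex) (auto simp: inj_on_def mon_sv mult.commute)
  finally show ?thesis .
qed

lemma linear_case:
  fixes f :: "complex^'r::finite^'r \<Rightarrow> complex^('r option)^('r option)"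
    and g :: "'r option + 'r option \<Rightarrow> ('r + 'r, complex) mpolynomial"
  assumes f: "f ` type1_domain \<subseteq> type1_domain" "mat_holomorphic_on f type1_domain"
    and c: "c > 0" and g: "\<And>z. nform (pmap g z) = c * nform z" "\<And>k. homogeneous 1 (g k)"
    and rel: "\<And>Z A. Z \<in> type1_domain \<Longrightarrow> A \<noteq> 0 \<Longrightarrow>
      vleft (pmap g (vjoin A (A v* Z))) v* f Z = vright (pmap g (vjoin A (A v* Z)))"
  shows "\<exists>h. fun_holomorphic_on h type1_domain \<and> h ` type1_domain \<subseteq> {z. cmod z < 1} \<and>
            equivalent_maps type1_domain type1_domain f (block_map h)"
proof -
  define s where "s = complex_of_real (1 / sqrt c)"
  have s: "s \<noteq> 0" "(cmod s)\<^sup>2 * c = 1" using c by (simp_all add: s_def power_divide norm_divide)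
  define M :: "complex^('r option + 'r option)^('r + 'r)" where "M = (\<chi> a k. s * lookup (g k) (sv a))"
  have M: "z v* M = s *s pmap g z" for z
    by (simp add: vec_eq_iff vector_matrix_mult_def M_def peval_linear[OF g(2)] sum_distrib_left mult_ac)
  have "nform (z v* M) = nform z" for z
    using s(2) by (simp add: M nform_cmult g(1) flip: mult.assoc)
  then obtain T where T: "\<And>z. nform (z v* T) = nform z" "\<And>i. T $ Inl (Some i) = M $ Inl i" "\<And>j. T $ Inr (Some j) = M $ Inr j"
    using isometry_extension by blast
  obtain S where S: "T ** S = mat 1" "S ** T = mat 1" "\<And>z. nform (z v* S) = nform z"
    using isometry_inverse[OF T(1)] by blast
  define \<Phi> where "\<Phi> = moebius (blockLL T) (blockLR T) (blockRL T) (blockRR T)"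
  define \<Psi> where "\<Psi> = moebius (blockLL S) (blockLR S) (blockRL S) (blockRR S)"
  note puT = pseudo_unitary_blocks[OF T(1)] and puS = pseudo_unitary_blocks[OF S(3)]
  have \<Phi>: "\<Phi> \<in> automorphisms type1_domain"
    unfolding \<Phi>_def by (rule moebius_automorphism[OF puT puS block_inverse[OF S(1)] block_inverse[OF S(2)]])
  have \<Phi>\<Psi>: "\<Phi> (\<Psi> W) = W" if "W \<in> type1_domain" for W
    unfolding \<Phi>_def \<Psi>_def by (rule moebius_inverse[OF puS puT that block_inverse[OF S(2)]])
  define F where "F Z = \<Psi> (f Z)" for Z
  have fdom: "f Z \<in> type1_domain" if "Z \<in> type1_domain" for Z using f(1) that by auto
  have Fdom: "F Z \<in> type1_domain" if "Z \<in> type1_domain" for Z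
    unfolding F_def \<Psi>_def by (rule moebius_in_domain[OF puS fdom[OF that]])
  have Fhol: "mat_holomorphic_on F type1_domain"
    unfolding mat_holomorphic_on_iff
  proof (intro conjI ballI open_type1_domain)
    fix Z :: "complex^'r^'r" assume Z: "Z \<in> type1_domain"
    have "cdiff_at cscale_mat cscale_mat f Z" using f(2) Z by (simp add: mat_holomorphic_on_iff)
    moreover have "cdiff_at cscale_mat cscale_mat \<Psi> (f Z)"
      using moebius_holomorphic[OF puS] fdom[OF Z] by (simp add: mat_holomorphic_on_iff \<Psi>_def)
    ultimately show "cdiff_at cscale_mat cscale_mat F Z" unfolding F_def by (rule cdiff_at_compose)
  qed
  define ext :: "complex^'r \<Rightarrow> complex^('r option)" where "ext x = (\<chi> k. case k of None \<Rightarrow> 0 | Some i \<Rightarrow> x $ i)" for x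
  have extT: "vjoin (ext x) (ext y) v* T = vjoin x y v* M" for x y
    by (simp add: vec_eq_iff vector_matrix_mult_def sum_plus sum_option ext_def T(2,3))
  \<comment> \<open>After undoing T the relation between \<open>f\<close> and \<open>g\<close> says
    that F Z sends the padded row A to the padded row A Z. At unit rows A this makes the first r
    rows of F Z equal to (Z, 0).\<close>
  have FA: "ext A v* F Z = ext (A v* Z)" if Z: "Z \<in> type1_domain" and A: "A \<noteq> 0" for A Z
  proof -
    define w where "w = vjoin A (A v* Z) v* M"
    have w: "w = s *s pmap g (vjoin A (A v* Z))" by (simp add: w_def M)
    have wf: "vleft w v* f Z = vright w"
      using rel[OF Z A] by (simp add: w scalar_vector_matrix_assoc)
    have wS: "w v* S = vjoin (ext A) (ext (A v* Z))"
      using extT[of A "A v* Z"] by (simp add: w_def[symmetric]) (metis S(1) vector_matrix_mul_assoc vector_matrix_mul_rid)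
    have "vleft w v* (blockLL S + f Z ** blockRL S) = vleft (w v* S)"
      using vjoin_mult_blocks(1)[of "vleft w" "vright w" S]
      by (simp add: vector_matrix_mult_add_rdistrib wf flip: vector_matrix_mul_assoc)
    moreover have "vleft w v* (blockLR S + f Z ** blockRR S) = vright (w v* S)"
      using vjoin_mult_blocks(2)[of "vleft w" "vright w" S]
      by (simp add: vector_matrix_mult_add_rdistrib wf flip: vector_matrix_mul_assoc)
    moreover have "(blockLL S + f Z ** blockRL S) ** F Z = blockLR S + f Z ** blockRR S"
      unfolding F_def \<Psi>_def by (rule moebius_eq[OF puS fdom[OF Z]])
    ultimately have "vleft (w v* S) v* F Z = vright (w v* S)"
      by (metis vector_matrix_mul_assoc)
    then show ?thesis by (simp add: wS)
  qed
  have Frow: "F Z $ Some i $ k = (case k of None \<Rightarrow> 0 | Some j \<Rightarrow> Z $ i $ j)" if Z: "Z \<in> type1_domain" for Z i k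
  proof -
    have "axis i (1::complex) \<noteq> 0" by (simp add: axis_eq_0_iff)
    from arg_cong[OF FA[OF Z this], of "\<lambda>v. v $ k"] show ?thesis
      by (simp add: vector_matrix_mult_def sum_option ext_def axis_def if_distrib[of "\<lambda>x. x * _"] cong: if_cong option.case_cong)
  qed
  have Fcol: "F Z $ None $ Some j = 0" if "Z \<in> type1_domain" for Z j
    by (rule extension_row_zero[OF Fdom Fhol _ that]) (simp_all add: Frow)
  define h where "h Z = F Z $ None $ None" for Z
  have Fh: "block_map h Z = F Z" if "Z \<in> type1_domain" for Z
    using Frow[OF that] Fcol[OF that] by (auto simp: vec_eq_iff block_map_def h_def split: option.splits)
  have hhol: "fun_holomorphic_on h type1_domain"
    using Fhol unfolding mat_holomorphic_on_iff fun_holomorphic_on_iff h_def by (auto intro: cdiff_at_mat_entry)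
  have hbound: "cmod (h Z) < 1" if "Z \<in> type1_domain" for Z
  proof -
    have ax: "axis None (1::complex) \<noteq> (0 :: complex^('r option))" by (simp add: axis_eq_0_iff)
    have "axis None 1 v* F Z = F Z $ None"
      by (simp add: vec_eq_iff vector_matrix_mult_def axis_def if_distrib[of "\<lambda>x. x * _"] cong: if_cong)
    then have "norm (F Z $ None) < 1" using type1_domainD[OF Fdom[OF that] ax] by (simp add: norm_axis_1)
    then show ?thesis unfolding h_def using Finite_Cartesian_Product.norm_nth_le[of "F Z $ None" None] by linarith
  qed
  have "equivalent_maps type1_domain type1_domain f (block_map h)"
    unfolding equivalent_maps_def
  proof (intro conjI f)
    show "block_map h ` type1_domain \<subseteq> type1_domain" using Fh Fdom by auto
    show "mat_holomorphic_on (block_map h) type1_domain"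
      unfolding mat_holomorphic_on_iff
    proof (intro conjI ballI open_type1_domain)
      fix Z :: "complex^'r^'r" assume Z: "Z \<in> type1_domain"
      show "cdiff_at cscale_mat cscale_mat (block_map h) Z"
        by (rule cdiff_at_cong_eventually[OF _ open_type1_domain Z, of _ _ F])
           (use Fhol Z Fh in \<open>auto simp: mat_holomorphic_on_iff\<close>)
    qed
    show "\<exists>A\<in>automorphisms type1_domain. \<exists>B\<in>automorphisms type1_domain. \<forall>Z\<in>type1_domain. f Z = A (block_map h (B Z))"
    proof (rule bexI[OF bexI[OF _ id_automorphism] \<Phi>], intro ballI)
      fix Z :: "complex^'r^'r" assume Z: "Z \<in> type1_domain"
      show "f Z = \<Phi> (block_map h Z)" using \<Phi>\<Psi>[OF fdom[OF Z]] by (simp add: Fh[OF Z] F_def)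
    qed
  qed
  then show ?thesis using hhol hbound by blast
qed


section \<open>Maps induced by quadratic maps\<close>

lemma sv2_eq_iff: "sv a + sv b = sv c + sv d \<longleftrightarrow> (a = c \<and> b = d) \<or> (a = d \<and> b = (c :: 'n::finite))"
proof
  assume eq: "sv a + sv b = sv c + sv d"
  show "(a = c \<and> b = d) \<or> (a = d \<and> b = c)"
  proof (cases "a = c")
    case False
    then obtain \<rho> where \<rho>: "sv b = sv c + \<rho>" "sv d = sv a + \<rho>" using sv_swap[OF _ eq] by blast
    have "exp_sum \<rho> = 0" using arg_cong[OF \<rho>(1), of exp_sum] by (simp add: exp_sum_add exp_sum_sv)
    then have "\<rho> = 0" by (rule exp_sum_eq_0)
    then show ?thesis using \<rho> by simp
  qed (use eq in simp)
qed (auto simp: add.commute)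

lemma cmod_unit_scaled:
  assumes "(cmod a)\<^sup>2 = s" "s > 0"
  obtains u where "cmod u = 1" "a = u * complex_of_real (sqrt s)"
proof
  have "cmod a = sqrt s" using assms(1) by (metis norm_ge_zero real_sqrt_unique)
  then show "cmod (a / complex_of_real (sqrt s)) = 1" using assms(2) by (simp add: norm_divide)
  show "a = a / complex_of_real (sqrt s) * complex_of_real (sqrt s)" using assms(2) by simp
qed

context monomial_ball_map
begin

text \<open>When \<open>P\<close> has \<open>r + 1\<close> positive and \<open>r + 1\<close> negative coefficients, no cancellation among the components
  of \<open>g\<close> is possible, and \<open>g\<close> is determined up to phases and permutations.\<close>

lemma components_determined:
  fixes M M' :: "'r option \<Rightarrow> ('r + 'r \<Rightarrow>\<^sub>0 nat)" and C C' :: "'r option \<Rightarrow> real"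
  assumes ev: "\<And>x. peval (norm_poly g) x = (\<Sum>t\<in>UNIV. C t * mon (M t) x) - (\<Sum>t\<in>UNIV. C' t * mon (M' t) x)"
    and inj: "inj M" "inj M'" and disj: "\<And>s t. M s \<noteq> M' t" and C: "\<And>t. C t > 0" "\<And>t. C' t > 0"
  obtains \<pi> \<pi>' \<eta> \<theta> where "bij \<pi>" "bij \<pi>'" "\<And>k. cmod (\<eta> k) = 1" "\<And>k. cmod (\<theta> k) = 1"
    "\<And>k z. peval (g (Inl k)) z = \<eta> k * (complex_of_real (sqrt (C (\<pi> k))) * mon (M (\<pi> k)) z)"
    "\<And>k z. peval (g (Inr k)) z = \<theta> k * (complex_of_real (sqrt (C' (\<pi>' k))) * mon (M' (\<pi>' k)) z)"
proof -
  let ?P = "(\<Sum>t\<in>UNIV. single (M t) (C t)) - (\<Sum>t\<in>UNIV. single (M' t) (C' t))"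
  have "norm_poly g - ?P = 0"
    by (rule peval_eq_zero_on_orthant) (simp add: peval_diff ev peval_sum peval_single)
  then have P: "norm_poly g = ?P" by simp
  have lk: "lookup (norm_poly g) \<mu> = (\<Sum>t\<in>UNIV. if M t = \<mu> then C t else 0) - (\<Sum>t\<in>UNIV. if M' t = \<mu> then C' t else 0)" for \<mu>
    unfolding P by (simp add: lookup_minus lookup_sum lookup_single when_def)
  have pos: "lookup (norm_poly g) (M t) = C t" for t
    using disj inj(1) by (simp add: lk inj_eq disj[symmetric])
  have neg: "lookup (norm_poly g) (M' t) = - C' t" for t
    using disj inj(2) by (simp add: lk inj_eq)
  have "\<exists>k. M t \<in> keys (g (Inl k))" for t
    by (rule norm_poly_pos_key) (use pos C in simp)
  then obtain \<kappa> where \<kappa>: "\<And>t. M t \<in> keys (g (Inl (\<kappa> t)))" by metis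
  have "\<exists>k. M' t \<in> keys (g (Inr k))" for t
    by (rule norm_poly_neg_key) (use neg C in simp)
  then obtain \<kappa>' where \<kappa>': "\<And>t. M' t \<in> keys (g (Inr (\<kappa>' t)))" by metis
  have "inj \<kappa>"
  proof (rule injI)
    fix s t assume "\<kappa> s = \<kappa> t"
    then have "M s = M t" using monomial_map_keys[OF mono \<kappa>[of s]] \<kappa>[of t] by simp
    then show "s = t" using inj(1) by (simp add: inj_eq)
  qed
  then have bij: "bij \<kappa>" by (simp add: bij_def finite_UNIV_inj_surj)
  have "inj \<kappa>'"
  proof (rule injI)
    fix s t assume "\<kappa>' s = \<kappa>' t"
    then have "M' s = M' t" using monomial_map_keys[OF mono \<kappa>'[of s]] \<kappa>'[of t] by simp
    then show "s = t" using inj(2) by (simp add: inj_eq)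
  qed
  then have bij': "bij \<kappa>'" by (simp add: bij_def finite_UNIV_inj_surj)
  define \<pi> where "\<pi> = inv \<kappa>"
  define \<pi>' where "\<pi>' = inv \<kappa>'"
  have \<kappa>\<pi>: "\<kappa> (\<pi> k) = k" "\<pi> (\<kappa> t) = t" "\<kappa>' (\<pi>' k) = k" "\<pi>' (\<kappa>' t) = t" for k t
    using bij bij' by (simp_all add: \<pi>_def \<pi>'_def bij_is_surj surj_f_inv_f bij_is_inj)
  define a where "a k = lookup (g (Inl k)) (M (\<pi> k))" for k
  define b where "b k = lookup (g (Inr k)) (M' (\<pi>' k))" for k
  have ga: "g (Inl k) = single (M (\<pi> k)) (a k)" for k
  proof -
    have "M (\<pi> k) \<in> keys (g (Inl k))" using \<kappa>[of "\<pi> k"] \<kappa>\<pi> by simp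
    then have "keys (g (Inl k)) = {M (\<pi> k)}" using monomial_map_keys[OF mono] by blast
    then show ?thesis using poly_mapping_sum_single[of "g (Inl k)"] by (simp add: a_def)
  qed
  have gb: "g (Inr k) = single (M' (\<pi>' k)) (b k)" for k
  proof -
    have "M' (\<pi>' k) \<in> keys (g (Inr k))" using \<kappa>'[of "\<pi>' k"] \<kappa>\<pi> by simp
    then have "keys (g (Inr k)) = {M' (\<pi>' k)}" using monomial_map_keys[OF mono] by blast
    then show ?thesis using poly_mapping_sum_single[of "g (Inr k)"] by (simp add: b_def)
  qed
  have bij\<pi>: "bij \<pi>" "bij \<pi>'" using bij bij' by (simp_all add: \<pi>_def \<pi>'_def bij_imp_bij_inv)
  have inj\<pi>: "\<pi> k = \<pi> l \<longleftrightarrow> k = l" "\<pi>' k = \<pi>' l \<longleftrightarrow> k = l" for k l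
    using bij\<pi> by (simp_all add: bij_is_inj inj_eq)
  have "(cmod (a k))\<^sup>2 = C (\<pi> k)" for k
  proof -
    have "(\<Sum>l\<in>UNIV. (cmod (lookup (g (Inl l)) (M (\<pi> k))))\<^sup>2) = (\<Sum>l\<in>UNIV. if l = k then (cmod (a k))\<^sup>2 else 0)"
      by (rule sum.cong) (use inj(1) in \<open>auto simp: ga lookup_single when_def inj_eq inj\<pi>\<close>)
    moreover have "(\<Sum>l\<in>UNIV. (cmod (lookup (g (Inr l)) (M (\<pi> k))))\<^sup>2) = 0"
      by (simp add: gb lookup_single when_def disj[symmetric])
    ultimately show ?thesis using pos[of "\<pi> k"] unfolding lookup_norm_poly by simp
  qed
  then have "\<exists>u. cmod u = 1 \<and> a k = u * complex_of_real (sqrt (C (\<pi> k)))" for k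
    using cmod_unit_scaled C(1) by metis
  then obtain \<eta> where \<eta>: "\<And>k. cmod (\<eta> k) = 1" "\<And>k. a k = \<eta> k * complex_of_real (sqrt (C (\<pi> k)))" by metis
  have "(cmod (b k))\<^sup>2 = C' (\<pi>' k)" for k
  proof -
    have "(\<Sum>l\<in>UNIV. (cmod (lookup (g (Inr l)) (M' (\<pi>' k))))\<^sup>2) = (\<Sum>l\<in>UNIV. if l = k then (cmod (b k))\<^sup>2 else 0)"
      by (rule sum.cong) (use inj(2) in \<open>auto simp: gb lookup_single when_def inj_eq inj\<pi>\<close>)
    moreover have "(\<Sum>l\<in>UNIV. (cmod (lookup (g (Inl l)) (M' (\<pi>' k))))\<^sup>2) = 0"
      by (simp add: ga lookup_single when_def disj)
    ultimately show ?thesis using neg[of "\<pi>' k"] unfolding lookup_norm_poly by simp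
  qed
  then have "\<exists>u. cmod u = 1 \<and> b k = u * complex_of_real (sqrt (C' (\<pi>' k)))" for k
    using cmod_unit_scaled C(2) by metis
  then obtain \<theta> where \<theta>: "\<And>k. cmod (\<theta> k) = 1" "\<And>k. b k = \<theta> k * complex_of_real (sqrt (C' (\<pi>' k)))" by metis
  have "peval (g (Inl k)) z = \<eta> k * (complex_of_real (sqrt (C (\<pi> k))) * mon (M (\<pi> k)) z)"
    "peval (g (Inr k)) z = \<theta> k * (complex_of_real (sqrt (C' (\<pi>' k))) * mon (M' (\<pi>' k)) z)" for k z
    by (simp_all add: ga gb peval_single \<eta>(2) \<theta>(2) mult.assoc)
  then show thesis using that[of \<pi> \<pi>' \<eta> \<theta>] bij\<pi> \<eta>(1) \<theta>(1) by blast
qed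

text \<open>The permutations and phases of the components of \<open>g\<close> act on
  \<open>f\<close> as a target automorphism. Removing it leaves equations for \<open>f'\<close> with
  explicit monomials and the weights sqrt C, sqrt C'.\<close>

lemma normalized_map:
  fixes M M' :: "'r option \<Rightarrow> ('r + 'r \<Rightarrow>\<^sub>0 nat)" and C C' :: "'r option \<Rightarrow> real"
    and f :: "complex^'r^'r \<Rightarrow> complex^('r option)^('r option)"
  assumes ev: "\<And>x. peval (norm_poly g) x = (\<Sum>t\<in>UNIV. C t * mon (M t) x) - (\<Sum>t\<in>UNIV. C' t * mon (M' t) x)"
    and inj: "inj M" "inj M'" and disj: "\<And>s t. M s \<noteq> M' t" and C: "\<And>t. C t > 0" "\<And>t. C' t > 0"
    and f: "f ` type1_domain \<subseteq> type1_domain"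
    and rel: "\<And>Z A. Z \<in> type1_domain \<Longrightarrow> A \<noteq> 0 \<Longrightarrow>
      vleft (pmap g (vjoin A (A v* Z))) v* f Z = vright (pmap g (vjoin A (A v* Z)))"
  shows "\<exists>a f'. a \<in> automorphisms type1_domain \<and> (\<forall>Z. f Z = a (f' Z)) \<and> f' ` type1_domain \<subseteq> type1_domain \<and>
    (continuous_on type1_domain f \<longrightarrow> continuous_on type1_domain f') \<and>
    (\<forall>Z A s. Z \<in> type1_domain \<longrightarrow> A \<noteq> 0 \<longrightarrow>
      (\<Sum>t\<in>UNIV. complex_of_real (sqrt (C t)) * mon (M t) (vjoin A (A v* Z)) * f' Z $ t $ s)
        = complex_of_real (sqrt (C' s)) * mon (M' s) (vjoin A (A v* Z)))"
proof -
  obtain \<pi> \<pi>' \<eta> \<theta> where \<pi>: "bij \<pi>" "bij \<pi>'" and u: "\<And>k. cmod (\<eta> k) = 1" "\<And>k. cmod (\<theta> k) = 1"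
    and g: "\<And>k z. peval (g (Inl k)) z = \<eta> k * (complex_of_real (sqrt (C (\<pi> k))) * mon (M (\<pi> k)) z)"
      "\<And>k z. peval (g (Inr k)) z = \<theta> k * (complex_of_real (sqrt (C' (\<pi>' k))) * mon (M' (\<pi>' k)) z)"
    using components_determined[OF ev inj disj C] by blast
  define a where "a = (monomial_trans \<pi> \<pi>' (\<lambda>k. cnj (\<eta> k)) \<theta> :: complex^('r option)^('r option) \<Rightarrow> _)"
  define f' where "f' Z = monomial_trans (inv \<pi>) (inv \<pi>') (\<lambda>k. \<eta> (inv \<pi> k)) (\<lambda>l. cnj (\<theta> (inv \<pi>' l))) (f Z)" for Z
  show ?thesis
  proof (rule exI[of _ a], rule exI[of _ f'], intro conjI allI impI)
    show "a \<in> automorphisms type1_domain"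
      unfolding a_def by (rule monomial_trans_automorphism) (use \<pi> u in auto)
    show "f Z = a (f' Z)" for Z
      using monomial_trans_inverse(2)[of \<pi> \<pi>' "\<lambda>k. cnj (\<eta> k)" \<theta> "f Z"] \<pi> u by (simp add: a_def f'_def)
    have "monomial_trans (inv \<pi>) (inv \<pi>') (\<lambda>k. \<eta> (inv \<pi> k)) (\<lambda>l. cnj (\<theta> (inv \<pi>' l))) W \<in> type1_domain"
      if "W \<in> type1_domain" for W :: "complex^('r option)^('r option)"
      by (rule monomial_trans_in_domain) (use \<pi> u that in \<open>auto simp: bij_imp_bij_inv\<close>)
    then show "f' ` type1_domain \<subseteq> type1_domain" using f by (auto simp: f'_def)
    show "continuous_on type1_domain f'" if "continuous_on type1_domain f"
      unfolding f'_def monomial_trans_def using that by (intro continuous_intros)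
    fix Z A s assume Z: "Z \<in> (type1_domain :: (complex^'r^'r) set)" and A: "A \<noteq> (0 :: complex^'r)"
    define z where "z = vjoin A (A v* Z)"
    have unit: "cnj (\<theta> k) * \<theta> k = 1" for k
      using u(2)[of k] complex_norm_square[of "\<theta> k"] by (simp add: mult.commute)
    have ip: "\<pi>' (inv \<pi>' s) = s" "inv \<pi> (\<pi> k) = k" for k
      using \<pi> by (simp_all add: bij_is_surj surj_f_inv_f bij_is_inj)
    have "(\<Sum>k\<in>UNIV. peval (g (Inl k)) z * f Z $ k $ inv \<pi>' s) = peval (g (Inr (inv \<pi>' s))) z"
      using arg_cong[OF rel[OF Z A], of "\<lambda>v. v $ inv \<pi>' s"] by (simp add: vector_matrix_mult_def z_def)
    then have "(\<Sum>k\<in>UNIV. \<eta> k * (complex_of_real (sqrt (C (\<pi> k))) * mon (M (\<pi> k)) z) * f Z $ k $ inv \<pi>' s)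
        = \<theta> (inv \<pi>' s) * (complex_of_real (sqrt (C' s)) * mon (M' s) z)"
      by (simp add: g ip)
    then have "cnj (\<theta> (inv \<pi>' s)) * (\<Sum>k\<in>UNIV. \<eta> k * (complex_of_real (sqrt (C (\<pi> k))) * mon (M (\<pi> k)) z) * f Z $ k $ inv \<pi>' s)
        = complex_of_real (sqrt (C' s)) * mon (M' s) z"
      by (simp add: unit flip: mult.assoc)
    moreover have "(\<Sum>t\<in>UNIV. complex_of_real (sqrt (C t)) * mon (M t) z * f' Z $ t $ s)
        = (\<Sum>k\<in>UNIV. complex_of_real (sqrt (C (\<pi> k))) * mon (M (\<pi> k)) z * f' Z $ \<pi> k $ s)"
      by (rule sum_bij_UNIV[OF \<pi>(1), symmetric])
    moreover have "\<dots> = cnj (\<theta> (inv \<pi>' s)) * (\<Sum>k\<in>UNIV. \<eta> k * (complex_of_real (sqrt (C (\<pi> k))) * mon (M (\<pi> k)) z) * f Z $ k $ inv \<pi>' s)"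
      by (simp add: f'_def monomial_trans_def ip sum_distrib_left mult_ac)
    ultimately show "(\<Sum>t\<in>UNIV. complex_of_real (sqrt (C t)) * mon (M t) (vjoin A (A v* Z)) * f' Z $ t $ s)
        = complex_of_real (sqrt (C' s)) * mon (M' s) (vjoin A (A v* Z))"
      unfolding z_def by simp
  qed
qed

end

section \<open>The two model maps for r = 2\<close>

lemma triple_simps [simp]:
  "triple p q x y z (Some p) = x" "p \<noteq> q \<Longrightarrow> triple p q x y z (Some q) = y" "triple p q x y z None = z"
  by (auto simp: triple_def)

lemma inj_triple:
  assumes "UNIV = {p, q}" "x \<noteq> y" "y \<noteq> z" "x \<noteq> z"
  shows "inj (triple p q x y z)"
proof (rule injI)
  fix a b assume "triple p q x y z a = triple p q x y z b"
  then show "a = b"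
    using assms(2-4) UNIV_I[of "the a"] UNIV_I[of "the b"] unfolding assms(1)
    by (cases a; cases b) (auto simp: triple_def split: if_splits)
qed

lemma triple_cases: "triple p q x y z a \<in> {x, y, z}"
  by (simp add: triple_def)

lemma sum_two:
  assumes "(UNIV :: 'r::finite set) = {p, q}" "p \<noteq> q"
  shows "(\<Sum>i\<in>(UNIV :: 'r set). h i) = h p + h q"
  unfolding assms(1) using assms(2) by simp

lemma quadratic_map_A_holomorphic: "mat_holomorphic_on (quadratic_map_A p q) type1_domain"
  unfolding mat_holomorphic_on_iff
proof (intro conjI ballI open_type1_domain cdiff_at_matI)
  fix Z a b
  show "cdiff_at cscale_mat (*) (\<lambda>Z. quadratic_map_A p q Z $ a $ b) Z"
    unfolding quadratic_map_A_def triple_def Let_def vec_lambda_beta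
    by (cases "a = Some p"; cases "a = Some q"; cases "b = Some p"; cases "b = Some q"; simp; intro cdiff_at_intros)
qed

lemma quadratic_map_B_holomorphic: "mat_holomorphic_on (quadratic_map_B p q) type1_domain"
  unfolding mat_holomorphic_on_iff
proof (intro conjI ballI open_type1_domain cdiff_at_matI)
  fix Z a b
  show "cdiff_at cscale_mat (*) (\<lambda>Z. quadratic_map_B p q Z $ a $ b) Z"
    unfolding quadratic_map_B_def triple_def Let_def vec_lambda_beta
    by (cases "a = Some p"; cases "a = Some q"; cases "b = Some p"; cases "b = Some q"; simp; intro cdiff_at_intros)
qed

text \<open>The source automorphism is only a permutation of columns. That \<open>m\<close> maps
  into the domain is inherited from \<open>f'\<close>, as this permutation is onto.\<close>

lemma quadratic_equivalence:
  fixes f :: "complex^'r::finite^'r \<Rightarrow> complex^('r option)^('r option)"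
  assumes f: "f ` type1_domain \<subseteq> type1_domain" "mat_holomorphic_on f type1_domain"
    and a: "a \<in> automorphisms type1_domain" "\<And>Z. f Z = a (f' Z)" "f' ` type1_domain \<subseteq> type1_domain"
    and b: "bij \<rho>" "\<And>Z. Z \<in> type1_domain \<Longrightarrow> f' Z = m (monomial_trans id \<rho> (\<lambda>_. 1) (\<lambda>_. 1) Z)"
    and m: "mat_holomorphic_on m type1_domain"
  shows "equivalent_maps type1_domain type1_domain f m"
  unfolding equivalent_maps_def
proof (intro conjI f m)
  let ?B = "monomial_trans id \<rho> (\<lambda>_. 1) (\<lambda>_. 1) :: complex^'r^'r \<Rightarrow> _"
  have B: "?B \<in> automorphisms type1_domain" by (rule monomial_trans_automorphism) (use b in auto)
  show "m ` type1_domain \<subseteq> type1_domain"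
  proof
    fix V assume "V \<in> m ` type1_domain"
    then obtain W where W: "W \<in> type1_domain" "V = m W" by blast
    then have "W \<in> ?B ` type1_domain" using B unfolding automorphisms_def bij_betw_def by blast
    then obtain Z where "Z \<in> type1_domain" "W = ?B Z" by blast
    then show "V \<in> type1_domain" using b(2) a(3) W(2) by auto
  qed
  show "\<exists>A\<in>automorphisms type1_domain. \<exists>B\<in>automorphisms type1_domain. \<forall>Z\<in>type1_domain. f Z = A (m (B Z))"
    by (rule bexI[OF bexI[OF _ B] a(1)]) (use a(2) b(2) in auto)
qed

context monomial_ball_map
begin

text \<open>Here P = c ((x_p + x_q)^2 - (y_p + y_q)^2), and the weights 1, 2, 1 are the origin of
  sqrt 2. For fixed Z the equations are quadratic forms in A whose coefficients are the rows of f',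
  so three rows A determine f' Z.\<close>

lemma quadrinomial_case:
  fixes f :: "complex^'r^'r \<Rightarrow> complex^('r option)^('r option)"
  assumes f: "f ` type1_domain \<subseteq> type1_domain" "mat_holomorphic_on f type1_domain"
    and rel: "\<And>Z A. Z \<in> type1_domain \<Longrightarrow> A \<noteq> 0 \<Longrightarrow>
      vleft (pmap g (vjoin A (A v* Z))) v* f Z = vright (pmap g (vjoin A (A v* Z)))"
    and c: "c > 0" and P: "\<And>x. peval (norm_poly g) x = sign_form x * (c * ((\<Sum>i\<in>UNIV. x $ Inl i) + (\<Sum>j\<in>UNIV. x $ Inr j)))"
    and UN: "(UNIV :: 'r set) = {p, q}" and pq: "p \<noteq> q"
  shows "equivalent_maps type1_domain type1_domain f (quadratic_map_B p q)"
proof -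
  define M :: "'r option \<Rightarrow> ('r + 'r \<Rightarrow>\<^sub>0 nat)" where
    "M = triple p q (sv (Inl p) + sv (Inl p)) (sv (Inl p) + sv (Inl q)) (sv (Inl q) + sv (Inl q))"
  define M' :: "'r option \<Rightarrow> ('r + 'r \<Rightarrow>\<^sub>0 nat)" where
    "M' = triple p q (sv (Inr p) + sv (Inr p)) (sv (Inr p) + sv (Inr q)) (sv (Inr q) + sv (Inr q))"
  define C where "C = triple p q c (2 * c) c"
  note s2 = sum_two[OF UN pq]
  have ev: "peval (norm_poly g) x = (\<Sum>t\<in>UNIV. C t * mon (M t) x) - (\<Sum>t\<in>UNIV. C t * mon (M' t) x)" for x
      unfolding P sign_form_def sum_option s2
      using pq by (simp add: C_def M_def M'_def mon_add mon_sv) (simp add: algebra_simps)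
  have inj: "inj M" "inj M'" unfolding M_def M'_def by (rule inj_triple[OF UN]; use pq in \<open>simp add: sv2_eq_iff\<close>)+
  have M: "M s \<in> {sv (Inl p) + sv (Inl p), sv (Inl p) + sv (Inl q), sv (Inl q) + sv (Inl q)}" for s
    unfolding M_def by (rule triple_cases)
  have M': "M' s \<in> {sv (Inr p) + sv (Inr p), sv (Inr p) + sv (Inr q), sv (Inr q) + sv (Inr q)}" for s
    unfolding M'_def by (rule triple_cases)
  have disj: "M s \<noteq> M' t" for s t
    using M[of s] M'[of t] by (auto simp: sv2_eq_iff)
  have C: "C t > 0" for t using c by (simp add: C_def triple_def)
  from normalized_map[OF ev inj disj C C f(1) rel]
  obtain a f' where *: "a \<in> automorphisms type1_domain" "\<forall>Z. f Z = a (f' Z)" "f' ` type1_domain \<subseteq> type1_domain"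
    "continuous_on type1_domain f \<longrightarrow> continuous_on type1_domain f'"
    "\<forall>Z A s. Z \<in> type1_domain \<longrightarrow> A \<noteq> 0 \<longrightarrow>
      (\<Sum>t\<in>UNIV. complex_of_real (sqrt (C t)) * mon (M t) (vjoin A (A v* Z)) * f' Z $ t $ s)
        = complex_of_real (sqrt (C s)) * mon (M' s) (vjoin A (A v* Z))" by blast
  have a: "a \<in> automorphisms type1_domain" "\<And>Z. f Z = a (f' Z)" "f' ` type1_domain \<subseteq> type1_domain"
    using *(1-3) by blast+
  have rel': "(\<Sum>t\<in>UNIV. complex_of_real (sqrt (C t)) * mon (M t) (vjoin A (A v* Z)) * f' Z $ t $ s)
        = complex_of_real (sqrt (C s)) * mon (M' s) (vjoin A (A v* Z))"
    if "Z \<in> type1_domain" "A \<noteq> 0" for Z A s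
    using *(5) that by blast
  have f'B: "f' Z = quadratic_map_B p q Z" if Z: "Z \<in> type1_domain" for Z
  proof -
    define D where "D t s = f' Z $ t $ s - quadratic_map_B p q Z $ t $ s" for t s
    let ?w = "complex_of_real (sqrt 2)"
    have ww: "?w * ?w = 2" by (simp flip: of_real_mult)
    have D: "A $ p * A $ p * D (Some p) s + ?w * A $ p * A $ q * D (Some q) s + A $ q * A $ q * D None s = 0"
      if A: "A \<noteq> 0" for A s
    proof -
      have r: "complex_of_real (sqrt c) * (A $ p * A $ p * f' Z $ Some p $ s + ?w * A $ p * A $ q * f' Z $ Some q $ s + A $ q * A $ q * f' Z $ None $ s)
        = complex_of_real (sqrt (C s)) * mon (M' s) (vjoin A (A v* Z))"
        using rel'[OF Z A, of s] pq
        by (simp add: sum_option s2 C_def M_def mon_add mon_sv real_sqrt_mult algebra_simps)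
      have b: "(A v* Z) $ j = A $ p * Z $ p $ j + A $ q * Z $ q $ j" for j
        by (simp add: vector_matrix_mult_def s2)
      have "complex_of_real (sqrt (C s)) * mon (M' s) (vjoin A (A v* Z)) = complex_of_real (sqrt c) *
         (A $ p * A $ p * quadratic_map_B p q Z $ Some p $ s + ?w * A $ p * A $ q * quadratic_map_B p q Z $ Some q $ s
            + A $ q * A $ q * quadratic_map_B p q Z $ None $ s)"
      proof -
        have "s = Some p \<or> s = Some q \<or> s = None" using UNIV_I[of "the s"] unfolding UN by (cases s) auto
        moreover have "x * ?w * (y * ?w) = 2 * x * y" for x y using ww by (simp add: algebra_simps) 
        ultimately show ?thesis
          using pq by (elim disjE)
            (simp_all add: quadratic_map_B_def Let_def C_def M'_def mon_add mon_sv b real_sqrt_mult power2_eq_square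
              algebra_simps ww mult.left_commute[of ?w ?w])
      qed
      with r c have "A $ p * A $ p * f' Z $ Some p $ s + ?w * A $ p * A $ q * f' Z $ Some q $ s + A $ q * A $ q * f' Z $ None $ s
          = A $ p * A $ p * quadratic_map_B p q Z $ Some p $ s + ?w * A $ p * A $ q * quadratic_map_B p q Z $ Some q $ s
            + A $ q * A $ q * quadratic_map_B p q Z $ None $ s" by simp
      then show ?thesis unfolding D_def by (simp only: right_diff_distrib) (simp add: algebra_simps)
    qed
    \<comment> \<open>The rows (1, 0) and (0, 1) isolate the two square terms, and (1, 1) then gives
      the mixed one.\<close>
    have "axis p 1 \<noteq> (0 :: complex^'r)" "axis q 1 \<noteq> (0 :: complex^'r)" by (simp_all add: axis_eq_0_iff)
    moreover have "(\<chi> i. 1) \<noteq> (0 :: complex^'r)" by (simp add: vec_eq_iff)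
    ultimately have "D (Some p) s = 0" "D None s = 0" "D (Some q) s = 0" for s
      using D[of "axis p 1" s] D[of "axis q 1" s] D[of "\<chi> i. 1" s] pq by (simp_all add: axis_def)
    then have "D t s = 0" for t s
      using UNIV_I[of "the t"] unfolding UN by (cases t) auto
    then show ?thesis by (simp add: D_def vec_eq_iff)
  qed
  show ?thesis
    by (rule quadratic_equivalence[OF f a, of id])
       (simp_all add: f'B monomial_trans_def quadratic_map_B_holomorphic)
qed

text \<open>In the product of s and x_p + y_j the terms x_p y_j cancel, and three monomials of each
  sign remain. The positive monomial x_q y_j becomes A_q (A Z)_j, which depends on Z, so the
  equations determine f' Z where Z_qj is nonzero; continuity covers the rest.\<close>

lemma binomial_case:
  fixes f :: "complex^'r^'r \<Rightarrow> complex^('r option)^('r option)"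
  assumes f: "f ` type1_domain \<subseteq> type1_domain" "mat_holomorphic_on f type1_domain"
    and rel: "\<And>Z A. Z \<in> type1_domain \<Longrightarrow> A \<noteq> 0 \<Longrightarrow>
      vleft (pmap g (vjoin A (A v* Z))) v* f Z = vright (pmap g (vjoin A (A v* Z)))"
    and c: "c > 0" and P: "\<And>x. peval (norm_poly g) x = sign_form x * (c * (x $ Inl p + x $ Inr j))"
    and UN: "(UNIV :: 'r set) = {p, q}" and pq: "p \<noteq> q"
  shows "equivalent_maps type1_domain type1_domain f (quadratic_map_A p q)"
proof -
  \<comment> \<open>The column index \<open>j\<close> need not be \<open>p\<close>;
    \<open>\<rho>\<close> below renames the columns so that \<open>j\<close> becomes the first
    one.\<close>
  define l where "l = (if j = p then q else p)"
  have UNj: "(UNIV :: 'r set) = {j, l}" and jl: "j \<noteq> l"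
    using UNIV_I[of j] UN pq by (auto simp: l_def)
  define \<rho> where "\<rho> k = (if k = p then j else l)" for k
  have \<rho>: "\<rho> p = j" "\<rho> q = l" using pq by (simp_all add: \<rho>_def)
  have "inj \<rho>" using jl UNIV_I UN by (intro injI) (auto simp: \<rho>_def split: if_splits)
  then have bij: "bij \<rho>" by (simp add: bij_def finite_UNIV_inj_surj)
  define M :: "'r option \<Rightarrow> ('r + 'r \<Rightarrow>\<^sub>0 nat)" where
    "M = triple p q (sv (Inl p) + sv (Inl p)) (sv (Inl p) + sv (Inl q)) (sv (Inl q) + sv (Inr j))"
  define M' :: "'r option \<Rightarrow> ('r + 'r \<Rightarrow>\<^sub>0 nat)" where
    "M' = triple p q (sv (Inr j) + sv (Inr j)) (sv (Inr j) + sv (Inr l)) (sv (Inl p) + sv (Inr l))"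
  define C where "C = (\<lambda>t :: 'r option. c)"
  note s2 = sum_two[OF UN pq] and s2j = sum_two[OF UNj jl]
  have sf: "sign_form x = x $ Inl p + x $ Inl q - (x $ Inr j + x $ Inr l)" for x :: "real^('r + 'r)"
    unfolding sign_form_def s2[of "\<lambda>i. x $ Inl i"] s2j[of "\<lambda>i. x $ Inr i"] by simp
  have ev: "peval (norm_poly g) x = (\<Sum>t\<in>UNIV. C t * mon (M t) x) - (\<Sum>t\<in>UNIV. C t * mon (M' t) x)" for x
      unfolding P sf sum_option s2
      using pq by (simp add: C_def M_def M'_def mon_add mon_sv) (simp add: algebra_simps)
  have inj: "inj M" "inj M'" unfolding M_def M'_def by (rule inj_triple[OF UN]; use pq jl in \<open>simp add: sv2_eq_iff\<close>)+
  have M: "M s \<in> {sv (Inl p) + sv (Inl p), sv (Inl p) + sv (Inl q), sv (Inl q) + sv (Inr j)}" for s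
    unfolding M_def by (rule triple_cases)
  have M': "M' s \<in> {sv (Inr j) + sv (Inr j), sv (Inr j) + sv (Inr l), sv (Inl p) + sv (Inr l)}" for s
    unfolding M'_def by (rule triple_cases)
  have disj: "M s \<noteq> M' t" for s t
    using M[of s] M'[of t] pq jl by (auto simp: sv2_eq_iff)
  have C: "C t > 0" for t using c by (simp add: C_def)
  from normalized_map[OF ev inj disj C C f(1) rel]
  obtain a f' where *: "a \<in> automorphisms type1_domain" "\<forall>Z. f Z = a (f' Z)" "f' ` type1_domain \<subseteq> type1_domain"
    "continuous_on type1_domain f \<longrightarrow> continuous_on type1_domain f'"
    "\<forall>Z A s. Z \<in> type1_domain \<longrightarrow> A \<noteq> 0 \<longrightarrow>
      (\<Sum>t\<in>UNIV. complex_of_real (sqrt (C t)) * mon (M t) (vjoin A (A v* Z)) * f' Z $ t $ s)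
        = complex_of_real (sqrt (C s)) * mon (M' s) (vjoin A (A v* Z))" by blast
  have a: "a \<in> automorphisms type1_domain" "\<And>Z. f Z = a (f' Z)" "f' ` type1_domain \<subseteq> type1_domain"
    using *(1-3) by blast+
  have cf: "continuous_on type1_domain f \<Longrightarrow> continuous_on type1_domain f'" using *(4) by blast
  have rel': "(\<Sum>t\<in>UNIV. complex_of_real (sqrt (C t)) * mon (M t) (vjoin A (A v* Z)) * f' Z $ t $ s)
        = complex_of_real (sqrt (C s)) * mon (M' s) (vjoin A (A v* Z))"
    if "Z \<in> type1_domain" "A \<noteq> 0" for Z A s
    using *(5) that by blast
  let ?B = "monomial_trans id \<rho> (\<lambda>_. 1) (\<lambda>_. 1) :: complex^'r^'r \<Rightarrow> _"
  have B: "?B Z $ p $ p = Z $ p $ j" "?B Z $ p $ q = Z $ p $ l" "?B Z $ q $ p = Z $ q $ j" "?B Z $ q $ q = Z $ q $ l" for Z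
    by (simp_all add: monomial_trans_def \<rho>)
  have generic: "f' Z = quadratic_map_A p q (?B Z)" if Z: "Z \<in> type1_domain" and nz: "Z $ q $ j \<noteq> 0" for Z
  proof -
    let ?Q = "quadratic_map_A p q (?B Z)"
    define D where "D t s = f' Z $ t $ s - ?Q $ t $ s" for t s
    have b: "(A v* Z) $ k = A $ p * Z $ p $ k + A $ q * Z $ q $ k" for A k
      by (simp add: vector_matrix_mult_def s2)
    have D: "A $ p * A $ p * D (Some p) s + A $ p * A $ q * D (Some q) s + A $ q * (A v* Z) $ j * D None s = 0"
      if A: "A \<noteq> 0" for A s
    proof -
      have r: "A $ p * A $ p * f' Z $ Some p $ s + A $ p * A $ q * f' Z $ Some q $ s + A $ q * (A v* Z) $ j * f' Z $ None $ s
        = mon (M' s) (vjoin A (A v* Z))"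
      proof -
        have "complex_of_real (sqrt c) * (A $ p * A $ p * f' Z $ Some p $ s + A $ p * A $ q * f' Z $ Some q $ s + A $ q * (A v* Z) $ j * f' Z $ None $ s)
          = complex_of_real (sqrt c) * mon (M' s) (vjoin A (A v* Z))"
          using rel'[OF Z A, of s] pq
          by (simp add: sum_option s2 C_def M_def mon_add mon_sv algebra_simps)
        then show ?thesis using c by simp
      qed
      have "mon (M' s) (vjoin A (A v* Z)) =
         A $ p * A $ p * ?Q $ Some p $ s + A $ p * A $ q * ?Q $ Some q $ s + A $ q * (A v* Z) $ j * ?Q $ None $ s"
      proof -
        have "s = Some p \<or> s = Some q \<or> s = None" using UNIV_I[of "the s"] unfolding UN by (cases s) auto
        then show ?thesis
          using pq by (elim disjE)
            (simp_all add: quadratic_map_A_def Let_def M'_def mon_add mon_sv b B power2_eq_square algebra_simps)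
      qed
      with r have "A $ p * A $ p * f' Z $ Some p $ s + A $ p * A $ q * f' Z $ Some q $ s + A $ q * (A v* Z) $ j * f' Z $ None $ s
          = A $ p * A $ p * ?Q $ Some p $ s + A $ p * A $ q * ?Q $ Some q $ s + A $ q * (A v* Z) $ j * ?Q $ None $ s" by simp
      then show ?thesis unfolding D_def by (simp only: right_diff_distrib) (simp add: algebra_simps)
    qed
    have Dall: "D (Some p) s = 0 \<and> D None s = 0 \<and> D (Some q) s = 0" for s
    proof -
      define A1 :: "complex^'r" where "A1 = (\<chi> i. 1)"
      define A2 :: "complex^'r" where "A2 = (\<chi> i. if i = p then 1 else -1)"
      have "axis p 1 \<noteq> (0 :: complex^'r)" by (simp add: axis_eq_0_iff)
      moreover have "A1 \<noteq> 0" by (simp add: vec_eq_iff A1_def)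
      moreover have "A2 $ p \<noteq> 0" by (simp add: A2_def)
      then have "A2 \<noteq> 0" by auto
      ultimately have 1: "D (Some p) s = 0" and 2: "D (Some q) s + (Z $ p $ j + Z $ q $ j) * D None s = - D (Some p) s"
        and 3: "- D (Some q) s - (Z $ p $ j - Z $ q $ j) * D None s = - D (Some p) s"
        using D[of "axis p 1" s] D[of A1 s] D[of A2 s] pq
        by (simp_all add: axis_def b A1_def A2_def add_eq_0_iff algebra_simps)
      \<comment> \<open>Adding the equations for A = (1, 1) and A = (1, -1) eliminates the middle
        row and leaves the coefficient 2 Z_qj.\<close>
      have "(2 * Z $ q $ j) * D None s = (D (Some q) s + (Z $ p $ j + Z $ q $ j) * D None s)
          + (- D (Some q) s - (Z $ p $ j - Z $ q $ j) * D None s)" by (simp add: algebra_simps)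
      also have "\<dots> = 0" unfolding 2 3 1 by simp
      finally have "D None s = 0" using nz by simp
      then show ?thesis using 1 2 by simp
    qed
    then have "D t s = 0" for t s
      using UNIV_I[of "the t"] unfolding UN by (cases t) auto
    then show ?thesis by (simp add: D_def vec_eq_iff)
  qed
  have contf: "continuous_on type1_domain f"
    using f(2) by (intro continuous_at_imp_continuous_on) (auto simp: mat_holomorphic_on_iff intro: cdiff_at_imp_isCont)
  have all: "f' Z = quadratic_map_A p q (?B Z)" if Z: "Z \<in> type1_domain" for Z
  proof (cases "Z $ q $ j = 0")
    case True
    define W where "W n = Z + inverse (real (Suc n)) *\<^sub>R (\<chi> i k. if i = q \<and> k = j then 1 else 0)" for n
    have "W \<longlonglongrightarrow> Z + 0 *\<^sub>R (\<chi> i k. if i = q \<and> k = j then 1 else 0)"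
      unfolding W_def by (intro tendsto_intros LIMSEQ_inverse_real_of_nat)
    then have WZ: "W \<longlonglongrightarrow> Z" by simp
    have evW: "eventually (\<lambda>n. W n \<in> type1_domain) sequentially"
      using topological_tendstoD[OF WZ open_type1_domain Z] .
    have Wn: "W n $ q $ j \<noteq> 0" for n using True by (simp add: W_def)
    have "(\<lambda>n. f' (W n)) \<longlonglongrightarrow> f' Z"
      by (rule continuous_on_tendsto_compose[OF cf[OF contf] WZ Z evW])
    moreover have "(\<lambda>n. quadratic_map_A p q (?B (W n))) \<longlonglongrightarrow> quadratic_map_A p q (?B Z)"
    proof -
      have BZ: "?B Z \<in> type1_domain" by (rule monomial_trans_in_domain) (use bij Z in auto)
      have "isCont (quadratic_map_A p q) (?B Z)"
        using quadratic_map_A_holomorphic[of p q] BZ by (auto simp: mat_holomorphic_on_iff intro: cdiff_at_imp_isCont)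
      moreover have "(\<lambda>n. ?B (W n)) \<longlonglongrightarrow> ?B Z"
        unfolding monomial_trans_def by (intro tendsto_intros WZ)
      ultimately show ?thesis by (rule isCont_tendsto_compose)
    qed
    moreover have "eventually (\<lambda>n. f' (W n) = quadratic_map_A p q (?B (W n))) sequentially"
      by (rule eventually_mono[OF evW]) (use generic Wn in blast)
    ultimately show ?thesis using tendsto_cong LIMSEQ_unique by fast
  qed (use generic Z in blast)
  show ?thesis
    by (rule quadratic_equivalence[OF f a bij all quadratic_map_A_holomorphic])
qed

end

theorem theorem1p3:
  fixes f :: "complex^'r::finite^'r \<Rightarrow> complex^('r option)^('r option)"
    and g :: "'r option + 'r option \<Rightarrow> ('r + 'r, complex) mpolynomial"
  assumes "CARD('r) \<ge> 2"
    and "f ` type1_domain \<subseteq> type1_domain"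
    and "mat_holomorphic_on f type1_domain"
    and "proper_map (top_of_set type1_domain) (top_of_set type1_domain) f"
    and "preserves_max_inv_geodesic f"
    and "proper_ball_rational_map g"
    and "monomial_map g"
    and "induced_map f g"
    and "map_degree g \<le> 2 \<or>
         (\<exists>Q. is_quotient_polynomial g Q \<and>
            (total_degree Q = 1 \<or> (\<forall>m. Poly_Mapping.lookup Q m \<ge> 0)))"
  shows "(\<exists>h. fun_holomorphic_on h type1_domain \<and> h ` type1_domain \<subseteq> {z. cmod z < 1} \<and>
            equivalent_maps type1_domain type1_domain f (block_map h)) \<or>
         (CARD('r) = 2 \<and> (\<exists>p q. (UNIV :: 'r set) = {p, q} \<and> p \<noteq> q \<and>
            equivalent_maps type1_domain type1_domain f (quadratic_map_A p q))) \<or>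
         (CARD('r) = 2 \<and> (\<exists>p q. (UNIV :: 'r set) = {p, q} \<and> p \<noteq> q \<and>
            equivalent_maps type1_domain type1_domain f (quadratic_map_B p q)))"
proof -
  interpret monomial_ball_map g
    using assms(1,6,7) by unfold_locales (auto simp: proper_ball_rational_map_def)
  obtain Q where Q: "norm_poly g = sign_poly * Q" "\<And>\<mu>. Poly_Mapping.lookup Q \<mu> \<ge> 0"
    using quotient_nonneg[OF assms(6,9)] by blast
  have "continuous_on type1_domain f"
    using assms(3) by (intro continuous_at_imp_continuous_on) (auto simp: mat_holomorphic_on_iff intro: cdiff_at_imp_isCont)
  note rel = induced_map_relation[OF assms(8) this]
  have other: "\<exists>q. (UNIV :: 'r set) = {p, q} \<and> p \<noteq> q" if card: "CARD('r) = 2" for p :: 'r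
  proof -
    obtain q where q: "q \<noteq> p" using exists_other[OF assms(1)] by blast
    then have "card {p, q} = CARD('r)" using card by simp
    then have "{p, q} = UNIV" by (intro card_subset_eq) auto
    with q show ?thesis by auto
  qed
  from Q show ?thesis
  proof (cases rule: monomial_map_cases)
    case (linear c)
    then show ?thesis using linear_case[OF assms(2,3) linear rel] by blast
  next
    case (binomial i j c)
    obtain q where q: "(UNIV :: 'r set) = {i, q}" "i \<noteq> q" using other[OF binomial(1)] by blast
    have "equivalent_maps type1_domain type1_domain f (quadratic_map_A i q)"
      by (rule binomial_case[OF assms(2,3) rel binomial(2,3) q])
    then show ?thesis using binomial(1) q by blast
  next
    case (quadrinomial c)
    \<comment> \<open>The polynomial is symmetric in the indices, so any element can serve as the
      first one.\<close>
    obtain q where q: "(UNIV :: 'r set) = {undefined, q}" "undefined \<noteq> q" using other[OF quadrinomial(1)] by blast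
    have "equivalent_maps type1_domain type1_domain f (quadratic_map_B undefined q)"
      by (rule quadrinomial_case[OF assms(2,3) rel quadrinomial(2,3) q])
    then show ?thesis using quadrinomial(1) q by blast
  qed
qed


end
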